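(* Let $d\in\{1,2\}$, let $L^d$ be a symmetric link function satisfying Property B, suppose the input variables satisfy Assumption I, and for $t\ge 0$ let $A_n(t)=n^{-1/2}((S^{(n)}_{L^d(i,j)}(t)))_{1\le i,j\le n}$. Let $p\in\mathbb N$, $\mathbb T_p=\{t_0,\dots,t_p\}$ with $0\le t_0<t_1<\dots<t_p$, and let $A_{r,n}=n^{-1/2}(A_n(t_r)-A_n(t_{r-1}))$, $1\le r\le p$. Let $g=A_{r_1,n}\cdots A_{r_l,n}$ be a monomial, with $l\ge1$ and $r_1,\dots,r_l\in\{1,\dots,p\}$. (i) Assume that the limits $\lim_{n\to\infty}\#\Pi(\chi_g(w))/n^{1+m}$ exist for all $w\in\mathcal P_2(2m,g)$, $m\ge1$. Then, with $k_r=\tfrac12\#\{j: r_j=r\}$, $$\lim_{n\to\infty}\frac{\mathbb E\,\mathrm{Trace}(A_{r_1,n}\cdots A_{r_l,n})}{n}=\begin{cases}0,& l=2m-1,\\[4pt]\displaystyle\prod_{r=1}^{p}(t_r-t_{r-1})^{k_r}\sum_{w\in\mathcal P_2(2m,g)}\lim_{n\to\infty}\frac{\#\Pi(\chi_g(w))}{n^{1+m}},& l=2m,\end{cases}$$ for all $m\ge1$ (the right side is $0$ if $\mathcal P_2(2m,g)$ is empty). Consequently, if these limits exist for all such monomials $g$ (for all $p$ and $\mathbb T_p$), one can fix self-adjoint indeterminates $A(t)$, $t\ge0$, let $\tilde{\mathcal A}$ be the algebra generated by $\bigcup_{p\in\mathbb N}\bigcup_{\mathbb T_p}\mathcal A(\mathbb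 T_p)$, where $\mathcal A(\mathbb T_p)$ is the polynomial algebra over $\mathbb C$ generated by $\{A(t):t\in\mathbb T_p\}$, and define a state $\tilde\tau$ on $\tilde{\mathcal A}$ by $$\tilde\tau(h(\{A(t):t\in\mathbb T_q\}))=\lim_{n\to\infty}n^{-1}\mathbb E\,\mathrm{Trace}\big(h(\{n^{-1/2}A_n(t):t\in\mathbb T_q\})\big)$$ for all $q\ge1$ and all polynomials $h$; then the process $\{n^{-1/2}A_n(t)\}_{t\ge0}$ in $(\mathcal M_n(\mathcal A_{\mathbb P}),n^{-1}\mathbb E\,\mathrm{Trace})$ converges algebraically to $\{A(t)\}_{t\ge0}$ in $(\tilde{\mathcal A},\tilde\tau)$. (ii) If $L^2(i,j)=(\max\{i,j\},\min\{i,j\})$, then the limits $\lim_{n\to\infty}\#\Pi(\chi_g(w))/n^{1+m}$ exist for all $w\in\mathcal P_2(2m,g)$, $m\ge1$, and all such monomials $g$ (for all $p$ and $\mathbb T_p$), and $\{A(t)\}_{t\ge0}$ is a free Brownian motion. Similarly, if $L^1(i,j)=n/2-|n/2-|i-j||$, $1\le i,j\le n$, then the joint moments of $\{A(t)\}_{t\ge0}$ agree with those of a standard Brownian motion.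
   Context: All random variables live on a probability space $(\Omega,\mathcal F,\mathbb P)$; $\mathcal A_{\mathbb P}=\cap_{1\le p<\infty}L^p(\mathbb P)$ and $\mathcal M_n(\mathcal A_{\mathbb P})$ is the algebra of $n\times n$ matrices with entries in $\mathcal A_{\mathbb P}$. $[x]$ is the greatest integer $\le x$. Assumption I: $\{X_{i,j,k},X_{i,k}: i,j\ge0,\ k\ge1\}$ are independent real random variables with mean zero and variance one, and for each $l\ge3$, $\sup_{i,j,k}\mathbb E[|X_{i,j,k}|^l+|X_{i,k}|^l]<\infty$. Random walks: $S^{(n)}_{i,j}(t)=\sum_{k=1}^{[nt]}X_{i,j,k}$ and $S^{(n)}_i(t)=\sum_{k=1}^{[nt]}X_{i,k}$ (empty sums are $0$). Link function: for $d\in\{1,2\}$, a sequence of functions $L^d=L^d_n:\{1,\dots,n\}^2\to\mathbb Z^d$ (with values in the index set of the input variables). It is symmetric if $L^d(i,j)=L^d(j,i)$ for all $i,j$. Property B: $\sup_n\sup_{r\in\mathbb Z_+^d}\sup_{1\le i\le n}\#\{j:1\le j\le n,\ L^d(i,j)=r\}<\infty$. The matrix uses the walks $S^{(n)}_{i,j}$ if $d=2$ and $S^{(n)}_i$ if $d=1$. Circuits and words: a circuit of length $l$ is a function $\pi:\{0,1,\dots,l\}\to\{1,\dots,n\}$ with $\pi(0)=\pi(l)$. A word of length $l$ is a sequence of $l$ letters whose first occurrences are in alphabetical order (equivalently a partition of $\{1,\dots,l\}$); $w(i)$ is its $i$th letter. $\Pi(w)$ (depending on $n$) is the set of circuits $\pi$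 of length $l$ such that $w(i)=w(j)$ if and only if $L^d(\pi(i-1),\pi(i))=L^d(\pi(j-1),\pi(j))$. A word is pair-matched if each letter appears exactly twice; $\mathcal P_2(2m)$ is the set of pair-matched words of length $2m$. For a monomial $g$ of length $2m$ with indices $r_1,\dots,r_{2m}$, an indexed word carries the index $r_j$ on its $j$th letter, letters with different indices being different; $\mathcal P_2(2m,g)$ is the set of indexed words in which each indexed letter appears exactly twice (so the two positions $i,j$ of a letter satisfy $r_i=r_j$), and $\chi_g:\mathcal P_2(2m,g)\to\mathcal P_2(2m)$ is the map dropping the indices. Algebraic convergence: $\{A_n(t)\}_{t\ge0}$ in $(\mathcal A_n,\tau_n)$ converges algebraically to $\{A(t)\}_{t\ge 0}$ in $(\mathcal A,\tau)$ if for all finitely many times $s_1,\dots,s_q$ and every non-commutative polynomial $h$, $\tau_n(h(A_n(s_1),\dots,A_n(s_q)))\to\tau(h(A(s_1),\dots,A(s_q)))$. Free Brownian motion: a collection $\{B(t)\}_{t\ge0}$ of self-adjoint elements of a $*$-probability space such that $B(0)=0$; increments over successive disjoint intervals are freely independent; and for $s,t\ge0$, $B(s+t)-B(s)$ has the semicircle distribution with mean $0$ and variance $t$ (density $\frac1{2\pi t}\sqrt{4t-x^2}$ on $[-2\sqrt t,2\sqrt t]$). Statements about the limit (such as $A(0)=0$) are understood at the level of joint moments with respect to $\tilde\tau$. *)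

theory Defs
  imports
    "HOL-Probability.Probability"
    "HOL-Library.Poly_Mapping"
    "Jordan_Normal_Form.Matrix"
    "Jordan_Normal_Form.VS_Connect"
begin

section \<open>Input variables, walks and link functions\<close>

text \<open>
  A point of the index set \<open>\<int>\<^sub>+\<^sup>d\<close> is a list of \<open>d\<close> naturals, so that \<open>X [i, j] k\<close> and \<open>X [i] k\<close>
  are the input variables for \<open>d = 2\<close> and \<open>d = 1\<close>. A link function takes the size \<open>n\<close>
  and the two matrix indices, which run over \<open>{1..n}\<close>.
\<close>

type_synonym 'w input = "nat list \<Rightarrow> nat \<Rightarrow> 'w \<Rightarrow> real"
type_synonym link = "nat \<Rightarrow> nat \<Rightarrow> nat \<Rightarrow> nat list"

definition input_indices :: "(nat list \<times> nat) set" where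
  "input_indices = {(r, k). length r \<in> {1, 2} \<and> 1 \<le> k}"

definition assumption_I :: "'w measure \<Rightarrow> 'w input \<Rightarrow> bool" where
  "assumption_I M X \<longleftrightarrow>
     prob_space.indep_vars M (\<lambda>_. borel) (\<lambda>(r, k). X r k) input_indices \<and>
     (\<forall>(r, k) \<in> input_indices.
        integrable M (X r k) \<and> integrable M (\<lambda>\<omega>. (X r k \<omega>)\<^sup>2) \<and>
        prob_space.expectation M (X r k) = 0 \<and> prob_space.variance M (X r k) = 1) \<and>
     (\<forall>l\<ge>3. \<exists>C. \<forall>i j k. 1 \<le> k \<longrightarrow>
        integrable M (\<lambda>\<omega>. \<bar>X [i, j] k \<omega>\<bar> ^ l + \<bar>X [i] k \<omega>\<bar> ^ l) \<and>
        prob_space.expectation M (\<lambda>\<omega>. \<bar>X [i, j] k \<omega>\<bar> ^ l + \<bar>X [i] k \<omega>\<bar> ^ l) \<le> C)"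

definition walk :: "'w input \<Rightarrow> nat \<Rightarrow> nat list \<Rightarrow> real \<Rightarrow> 'w \<Rightarrow> real" where
  "walk X n r t \<omega> = (\<Sum>k = 1..nat \<lfloor>real n * t\<rfloor>. X r k \<omega>)"

definition link_function :: "nat \<Rightarrow> link \<Rightarrow> bool" where
  "link_function d L \<longleftrightarrow> (\<forall>n. \<forall>i\<in>{1..n}. \<forall>j\<in>{1..n}. length (L n i j) = d)"

definition symmetric_link :: "link \<Rightarrow> bool" where
  "symmetric_link L \<longleftrightarrow> (\<forall>n. \<forall>i\<in>{1..n}. \<forall>j\<in>{1..n}. L n i j = L n j i)"

definition property_B :: "nat \<Rightarrow> link \<Rightarrow> bool" where
  "property_B d L \<longleftrightarrow>
     (\<exists>C. \<forall>n. \<forall>r. length r = d \<longrightarrow> (\<forall>i\<in>{1..n}. card {j \<in> {1..n}. L n i j = r} \<le> C))"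

definition wigner_link :: link where
  "wigner_link n i j = [max i j, min i j]"

text \<open>The real number below equals \<open>min \<bar>i - j\<bar> (n - \<bar>i - j\<bar>)\<close>, so \<open>nat\<close> and floor lose nothing.\<close>

definition circulant_link :: link where
  "circulant_link n i j = [nat \<lfloor>real n / 2 - \<bar>real n / 2 - \<bar>real i - real j\<bar>\<bar>\<rfloor>]"

lemma circulant_link_value:
  assumes "i \<in> {1..n}" "j \<in> {1..n}"
  shows "real (hd (circulant_link n i j)) = real n / 2 - \<bar>real n / 2 - \<bar>real i - real j\<bar>\<bar>"
proof -
  define k where "k = \<bar>int i - int j\<bar>"
  have k: "0 \<le> k" "k \<le> int n" "real_of_int k = \<bar>real i - real j\<bar>"
    using assms unfolding k_def by auto
  have eq: "real n / 2 - \<bar>real n / 2 - \<bar>real i - real j\<bar>\<bar> = real_of_int (min k (int n - k))"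
    unfolding k(3)[symmetric] by (auto simp: min_def abs_if)
  show ?thesis
    using k(1,2) unfolding circulant_link_def eq by simp
qed


section \<open>Circuits and words\<close>

definition circuits :: "nat \<Rightarrow> nat \<Rightarrow> (nat \<Rightarrow> nat) set" where
  "circuits n l = {\<pi> \<in> {0..l} \<rightarrow>\<^sub>E {1..n}. \<pi> 0 = \<pi> l}"

text \<open>Letters are the naturals \<open>0, 1, 2, \<dots>\<close>; the condition says that a new letter is the first unused one.\<close>

definition is_word :: "nat list \<Rightarrow> bool" where
  "is_word w \<longleftrightarrow> (\<forall>i<length w. w ! i \<in> set (take i w) \<or> w ! i = card (set (take i w)))"

definition Pi_circuits :: "link \<Rightarrow> nat \<Rightarrow> nat list \<Rightarrow> (nat \<Rightarrow> nat) set" where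
  "Pi_circuits L n w =
     {\<pi> \<in> circuits n (length w).
        \<forall>i\<in>{1..length w}. \<forall>j\<in>{1..length w}.
          w ! (i - 1) = w ! (j - 1) \<longleftrightarrow> L n (\<pi> (i - 1)) (\<pi> i) = L n (\<pi> (j - 1)) (\<pi> j)}"

definition pair_words :: "nat \<Rightarrow> nat list set" where
  "pair_words l = {w. length w = l \<and> is_word w \<and> (\<forall>a\<in>set w. count_list w a = 2)}"

text \<open>
  A monomial is given by its list \<open>rs\<close> of indices; an indexed word consists of pairs
  (letter, index). Letters with different indices are different letters, so that dropping
  the indices again gives a pair-matched word.
\<close>

definition indexed_pair_words :: "nat list \<Rightarrow> (nat \<times> nat) list set" where
  "indexed_pair_words rs =
     {v. map snd v = rs \<and> is_word (map fst v) \<and>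
         (\<forall>x\<in>set v. \<forall>y\<in>set v. snd x \<noteq> snd y \<longrightarrow> fst x \<noteq> fst y) \<and>
         (\<forall>x\<in>set v. count_list v x = 2)}"

definition drop_indices :: "(nat \<times> nat) list \<Rightarrow> nat list" where
  "drop_indices v = map fst v"

lemma drop_indices_pair_words:
  assumes "v \<in> indexed_pair_words rs"
  shows "drop_indices v \<in> pair_words (length rs)"
proof -
  have inj: "inj_on fst (set v)"
    using assms by (auto simp: indexed_pair_words_def inj_on_def) (metis fst_conv snd_conv)
  have "count_list (map fst v) (fst x) = count_list v x" if "x \<in> set v" for x
    using inj that
    by (auto simp: count_list_eq_length_filter filter_map o_def inj_on_def
             intro!: arg_cong[where f = length] filter_cong)
  then show ?thesis
    using assms by (auto simp: indexed_pair_words_def pair_words_def drop_indices_def)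
qed

definition word_density :: "link \<Rightarrow> nat \<Rightarrow> nat list \<Rightarrow> nat \<Rightarrow> real" where
  "word_density L m w n = real (card (Pi_circuits L n w)) / real n ^ (1 + m)"

text \<open>Existence of the limits for one monomial; the condition is void for odd length.\<close>

definition word_limits_exist :: "link \<Rightarrow> nat list \<Rightarrow> bool" where
  "word_limits_exist L rs \<longleftrightarrow>
     (\<forall>m\<ge>1. length rs = 2 * m \<longrightarrow>
        (\<forall>v\<in>indexed_pair_words rs. convergent (word_density L m (drop_indices v))))"

definition all_word_limits_exist :: "link \<Rightarrow> bool" where
  "all_word_limits_exist L \<longleftrightarrow>
     (\<forall>p. \<forall>rs. rs \<noteq> [] \<and> set rs \<subseteq> {1..p} \<longrightarrow> word_limits_exist L rs)"


section \<open>Non-commutative probability spaces\<close>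

record 'a star_alg = "(complex, 'a) module" +
  star :: "'a \<Rightarrow> 'a"

locale star_algebra = ring A + Module.module "class_ring :: complex ring" A
  for A :: "('a, 'm) star_alg_scheme" (structure) +
  assumes smult_mult_left: "x \<in> carrier A \<Longrightarrow> y \<in> carrier A \<Longrightarrow> (c \<odot> x) \<otimes> y = c \<odot> (x \<otimes> y)"
    and smult_mult_right: "x \<in> carrier A \<Longrightarrow> y \<in> carrier A \<Longrightarrow> x \<otimes> (c \<odot> y) = c \<odot> (x \<otimes> y)"
    and star_closed: "x \<in> carrier A \<Longrightarrow> star A x \<in> carrier A"
    and star_star: "x \<in> carrier A \<Longrightarrow> star A (star A x) = x"
    and star_add: "x \<in> carrier A \<Longrightarrow> y \<in> carrier A \<Longrightarrow> star A (x \<oplus> y) = star A x \<oplus> star A y"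
    and star_smult: "x \<in> carrier A \<Longrightarrow> star A (c \<odot> x) = cnj c \<odot> star A x"
    and star_mult: "x \<in> carrier A \<Longrightarrow> y \<in> carrier A \<Longrightarrow> star A (x \<otimes> y) = star A y \<otimes> star A x"

locale star_prob_space = star_algebra A
  for A :: "('a, 'm) star_alg_scheme" (structure) and \<tau> :: "'a \<Rightarrow> complex" +
  assumes state_add: "x \<in> carrier A \<Longrightarrow> y \<in> carrier A \<Longrightarrow> \<tau> (x \<oplus> y) = \<tau> x + \<tau> y"
    and state_smult: "x \<in> carrier A \<Longrightarrow> \<tau> (c \<odot> x) = c * \<tau> x"
    and state_one: "\<tau> \<one> = 1"
    and state_positive: "x \<in> carrier A \<Longrightarrow> \<tau> (star A x \<otimes> x) \<in> \<real> \<and> 0 \<le> Re (\<tau> (star A x \<otimes> x))"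

definition alg_prod :: "('a, 'm) star_alg_scheme \<Rightarrow> 'a list \<Rightarrow> 'a" where
  "alg_prod A xs = foldr (\<otimes>\<^bsub>A\<^esub>) xs \<one>\<^bsub>A\<^esub>"

inductive_set gen_alg :: "('a, 'm) star_alg_scheme \<Rightarrow> 'a set \<Rightarrow> 'a set"
  for A :: "('a, 'm) star_alg_scheme" and S :: "'a set" where
  one: "\<one>\<^bsub>A\<^esub> \<in> gen_alg A S"
| incl: "x \<in> S \<Longrightarrow> x \<in> gen_alg A S"
| add: "x \<in> gen_alg A S \<Longrightarrow> y \<in> gen_alg A S \<Longrightarrow> x \<oplus>\<^bsub>A\<^esub> y \<in> gen_alg A S"
| mult: "x \<in> gen_alg A S \<Longrightarrow> y \<in> gen_alg A S \<Longrightarrow> x \<otimes>\<^bsub>A\<^esub> y \<in> gen_alg A S"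
| smult: "x \<in> gen_alg A S \<Longrightarrow> c \<odot>\<^bsub>A\<^esub> x \<in> gen_alg A S"

definition freely_independent ::
  "('a, 'm) star_alg_scheme \<Rightarrow> ('a \<Rightarrow> complex) \<Rightarrow> 'i set \<Rightarrow> ('i \<Rightarrow> 'a set) \<Rightarrow> bool" where
  "freely_independent A \<tau> I \<B> \<longleftrightarrow>
     (\<forall>k\<ge>1. \<forall>\<iota> x.
        (\<forall>i<k. \<iota> i \<in> I \<and> x i \<in> \<B> (\<iota> i) \<and> \<tau> (x i) = 0) \<and>
        (\<forall>i. Suc i < k \<longrightarrow> \<iota> i \<noteq> \<iota> (Suc i)) \<longrightarrow>
        \<tau> (alg_prod A (map x [0..<k])) = 0)"

definition has_distribution ::
  "('a, 'm) star_alg_scheme \<Rightarrow> ('a \<Rightarrow> complex) \<Rightarrow> 'a \<Rightarrow> real measure \<Rightarrow> bool" where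
  "has_distribution A \<tau> x \<mu> \<longleftrightarrow>
     (\<forall>k::nat. integrable \<mu> (\<lambda>u. u ^ k) \<and>
        \<tau> (x [^]\<^bsub>A\<^esub> k) = complex_of_real (\<integral>u. u ^ k \<partial>\<mu>))"

text \<open>The semicircle distribution with mean 0 and variance \<open>t\<close>; it degenerates to a point mass at \<open>t = 0\<close>.\<close>

definition semicircle :: "real \<Rightarrow> real measure" where
  "semicircle t =
     (if t = 0 then return borel 0
      else density lborel (\<lambda>x. ennreal
        (indicator {- 2 * sqrt t..2 * sqrt t} x * sqrt (4 * t - x\<^sup>2) / (2 * pi * t))))"

text \<open>
  The condition \<open>B 0 = 0\<close> is understood at the level of joint moments:
  every joint moment of the process with a factor \<open>B 0\<close> vanishes.
\<close>

definition free_brownian_motion ::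
  "('a, 'm) star_alg_scheme \<Rightarrow> ('a \<Rightarrow> complex) \<Rightarrow> (real \<Rightarrow> 'a) \<Rightarrow> bool" where
  "free_brownian_motion A \<tau> B \<longleftrightarrow>
     star_prob_space A \<tau> \<and>
     (\<forall>t\<ge>0. B t \<in> carrier A \<and> star A (B t) = B t) \<and>
     (\<forall>x\<in>gen_alg A (B ` {0..}). \<forall>y\<in>gen_alg A (B ` {0..}).
        \<tau> (x \<otimes>\<^bsub>A\<^esub> B 0 \<otimes>\<^bsub>A\<^esub> y) = 0) \<and>
     (\<forall>p. \<forall>t::nat \<Rightarrow> real. 0 \<le> t 0 \<and> (\<forall>r\<in>{1..p}. t (r - 1) < t r) \<longrightarrow>
        freely_independent A \<tau> {1..p} (\<lambda>r. gen_alg A {B (t r) \<ominus>\<^bsub>A\<^esub> B (t (r - 1))})) \<and>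
     (\<forall>s\<ge>0. \<forall>t\<ge>0. has_distribution A \<tau> (B (s + t) \<ominus>\<^bsub>A\<^esub> B s) (semicircle t))"


section \<open>Non-commutative polynomials\<close>

text \<open>
  Polynomials in non-commuting self-adjoint indeterminates are the elements of the monoid
  algebra over \<open>\<complex>\<close> of the free monoid. The free monoid is a copy of the type of lists,
  written additively because \<open>poly_mapping\<close> convolves along the addition of its keys.
\<close>

datatype 'v ncmono = NCMono (letters: "'v list")

instantiation ncmono :: (type) monoid_add
begin

definition zero_ncmono :: "'a ncmono" where
  "zero_ncmono = NCMono []"

definition plus_ncmono :: "'a ncmono \<Rightarrow> 'a ncmono \<Rightarrow> 'a ncmono" where
  "plus_ncmono u v = NCMono (letters u @ letters v)"

instance
  by standard (simp_all add: zero_ncmono_def plus_ncmono_def)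

end

type_synonym 'v ncpoly = "'v ncmono \<Rightarrow>\<^sub>0 complex"

definition ncvar :: "'v \<Rightarrow> 'v ncpoly" where
  "ncvar v = Poly_Mapping.single (NCMono [v]) 1"

definition ncpolys :: "'v set \<Rightarrow> 'v ncpoly set" where
  "ncpolys T = {h. \<forall>w\<in>Poly_Mapping.keys h. set (letters w) \<subseteq> T}"

definition ncstar :: "'v ncpoly \<Rightarrow> 'v ncpoly" where
  "ncstar h = (\<Sum>w\<in>Poly_Mapping.keys h.
     Poly_Mapping.single (NCMono (rev (letters w))) (cnj (Poly_Mapping.lookup h w)))"

definition free_star_alg :: "'v set \<Rightarrow> 'v ncpoly star_alg" where
  "free_star_alg T =
     \<lparr>carrier = ncpolys T, mult = (*), one = 1, zero = 0, add = (+),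
      smult = (\<lambda>c h. Poly_Mapping.single 0 c * h), star = ncstar\<rparr>"

text \<open>\<open>nc_eval A a h\<close> is \<open>h\<close> with each indeterminate \<open>v\<close> replaced by the element \<open>a v\<close> of \<open>A\<close>.\<close>

definition nc_eval :: "('a, 'm) star_alg_scheme \<Rightarrow> ('v \<Rightarrow> 'a) \<Rightarrow> 'v ncpoly \<Rightarrow> 'a" where
  "nc_eval A a h =
     (\<Oplus>\<^bsub>A\<^esub>w\<in>Poly_Mapping.keys h.
        Poly_Mapping.lookup h w \<odot>\<^bsub>A\<^esub> alg_prod A (map a (letters w)))"

definition converges_algebraically ::
  "(nat \<Rightarrow> ('a, 'm) star_alg_scheme) \<Rightarrow> (nat \<Rightarrow> 'a \<Rightarrow> complex) \<Rightarrow> (nat \<Rightarrow> real \<Rightarrow> 'a) \<Rightarrow>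
   ('b, 'k) star_alg_scheme \<Rightarrow> ('b \<Rightarrow> complex) \<Rightarrow> (real \<Rightarrow> 'b) \<Rightarrow> bool" where
  "converges_algebraically \<A> \<tau> a A \<tau>' b \<longleftrightarrow>
     (\<forall>q. \<forall>s::nat \<Rightarrow> real. (\<forall>i<q. 0 \<le> s i) \<longrightarrow>
        (\<forall>h\<in>ncpolys {..<q}.
           (\<lambda>n. \<tau> n (nc_eval (\<A> n) (\<lambda>i. a n (s i)) h))
             \<longlonglongrightarrow> \<tau>' (nc_eval A (\<lambda>i. b (s i)) h)))"


section \<open>Random matrices\<close>

text \<open>A matrix with entries in an algebra of random variables is represented as a matrix-valued function on \<open>\<Omega>\<close>.\<close>

type_synonym 'w rmat = "'w \<Rightarrow> complex Matrix.mat"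

definition all_Lp :: "'w measure \<Rightarrow> ('w \<Rightarrow> complex) set" where
  "all_Lp M = {f \<in> borel_measurable M. \<forall>p::real. 1 \<le> p \<longrightarrow> integrable M (\<lambda>\<omega>. norm (f \<omega>) powr p)}"

definition rmat_alg :: "'w measure \<Rightarrow> nat \<Rightarrow> 'w rmat star_alg" where
  "rmat_alg M n =
     \<lparr>carrier = {A. (\<forall>\<omega>. A \<omega> \<in> carrier_mat n n) \<and>
                    (\<forall>i<n. \<forall>j<n. (\<lambda>\<omega>. A \<omega> $$ (i, j)) \<in> all_Lp M)},
      mult = (\<lambda>A B \<omega>. A \<omega> * B \<omega>), one = (\<lambda>_. 1\<^sub>m n), zero = (\<lambda>_. 0\<^sub>m n n),
      add = (\<lambda>A B \<omega>. A \<omega> + B \<omega>), smult = (\<lambda>c A \<omega>. c \<cdot>\<^sub>m A \<omega>),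
      star = (\<lambda>A \<omega>. map_mat cnj (transpose_mat (A \<omega>)))\<rparr>"

definition mean_trace :: "'w measure \<Rightarrow> nat \<Rightarrow> 'w rmat \<Rightarrow> complex" where
  "mean_trace M n A = (\<integral>\<omega>. (\<Sum>i<n. A \<omega> $$ (i, i)) \<partial>M) / of_nat n"

text \<open>Matrix positions are numbered from 0, hence the shift in the arguments of the link function.\<close>

definition walk_matrix :: "'w input \<Rightarrow> link \<Rightarrow> nat \<Rightarrow> real \<Rightarrow> 'w rmat" where
  "walk_matrix X L n t \<omega> =
     Matrix.mat n n (\<lambda>(i, j). complex_of_real (walk X n (L n (Suc i) (Suc j)) t \<omega> / sqrt (real n)))"

definition scaled_matrix :: "'w input \<Rightarrow> link \<Rightarrow> nat \<Rightarrow> real \<Rightarrow> 'w rmat" where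
  "scaled_matrix X L n t \<omega> = complex_of_real (1 / sqrt (real n)) \<cdot>\<^sub>m walk_matrix X L n t \<omega>"

definition increment_matrix :: "'w input \<Rightarrow> link \<Rightarrow> (nat \<Rightarrow> real) \<Rightarrow> nat \<Rightarrow> nat \<Rightarrow> 'w rmat" where
  "increment_matrix X L t n r \<omega> =
     complex_of_real (1 / sqrt (real n)) \<cdot>\<^sub>m
       (walk_matrix X L n (t r) \<omega> - walk_matrix X L n (t (r - 1)) \<omega>)"


section \<open>The limit process\<close>

text \<open>
  The indeterminate \<open>A(t)\<close> is \<open>ncvar t\<close>. The algebra generated by the polynomial algebras
  \<open>\<A>(T)\<close>, \<open>T\<close> a finite set of times, is their union, which consists of all polynomials in the
  \<open>A(t)\<close>, \<open>t \<ge> 0\<close>.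
\<close>

definition limit_alg :: "real ncpoly star_alg" where
  "limit_alg = free_star_alg {0..}"

lemma carrier_limit_alg:
  "carrier limit_alg = (\<Union>T\<in>{T. finite T \<and> T \<subseteq> {0..}}. ncpolys T)"
proof -
  have "\<exists>T. finite T \<and> T \<subseteq> {0..} \<and> h \<in> ncpolys T" if "h \<in> ncpolys {0..}" for h :: "real ncpoly"
    using that
    by (intro exI[of _ "\<Union>w\<in>Poly_Mapping.keys h. set (letters w)"]) (auto simp: ncpolys_def)
  then show ?thesis
    by (auto simp: limit_alg_def free_star_alg_def) (auto simp: ncpolys_def)
qed

definition limit_state :: "'w measure \<Rightarrow> 'w input \<Rightarrow> link \<Rightarrow> real ncpoly \<Rightarrow> complex" where
  "limit_state M X L h = lim (\<lambda>n. mean_trace M n (nc_eval (rmat_alg M n) (scaled_matrix X L n) h))"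


section \<open>Brownian motion\<close>

definition standard_brownian_motion :: "'b measure \<Rightarrow> (real \<Rightarrow> 'b \<Rightarrow> real) \<Rightarrow> bool" where
  "standard_brownian_motion N W \<longleftrightarrow>
     prob_space N \<and>
     (\<forall>t\<ge>0. W t \<in> borel_measurable N) \<and>
     (AE \<omega> in N. W 0 \<omega> = 0) \<and>
     (\<forall>p. \<forall>t::nat \<Rightarrow> real. 0 \<le> t 0 \<and> (\<forall>r\<in>{1..p}. t (r - 1) < t r) \<longrightarrow>
        prob_space.indep_vars N (\<lambda>_. borel) (\<lambda>r \<omega>. W (t r) \<omega> - W (t (r - 1)) \<omega>) {1..p}) \<and>
     (\<forall>s\<ge>0. \<forall>t>0. distributed N lborel (\<lambda>\<omega>. W (s + t) \<omega> - W s \<omega>) (normal_density 0 (sqrt t))) \<and>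
     (AE \<omega> in N. continuous_on {0..} (\<lambda>t. W t \<omega>))"

end

theory Submission
  imports Defs
begin

text \<open>
  Expanding the trace turns the mean trace of a monomial into a sum over closed walks of mixed moments of
  the walk increments, which are independent and centred and are indexed by a link value and a time
  interval. A walk contributes only if each of its indices occurs at least twice. By Property B the number of
  walks whose link values are equal according to a given word with \<open>k\<close> letters is \<open>O(n\<^bsup>1+k\<^esup>)\<close>, so that in the
  limit only the pair-matched words survive whose paired positions carry the same time interval; such a word
  contributes its density times a product of variances.

  For the link \<open>(max i j, min i j)\<close>, two adjacent equal letters of a word can be cancelled at the cost of a
  relative error \<open>O(1/n)\<close>, while the walks of a pair-matched word of length \<open>2m\<close> without adjacent equal letters
  visit at most \<open>m\<close> vertices. So the density of a word is \<open>1\<close> or \<open>0\<close> according as a stack reduces the word to the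
  empty word or not. Reading the indexed words from left to right, their number is a vacuum moment of sums of
  creation and annihilation operators on the full Fock space, which are free and semicircular.

  For the circulant link, interchanging two consecutive steps of a walk interchanges the corresponding letters.
  Hence every pair-matched word has as many walks as \<open>aabbcc\<dots>\<close>, and cancelling pairs shows that its density
  is \<open>1\<close>. The number of indexed words is the corresponding moment of independent Gaussian variables.
\<close>

section \<open>Words and walks\<close>

text \<open>Deleting letters destroys the normal form of a word, so walks are counted for arbitrary
  lists up to equality pattern (\<open>same_kernel\<close>); normalised words return only where
  closed walks are classified and indexed words are counted. Circuits become lists of vertices, so
  that inserting a step or moving one vertex is list surgery. Words in the \<open>A(t)\<close> are
  expanded on a finite time grid that starts at 0: they telescope into words in increments, whose
  limits are known. Positivity of the state cannot be seen from the combinatorial formula; it is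
  inherited from the mean traces at finite size. For freeness no Hilbert space is built: the
  operators act on all complex functions of words, and only the value at the empty word, the vacuum
  coefficient, is read off. A single colour acts as the free Jacobi matrix, whose recursion is also
  that of the Chebyshev polynomials; this yields the semicircle law. Brownian moments are expanded
  on the same grid, so that the comparison is made term by term.\<close>

definition same_kernel :: "'a list \<Rightarrow> 'b list \<Rightarrow> bool" where
  "same_kernel w es \<longleftrightarrow> length w = length es \<and>
     (\<forall>i<length w. \<forall>j<length w. w ! i = w ! j \<longleftrightarrow> es ! i = es ! j)"

lemma same_kernel_length: "same_kernel w es \<Longrightarrow> length es = length w"
  by (simp add: same_kernel_def)

text \<open>The working form of the notion: equal patterns differ by an injective relabelling, so
  list surgery becomes surgery on \<open>map f w\<close>. The relabelling reads off the value at one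
  chosen position of each letter.\<close>

lemma same_kernel_iff_map:
  "same_kernel w es \<longleftrightarrow> (\<exists>f. inj_on f (set w) \<and> es = map f w)"
proof
  assume k: "same_kernel w es"
  define p where "p a = (SOME i. i < length w \<and> w ! i = a)" for a
  have p: "p a < length w \<and> w ! p a = a" if "a \<in> set w" for a
    unfolding p_def by (rule someI_ex) (use that in \<open>auto simp: in_set_conv_nth\<close>)
  have inj: "inj_on (\<lambda>a. es ! p a) (set w)"
  proof (rule inj_onI)
    fix a b assume "a \<in> set w" "b \<in> set w" "es ! p a = es ! p b"
    then show "a = b" using k p[of a] p[of b] unfolding same_kernel_def by metis
  qed
  moreover have "es = map (\<lambda>a. es ! p a) w"
  proof (rule nth_equalityI)
    show "length es = length (map (\<lambda>a. es ! p a) w)" using k by (simp add: same_kernel_def)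
    fix i assume "i < length es"
    then have i: "i < length w" using k by (simp add: same_kernel_def)
    have "w ! p (w ! i) = w ! i" "p (w ! i) < length w" using p[of "w ! i"] i by auto
    then have "es ! p (w ! i) = es ! i" using k i unfolding same_kernel_def by blast
    then show "es ! i = map (\<lambda>a. es ! p a) w ! i" using i by simp
  qed
  ultimately show "\<exists>f. inj_on f (set w) \<and> es = map f w" by blast
next
  assume "\<exists>f. inj_on f (set w) \<and> es = map f w"
  then show "same_kernel w es" by (auto simp: same_kernel_def inj_on_eq_iff)
qed

lemma same_kernel_sym: "same_kernel w es \<Longrightarrow> same_kernel es w"
  by (auto simp: same_kernel_def)

lemma same_kernel_trans: "same_kernel u v \<Longrightarrow> same_kernel v w \<Longrightarrow> same_kernel u w"
  by (auto simp: same_kernel_def)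

lemma same_kernel_snoc:
  "same_kernel (w @ [a]) (es @ [e]) \<longleftrightarrow>
     same_kernel w es \<and> (\<forall>i<length w. w ! i = a \<longleftrightarrow> es ! i = e)"
proof
  assume "same_kernel (w @ [a]) (es @ [e])"
  then have l: "length w = length es"
    and k: "\<And>i j. i < Suc (length w) \<Longrightarrow> j < Suc (length w) \<Longrightarrow>
      (w @ [a]) ! i = (w @ [a]) ! j \<longleftrightarrow> (es @ [e]) ! i = (es @ [e]) ! j"
    unfolding same_kernel_def by auto
  have "w ! i = w ! j \<longleftrightarrow> es ! i = es ! j" if "i < length w" "j < length w" for i j
    using k[of i j] that l by (auto simp: nth_append)
  moreover have "w ! i = a \<longleftrightarrow> es ! i = e" if "i < length w" for i
    using k[of i "length w"] that l by (auto simp: nth_append)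
  ultimately show "same_kernel w es \<and> (\<forall>i<length w. w ! i = a \<longleftrightarrow> es ! i = e)"
    using l by (auto simp: same_kernel_def)
next
  assume *: "same_kernel w es \<and> (\<forall>i<length w. w ! i = a \<longleftrightarrow> es ! i = e)"
  then show "same_kernel (w @ [a]) (es @ [e])"
    by (auto simp: same_kernel_def nth_append less_Suc_eq)
qed

text \<open>The core of cancelling an adjacent pair. As \<open>a\<close> occurs nowhere else, its
  value must be new; conversely a relabelling of \<open>u @ v\<close> extends by sending
  \<open>a\<close> to the new value.\<close>

lemma same_kernel_pair_insert:
  assumes "a \<notin> set (u @ v)" "length u = length u'" "length v = length v'"
  shows "same_kernel (u @ [a, a] @ v) (u' @ [e, e'] @ v') \<longleftrightarrow>
     e = e' \<and> e \<notin> set (u' @ v') \<and> same_kernel (u @ v) (u' @ v')"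
proof
  assume "same_kernel (u @ [a, a] @ v) (u' @ [e, e'] @ v')"
  then obtain f where f: "inj_on f (set (u @ [a, a] @ v))"
    and e: "u' @ [e, e'] @ v' = map f (u @ [a, a] @ v)"
    by (auto simp: same_kernel_iff_map)
  then have *: "u' = map f u" "v' = map f v" "e = f a" "e' = f a"
    using assms(2,3) by (auto simp: append_eq_append_conv)
  have "inj_on f (set (u @ v))" using f by (rule inj_on_subset) auto
  moreover have "f a \<notin> f ` set (u @ v)"
    using f assms(1) by (auto simp: inj_on_def)
  ultimately show "e = e' \<and> e \<notin> set (u' @ v') \<and> same_kernel (u @ v) (u' @ v')"
    unfolding same_kernel_iff_map * by auto
next
  assume *: "e = e' \<and> e \<notin> set (u' @ v') \<and> same_kernel (u @ v) (u' @ v')"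
  then obtain f where f: "inj_on f (set (u @ v))" "u' @ v' = map f (u @ v)"
    by (auto simp: same_kernel_iff_map)
  then have uv: "u' = map f u" "v' = map f v" using assms(2) by auto
  define g where "g = f(a := e)"
  have g: "map g u = map f u" "map g v = map f v" "g a = e"
    using assms(1) by (auto simp: g_def)
  have "inj_on g (set (u @ [a, a] @ v))"
    using f(1) assms(1) * unfolding g_def uv
    by (auto simp: inj_on_def)
  moreover have "u' @ [e, e'] @ v' = map g (u @ [a, a] @ v)"
    using uv g * by simp
  ultimately show "same_kernel (u @ [a, a] @ v) (u' @ [e, e'] @ v')"
    unfolding same_kernel_iff_map by blast
qed

lemma same_kernel_swap:
  assumes "same_kernel (u @ [a, b] @ v) (u' @ [e, e'] @ v')" "length u = length u'"
  shows "same_kernel (u @ [b, a] @ v) (u' @ [e', e] @ v')"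
proof -
  obtain f where f: "inj_on f (set (u @ [a, b] @ v))"
    and e: "u' @ [e, e'] @ v' = map f (u @ [a, b] @ v)"
    using assms(1) by (auto simp: same_kernel_iff_map)
  then have *: "u' = map f u" "v' = map f v" "e = f a" "e' = f b"
    using assms(2) by (auto simp: append_eq_append_conv)
  have "set (u @ [b, a] @ v) = set (u @ [a, b] @ v)" by auto
  then show ?thesis using f unfolding same_kernel_iff_map *
    by (intro exI[of _ f]) (auto simp: insert_commute)
qed

lemma same_kernel_count_list:
  assumes "inj_on f (set w)" "a \<in> set w"
  shows "count_list (map f w) (f a) = count_list w a"
  using assms by (auto simp: count_list_eq_length_filter filter_map o_def inj_on_def
             intro!: arg_cong[where f = length] filter_cong)

lemma is_word_Nil [simp]: "is_word []"
  by (simp add: is_word_def)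

lemma is_word_snoc:
  "is_word (w @ [a]) \<longleftrightarrow> is_word w \<and> (a \<in> set w \<or> a = card (set w))"
  by (auto simp: is_word_def less_Suc_eq nth_append)

lemma set_is_word: "is_word w \<Longrightarrow> set w = {..<card (set w)}"
proof (induction w rule: rev_induct)
  case (snoc a w)
  then have w: "set w = {..<card (set w)}" and a: "a \<in> set w \<or> a = card (set w)"
    by (auto simp: is_word_snoc)
  from a show ?case
  proof
    assume "a \<in> set w"
    then have "set (w @ [a]) = set w" by auto
    with w show ?thesis by simp
  next
    assume "a = card (set w)"
    then have "set (w @ [a]) = {..<Suc (card (set w))}"
      using arg_cong[OF w, of "insert a"] by (simp add: lessThan_Suc)
    then show ?thesis by (metis card_lessThan)
  qed
qed simp

lemma ex_word_same_kernel: "\<exists>w. is_word w \<and> same_kernel w es"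
proof (induction es rule: rev_induct)
  case Nil
  show ?case by (rule exI[of _ "[]"]) (simp add: same_kernel_def)
next
  case (snoc e es)
  then obtain w where w: "is_word w" "same_kernel w es" by blast
  obtain f where f: "inj_on f (set w)" "es = map f w"
    using w(2) by (auto simp: same_kernel_iff_map)
  show ?case
  proof (cases "e \<in> set es")
    case True
    then obtain a where a: "a \<in> set w" "e = f a" using f by auto
    have "es @ [e] = map f (w @ [a])" "inj_on f (set (w @ [a]))"
      using f a by (auto simp: insert_absorb)
    then show ?thesis using w(1) a
      by (intro exI[of _ "w @ [a]"]) (auto simp: is_word_snoc same_kernel_iff_map)
  next
    case False
    define a where "a = card (set w)"
    have a: "a \<notin> set w" using set_is_word[OF w(1)] unfolding a_def by auto
    define g where "g = f(a := e)"
    have "map g w = map f w" "g a = e" using a by (auto simp: g_def)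
    then have "es @ [e] = map g (w @ [a])" using f by simp
    moreover have "inj_on g (set (w @ [a]))"
      using f a False unfolding g_def by (auto simp: inj_on_def)
    ultimately show ?thesis using w(1)
      by (intro exI[of _ "w @ [a]"]) (auto simp: is_word_snoc same_kernel_iff_map a_def)
  qed
qed

text \<open>With existence, this gives exactly one normalised word per equality pattern, so that
  \<open>word_of\<close> sorts closed walks into disjoint classes.\<close>

lemma is_word_unique:
  "is_word w \<Longrightarrow> is_word w' \<Longrightarrow> same_kernel w w' \<Longrightarrow> w = w'"
proof (induction w arbitrary: w' rule: rev_induct)
  case Nil
  then show ?case by (simp add: same_kernel_def)
next
  case (snoc a w)
  then obtain u b where w': "w' = u @ [b]"
    by (metis append_Nil2 length_0_conv rev_exhaust same_kernel_length snoc_eq_iff_butlast)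
  have k: "same_kernel w u" "\<forall>i<length w. w ! i = a \<longleftrightarrow> u ! i = b"
    using snoc.prems(3) unfolding w' same_kernel_snoc by auto
  then have u: "u = w" using snoc unfolding w' is_word_snoc by blast
  then have "a \<in> set w \<Longrightarrow> a = b" "b \<in> set w \<Longrightarrow> a = b"
    using k(2) by (auto simp: in_set_conv_nth)
  then show ?case using snoc.prems(1,2) unfolding w' u is_word_snoc by auto
qed

definition words :: "nat \<Rightarrow> nat list set" where
  "words l = {w. length w = l \<and> is_word w}"

lemma finite_words [simp]: "finite (words l)"
proof -
  have "words l \<subseteq> {w. set w \<subseteq> {..<l} \<and> length w = l}"
  proof
    fix w assume "w \<in> words l"
    then have w: "is_word w" "length w = l" by (auto simp: words_def)
    then have "{..<card (set w)} \<subseteq> {..<l}" using card_length[of w] by simp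
    then have "set w \<subseteq> {..<l}" unfolding set_is_word[OF w(1), symmetric] .
    with w show "w \<in> {w. set w \<subseteq> {..<l} \<and> length w = l}" by simp
  qed
  then show ?thesis by (rule finite_subset) (simp add: finite_lists_length_eq)
qed

definition word_of :: "'a list \<Rightarrow> nat list" where
  "word_of es = (SOME w. is_word w \<and> same_kernel w es)"

lemma word_of: "is_word (word_of es)" "same_kernel (word_of es) es"
  using someI_ex[OF ex_word_same_kernel[of es]] unfolding word_of_def by auto

lemma word_of_eq_iff: "is_word w \<Longrightarrow> word_of es = w \<longleftrightarrow> same_kernel w es"
  by (metis is_word_unique same_kernel_sym same_kernel_trans word_of)

lemma word_of_in_words: "word_of es \<in> words (length es)"
  using word_of[of es] by (auto simp: words_def same_kernel_def)

section \<open>Walks on the vertices 1 to n and their sequences of link values\<close>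

fun edges :: "('v \<Rightarrow> 'v \<Rightarrow> 'e) \<Rightarrow> 'v list \<Rightarrow> 'e list" where
  "edges L (x # y # zs) = L x y # edges L (y # zs)"
| "edges L _ = []"

lemma length_edges [simp]: "length (edges L xs) = length xs - 1"
  by (induction L xs rule: edges.induct) auto

lemma edges_append: "edges L (xs @ x # ys) = edges L (xs @ [x]) @ edges L (x # ys)"
  by (induction L xs rule: edges.induct) (cases ys; simp)+

lemma edges_snoc: "xs \<noteq> [] \<Longrightarrow> edges L (xs @ [y]) = edges L xs @ [L (last xs) y]"
  by (induction L xs rule: edges.induct) auto

lemma edges_nth: "Suc i < length xs \<Longrightarrow> edges L xs ! i = L (xs ! i) (xs ! Suc i)"
proof (induction L xs arbitrary: i rule: edges.induct)
  case (1 L x y zs)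
  then show ?case by (cases i) auto
qed auto

definition walks :: "nat \<Rightarrow> nat \<Rightarrow> nat list set" where
  "walks n l = {xs. length xs = Suc l \<and> set xs \<subseteq> {1..n}}"

definition closed_walks :: "nat \<Rightarrow> nat \<Rightarrow> nat list set" where
  "closed_walks n l = {xs \<in> walks n l. hd xs = last xs}"

definition word_walks :: "link \<Rightarrow> nat \<Rightarrow> 'a list \<Rightarrow> nat list set" where
  "word_walks L n w = {xs \<in> closed_walks n (length w). same_kernel w (edges (L n) xs)}"

lemma finite_walks [simp]: "finite (walks n l)"
  unfolding walks_def using finite_lists_length_eq[of "{1..n}" "Suc l"]
  by (simp add: conj_commute)

lemma finite_closed_walks [simp]: "finite (closed_walks n l)"
  unfolding closed_walks_def by simp

lemma finite_word_walks [simp]: "finite (word_walks L n w)"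
  unfolding word_walks_def by simp

lemma bij_betw_circuits:
  "bij_betw (\<lambda>\<pi>. map \<pi> [0..<Suc l]) (circuits n l) (closed_walks n l)"
proof (rule bij_betw_byWitness[where f' = "\<lambda>xs. \<lambda>i\<in>{0..l}. xs ! i"])
  show "\<forall>\<pi>\<in>circuits n l. (\<lambda>i\<in>{0..l}. map \<pi> [0..<Suc l] ! i) = \<pi>"
  proof
    fix \<pi> assume "\<pi> \<in> circuits n l"
    then have "\<pi> \<in> extensional {0..l}" by (auto simp: circuits_def PiE_def)
    then show "(\<lambda>i\<in>{0..l}. map \<pi> [0..<Suc l] ! i) = \<pi>"
      by (auto simp: fun_eq_iff extensional_def restrict_def nth_append simp del: upt_Suc)
  qed
  show "\<forall>xs\<in>closed_walks n l. map (\<lambda>i\<in>{0..l}. xs ! i) [0..<Suc l] = xs"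
    by (auto simp: closed_walks_def walks_def list_eq_iff_nth_eq simp del: upt_Suc)
  have hd_last: "hd xs = last xs \<longleftrightarrow> xs ! 0 = xs ! l" if "length xs = Suc l" for xs :: "nat list"
    using that by (cases "xs = []") (auto simp: hd_conv_nth last_conv_nth)
  show "(\<lambda>\<pi>. map \<pi> [0..<Suc l]) ` circuits n l \<subseteq> closed_walks n l"
    by (auto simp: closed_walks_def walks_def hd_last circuits_def PiE_def Pi_def simp del: upt_Suc)
  show "(\<lambda>xs. \<lambda>i\<in>{0..l}. xs ! i) ` closed_walks n l \<subseteq> circuits n l"
    by (auto simp: closed_walks_def walks_def hd_last circuits_def subset_iff)
qed

lemma card_Pi_circuits: "card (Pi_circuits L n w) = card (word_walks L n w)"
proof -
  let ?l = "length w" and ?m = "\<lambda>\<pi>. map \<pi> [0..<Suc (length w)]"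
  have k: "same_kernel w (edges (L n) (?m \<pi>)) \<longleftrightarrow>
     (\<forall>i\<in>{1..?l}. \<forall>j\<in>{1..?l}.
        w ! (i - 1) = w ! (j - 1) \<longleftrightarrow> L n (\<pi> (i - 1)) (\<pi> i) = L n (\<pi> (j - 1)) (\<pi> j))" for \<pi> :: "nat \<Rightarrow> nat"
  proof -
    have e: "edges (L n) (?m \<pi>) ! i = L n (\<pi> i) (\<pi> (Suc i))" if "i < ?l" for i
      using that by (subst edges_nth) (auto simp del: upt_Suc)
    have "(\<forall>i\<in>{1..?l}. P i) \<longleftrightarrow> (\<forall>i<?l. P (Suc i))" for P
      by (metis One_nat_def Suc_le_eq Suc_le_lessD Suc_pred atLeastAtMost_iff le_add1 plus_1_eq_Suc)
    then show ?thesis by (simp add: same_kernel_def e del: upt_Suc)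
  qed
  have "bij_betw ?m (Pi_circuits L n w) (word_walks L n w)"
  proof (rule bij_betw_subset[OF bij_betw_circuits[of ?l n]])
    show "Pi_circuits L n w \<subseteq> circuits n ?l" by (auto simp: Pi_circuits_def)
    have "word_walks L n w = {xs \<in> ?m ` circuits n ?l. same_kernel w (edges (L n) xs)}"
      using bij_betw_circuits[of ?l n] unfolding word_walks_def bij_betw_def by simp
    also have "\<dots> = ?m ` {\<pi> \<in> circuits n ?l. same_kernel w (edges (L n) (?m \<pi>))}"
      by blast
    finally show "?m ` Pi_circuits L n w = word_walks L n w"
      unfolding Pi_circuits_def k by simp
  qed
  then show ?thesis by (rule bij_betw_same_card)
qed

lemma sum_closed_walks_by_word:
  "(\<Sum>xs\<in>closed_walks n l. F xs) = (\<Sum>w\<in>words l. \<Sum>xs\<in>word_walks L n w. F xs)"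
proof -
  have "(\<Sum>xs\<in>closed_walks n l. F xs) =
     (\<Sum>w\<in>words l. \<Sum>xs\<in>{xs \<in> closed_walks n l. word_of (edges (L n) xs) = w}. F xs)"
  proof (rule sum.group[symmetric])
    show "(\<lambda>xs. word_of (edges (L n) xs)) ` closed_walks n l \<subseteq> words l"
    proof
      fix w assume "w \<in> (\<lambda>xs. word_of (edges (L n) xs)) ` closed_walks n l"
      then obtain xs where "xs \<in> closed_walks n l" "w = word_of (edges (L n) xs)" by blast
      then show "w \<in> words l"
        using word_of_in_words[of "edges (L n) xs"] by (simp add: closed_walks_def walks_def)
    qed
  qed simp_all
  also have "\<dots> = (\<Sum>w\<in>words l. \<Sum>xs\<in>word_walks L n w. F xs)"
    by (intro sum.cong refl) (auto simp: word_walks_def words_def word_of_eq_iff)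
  finally show ?thesis .
qed

text \<open>Property B for all \<open>r\<close> at once: values of the wrong length have empty
  fibres. The requirement \<open>1 \<le> C\<close> makes the powers of \<open>C\<close>
  monotone.\<close>

definition fibre_bound :: "link \<Rightarrow> nat \<Rightarrow> bool" where
  "fibre_bound L C \<longleftrightarrow> 1 \<le> C \<and> (\<forall>n r. \<forall>i\<in>{1..n}. card {j \<in> {1..n}. L n i j = r} \<le> C)"

lemma property_B_fibre_bound:
  assumes "link_function d L" "property_B d L"
  obtains C where "fibre_bound L C"
proof -
  obtain C where C: "\<And>n r i. length r = d \<Longrightarrow> i \<in> {1..n} \<Longrightarrow> card {j \<in> {1..n}. L n i j = r} \<le> C"
    using assms(2) unfolding property_B_def by blast
  have "card {j \<in> {1..n}. L n i j = r} \<le> max 1 C" if "i \<in> {1..n}" for n i r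
  proof (cases "length r = d")
    case True
    then show ?thesis using C[OF True that] by simp
  next
    case False
    then have *: "{j \<in> {1..n}. L n i j = r} = {}"
      using assms(1) that unfolding link_function_def by blast
    show ?thesis unfolding * by simp
  qed
  then have "fibre_bound L (max 1 C)" by (auto simp: fibre_bound_def)
  then show thesis by (rule that)
qed

text \<open>The walk is built from left to right. Open walks are included because the circulant link
  needs the count for the tail of a closed walk, which does not close up itself.\<close>

lemma card_walks_with_kernel_le:
  assumes "fibre_bound L C"
  shows "card {xs \<in> walks n (length w). same_kernel w (edges (L n) xs)}
           \<le> n * n ^ card (set w) * C ^ length w"
proof (induction w rule: rev_induct)
  case Nil
  have "{xs \<in> walks n 0. same_kernel [] (edges (L n) xs)} \<subseteq> (\<lambda>x. [x]) ` {1..n}"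
    by (auto simp: walks_def length_Suc_conv)
  then have "card {xs \<in> walks n 0. same_kernel [] (edges (L n) xs)} \<le> card ((\<lambda>x. [x]) ` {1..n})"
    by (intro card_mono) auto
  also have "\<dots> \<le> n" using card_image_le[of "{1..n}" "\<lambda>x. [x]"] by simp
  finally show ?case by simp
next
  case (snoc a w)
  let ?S = "\<lambda>w. {xs \<in> walks n (length w). same_kernel w (edges (L n) xs)}"
  let ?T = "\<lambda>ys. {y \<in> {1..n}. same_kernel (w @ [a]) (edges (L n) (ys @ [y]))}"
  define B where "B = (if a \<in> set w then C else n)"
  have "?S (w @ [a]) \<subseteq> (\<lambda>(ys, y). ys @ [y]) ` (SIGMA ys:?S w. ?T ys)"
  proof
    fix xs assume xs: "xs \<in> ?S (w @ [a])"
    then obtain ys y where e: "xs = ys @ [y]"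
      by (cases xs rule: rev_exhaust) (auto simp: walks_def)
    with xs have "ys \<noteq> []" by (auto simp: walks_def)
    then have "same_kernel w (edges (L n) ys)"
      using xs unfolding e by (auto simp: edges_snoc same_kernel_snoc)
    then show "xs \<in> (\<lambda>(ys, y). ys @ [y]) ` (SIGMA ys:?S w. ?T ys)"
      using xs unfolding e by (auto simp: walks_def image_iff)
  qed
  then have "card (?S (w @ [a])) \<le> card ((\<lambda>(ys, y). ys @ [y]) ` (SIGMA ys:?S w. ?T ys))"
    by (intro card_mono finite_imageI finite_SigmaI) auto
  also have "\<dots> \<le> card (SIGMA ys:?S w. ?T ys)"
    by (intro card_image_le finite_SigmaI) auto
  also have "\<dots> = (\<Sum>ys\<in>?S w. card (?T ys))"
    by (intro card_SigmaI) auto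
  also have "\<dots> \<le> (\<Sum>ys\<in>?S w. B)"
  proof (rule sum_mono)
    fix ys assume ys: "ys \<in> ?S w"
    then have ne: "ys \<noteq> []" by (auto simp: walks_def)
    show "card (?T ys) \<le> B"
    proof (cases "a \<in> set w")
      case True
      then obtain i where i: "i < length w" "w ! i = a" by (auto simp: in_set_conv_nth)
      have "?T ys \<subseteq> {y \<in> {1..n}. L n (last ys) y = edges (L n) ys ! i}"
        using ne i by (auto simp: edges_snoc same_kernel_snoc)
      then have "card (?T ys) \<le> card {y \<in> {1..n}. L n (last ys) y = edges (L n) ys ! i}"
        by (intro card_mono) auto
      also have "last ys \<in> {1..n}" using ys ne by (auto simp: walks_def dest!: last_in_set)
      then have "card {y \<in> {1..n}. L n (last ys) y = edges (L n) ys ! i} \<le> C"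
        using assms by (auto simp: fibre_bound_def)
      finally show ?thesis using True by (simp add: B_def)
    next
      case False
      have "card (?T ys) \<le> card {1..n}" by (intro card_mono) auto
      then show ?thesis using False by (simp add: B_def)
    qed
  qed
  also have "\<dots> = card (?S w) * B" by simp
  also have "\<dots> \<le> n * n ^ card (set w) * C ^ length w * B"
    using snoc.IH by (rule mult_right_mono) simp
  also have "\<dots> \<le> n * n ^ card (set (w @ [a])) * C ^ length (w @ [a])"
  proof (cases "a \<in> set w")
    case True
    then show ?thesis by (simp add: B_def insert_absorb)
  next
    case False
    have "C ^ length w \<le> C * C ^ length w" using assms by (auto simp: fibre_bound_def)
    then show ?thesis using False by (simp add: B_def mult.assoc mult.left_commute)
  qed
  finally show ?case .
qed

lemma card_word_walks_le:
  assumes "fibre_bound L C"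
  shows "card (word_walks L n w) \<le> n * n ^ card (set w) * C ^ length w"
proof -
  have "card (word_walks L n w) \<le> card {xs \<in> walks n (length w). same_kernel w (edges (L n) xs)}"
    by (intro card_mono) (auto simp: word_walks_def closed_walks_def)
  with card_walks_with_kernel_le[OF assms, of n w] show ?thesis by linarith
qed

section \<open>Densities of words\<close>

text \<open>Agrees with \<open>word_density\<close> at even length, but takes the exponent from the
  list itself and allows letters of any type, so that inductions may pass to shorter lists.\<close>

definition walk_density :: "link \<Rightarrow> 'a list \<Rightarrow> nat \<Rightarrow> real" where
  "walk_density L w n = real (card (word_walks L n w)) / real n ^ (1 + length w div 2)"

definition paired :: "'a list \<Rightarrow> bool" where
  "paired w \<longleftrightarrow> (\<forall>a\<in>set w. count_list w a = 2)"

lemma paired_length: "paired w \<Longrightarrow> length w = 2 * card (set w)"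
  using sum_count_set[of w "set w"] by (simp add: paired_def)

lemma paired_pairD:
  assumes "paired (u @ [a, a] @ v)"
  shows "a \<notin> set (u @ v)" "paired (u @ v)"
proof -
  have "count_list (u @ [a, a] @ v) a = 2" using assms unfolding paired_def by (metis in_set_conv_decomp append_Cons)
  then have 0: "count_list u a = 0" "count_list v a = 0" by auto
  then show a: "a \<notin> set (u @ v)" by (simp add: count_list_0_iff)
  show "paired (u @ v)" unfolding paired_def
  proof
    fix b assume b: "b \<in> set (u @ v)"
    then have "b \<noteq> a" using a by auto
    moreover have "count_list (u @ [a, a] @ v) b = 2" using b assms unfolding paired_def by auto
    ultimately show "count_list (u @ v) b = 2" by simp
  qed
qed

lemma split_three:
  assumes "length xs = i + 3 + k"
  obtains p x y z q where "xs = p @ x # y # z # q" "length p = i" "length q = k"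
proof -
  define r where "r = drop i xs"
  have "length r = Suc (Suc (Suc k))" using assms by (simp add: r_def)
  then obtain x y z q where "r = x # y # z # q" "length q = k"
    by (auto simp: length_Suc_conv)
  moreover have "xs = take i xs @ r" by (simp add: r_def)
  moreover have "length (take i xs) = i" using assms by simp
  ultimately show thesis using that[of "take i xs" x y z q] by simp
qed

lemma word_walks_split:
  assumes "xs \<in> word_walks L n (u @ [a, b] @ v)"
  obtains p x y z q where "xs = p @ x # y # z # q" "length p = length u" "length q = length v"
proof -
  have "length xs = length u + 3 + length v"
    using assms by (auto simp: word_walks_def closed_walks_def walks_def)
  then show thesis by (rule split_three) (rule that)
qed

lemma edges_three:
  "edges L (p @ x # y # z # q) = edges L (p @ [x]) @ [L x y, L y z] @ edges L (z # q)"
  by (subst edges_append) simp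

lemma hd_last_three:
  "hd (p @ x # y # z # q) = hd (p @ [x])" "last (p @ x # y # z # q) = last (z # q)"
  by (cases p; simp)+

lemma word_walks_insert_iff:
  assumes "symmetric_link L" "a \<notin> set (u @ v)" "length p = length u" "length q = length v"
  shows "p @ x # y # x # q \<in> word_walks L n (u @ [a, a] @ v) \<longleftrightarrow>
     p @ x # q \<in> word_walks L n (u @ v) \<and> y \<in> {1..n} \<and> L n x y \<notin> set (edges (L n) (p @ x # q))"
proof -
  have e: "edges (L n) (p @ x # q) = edges (L n) (p @ [x]) @ edges (L n) (x # q)"
    by (rule edges_append)
  have "L n y x = L n x y" if "x \<in> {1..n}" "y \<in> {1..n}"
    using that assms(1) unfolding symmetric_link_def by blast
  moreover have "hd (p @ x # q) = hd (p @ [x])" "last (p @ x # q) = last (x # q)"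
    by (cases p; simp)+
  moreover have "same_kernel (u @ [a, a] @ v) (edges (L n) (p @ [x]) @ [L n x y, L n y x] @ edges (L n) (x # q))
     \<longleftrightarrow> L n x y = L n y x \<and> L n x y \<notin> set (edges (L n) (p @ x # q)) \<and>
       same_kernel (u @ v) (edges (L n) (p @ x # q))"
    unfolding e using assms by (intro same_kernel_pair_insert) auto
  ultimately show ?thesis
    unfolding word_walks_def closed_walks_def walks_def mem_Collect_eq edges_three hd_last_three
    using assms(3,4) by auto
qed

text \<open>The walks that backtrack at the adjacent pair \<open>a\<close>, \<open>a\<close>. For
  the max-min link these are all walks of the word; for the circulant link the others turn out to be
  negligible.\<close>

definition returning_walks :: "link \<Rightarrow> nat \<Rightarrow> 'a list \<Rightarrow> 'a \<Rightarrow> 'a list \<Rightarrow> nat list set" where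
  "returning_walks L n u a v =
     {xs \<in> word_walks L n (u @ [a, a] @ v). xs ! length u = xs ! (length u + 2)}"

text \<open>A returning walk is a walk of \<open>u @ v\<close> together with the tip
  \<open>y\<close> of the detour. The tip is any vertex whose edge value is new, and each of the
  \<open>length (u @ v)\<close> used values excludes at most \<open>C\<close> vertices.\<close>

lemma card_returning_walks:
  assumes sym: "symmetric_link L" and a: "a \<notin> set (u @ v)" and C: "fibre_bound L C"
  shows "card (returning_walks L n u a v) \<le> n * card (word_walks L n (u @ v))"
    and "(n - C * length (u @ v)) * card (word_walks L n (u @ v)) \<le> card (returning_walks L n u a v)"
proof -
  let ?i = "length u"
  define T where "T zs = {y \<in> {1..n}. L n (zs ! ?i) y \<notin> set (edges (L n) zs)}" for zs
  define ins :: "nat list \<times> nat \<Rightarrow> nat list" where "ins = (\<lambda>(zs, y). take ?i zs @ zs ! ?i # y # drop ?i zs)"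
  have ins: "ins (p @ x # q, y) = p @ x # y # x # q" if "length p = ?i" for p x q y
    using that nth_append_length[of p x q] by (auto simp: ins_def)
  have nth: "(p @ x # q) ! ?i = x" if "length p = ?i" for p q and x :: nat
    using that by (metis nth_append_length)
  have split: "\<exists>p x q. zs = p @ x # q \<and> length p = ?i \<and> length q = length v"
    if "zs \<in> word_walks L n (u @ v)" for zs
  proof -
    have l: "length zs = Suc (length u + length v)"
      using that by (auto simp: word_walks_def closed_walks_def walks_def)
    then have "zs = take ?i zs @ zs ! ?i # drop (Suc ?i) zs" by (intro id_take_nth_drop) auto
    then show ?thesis using l by (intro exI conjI) auto
  qed
  have R: "returning_walks L n u a v = ins ` (SIGMA zs:word_walks L n (u @ v). T zs)"
  proof
    show "returning_walks L n u a v \<subseteq> ins ` (SIGMA zs:word_walks L n (u @ v). T zs)"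
    proof
      fix xs assume xs: "xs \<in> returning_walks L n u a v"
      then have mem: "xs \<in> word_walks L n (u @ [a, a] @ v)" by (simp add: returning_walks_def)
      then obtain p x y z q where e: "xs = p @ x # y # z # q" "length p = ?i" "length q = length v"
        by (rule word_walks_split)
      have "z = x" using xs unfolding e by (auto simp: returning_walks_def e(2) nth_append)
      then have "p @ x # q \<in> word_walks L n (u @ v)" "y \<in> T (p @ x # q)"
        using mem word_walks_insert_iff[OF sym a e(2,3)] by (auto simp: e T_def nth)
      moreover have "xs = ins (p @ x # q, y)" using ins e \<open>z = x\<close> by simp
      ultimately show "xs \<in> ins ` (SIGMA zs:word_walks L n (u @ v). T zs)" by blast
    qed
    show "ins ` (SIGMA zs:word_walks L n (u @ v). T zs) \<subseteq> returning_walks L n u a v"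
    proof
      fix xs assume "xs \<in> ins ` (SIGMA zs:word_walks L n (u @ v). T zs)"
      then obtain zs y where zs: "zs \<in> word_walks L n (u @ v)" "y \<in> T zs" "xs = ins (zs, y)" by auto
      then obtain p x q where e: "zs = p @ x # q" "length p = ?i" "length q = length v"
        using split by blast
      have xs: "xs = p @ x # y # x # q" using zs(3) ins e by simp
      have "y \<in> {1..n}" "L n x y \<notin> set (edges (L n) (p @ x # q))"
        using zs(2) unfolding e(1) T_def by (auto simp: nth[OF e(2)])
      then have "xs \<in> word_walks L n (u @ [a, a] @ v)"
        using zs(1) word_walks_insert_iff[OF sym a e(2,3)] unfolding xs e(1) by blast
      then show "xs \<in> returning_walks L n u a v"
        unfolding returning_walks_def xs by (simp add: nth_append e(2)[symmetric])
    qed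
  qed
  have inj: "inj_on ins (SIGMA zs:word_walks L n (u @ v). T zs)"
  proof (rule inj_onI)
    fix s t assume st: "s \<in> (SIGMA zs:word_walks L n (u @ v). T zs)"
      "t \<in> (SIGMA zs:word_walks L n (u @ v). T zs)" "ins s = ins t"
    obtain p x q y where s: "s = (p @ x # q, y)" "length p = ?i" "length q = length v"
      using st(1) split by (cases s) blast
    obtain p' x' q' y' where t: "t = (p' @ x' # q', y')" "length p' = ?i" "length q' = length v"
      using st(2) split by (cases t) blast
    show "s = t" using st(3) s t by (auto simp: ins)
  qed
  have fin: "finite (T zs)" for zs by (simp add: T_def)
  have card: "card (returning_walks L n u a v) = (\<Sum>zs\<in>word_walks L n (u @ v). card (T zs))"
    unfolding R card_image[OF inj] using fin by (intro card_SigmaI) auto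
  have "card (T zs) \<le> n" for zs
  proof -
    have "T zs \<subseteq> {1..n}" by (auto simp: T_def)
    then have "card (T zs) \<le> card {1..n}" by (intro card_mono) auto
    then show ?thesis by simp
  qed
  then show "card (returning_walks L n u a v) \<le> n * card (word_walks L n (u @ v))"
    unfolding card using sum_bounded_above[of "word_walks L n (u @ v)" "\<lambda>zs. card (T zs)" n]
    by (simp add: mult.commute)
  have "n - C * length (u @ v) \<le> card (T zs)" if zs: "zs \<in> word_walks L n (u @ v)" for zs
  proof -
    let ?E = "set (edges (L n) zs)"
    have len: "length zs = Suc (length (u @ v))" "set zs \<subseteq> {1..n}"
      using zs by (auto simp: word_walks_def closed_walks_def walks_def)
    then have "zs ! ?i \<in> set zs" by (intro nth_mem) simp
    then have x: "zs ! ?i \<in> {1..n}" using len(2) by blast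
    have "{1..n} - T zs = (\<Union>e\<in>?E. {y \<in> {1..n}. L n (zs ! ?i) y = e})" by (auto simp: T_def)
    then have "card ({1..n} - T zs) \<le> (\<Sum>e\<in>?E. card {y \<in> {1..n}. L n (zs ! ?i) y = e})"
      by (simp add: card_UN_le)
    also have "\<dots> \<le> (\<Sum>e\<in>?E. C)" using C x by (intro sum_mono) (auto simp: fibre_bound_def)
    also have "\<dots> \<le> C * length (u @ v)"
      using card_length[of "edges (L n) zs"] len by (simp add: mult.commute)
    also have "card ({1..n} - T zs) = n - card (T zs)"
      by (subst card_Diff_subset) (auto simp: T_def)
    finally show ?thesis by linarith
  qed
  then show "(n - C * length (u @ v)) * card (word_walks L n (u @ v)) \<le> card (returning_walks L n u a v)"
    unfolding card using sum_bounded_below[of "word_walks L n (u @ v)" "n - C * length (u @ v)" "\<lambda>zs. card (T zs)"]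
    by (simp add: mult.commute)
qed

text \<open>Inserting a backtrack multiplies the count by \<open>n\<close> up to a factor
  \<open>1 - O(1/n)\<close>, and two more letters raise the normalisation by exactly one power of
  \<open>n\<close>.\<close>

lemma returning_walks_density:
  assumes sym: "symmetric_link L" and a: "a \<notin> set (u @ v)" and C: "fibre_bound L C"
    and lim: "walk_density L (u @ v) \<longlonglongrightarrow> c"
  shows "(\<lambda>n. card (returning_walks L n u a v) / real n ^ (1 + length (u @ [a, a] @ v) div 2)) \<longlonglongrightarrow> c"
proof (rule tendsto_sandwich)
  let ?l = "length (u @ v)" and ?m = "length (u @ v) div 2"
  have m: "length (u @ [a, a] @ v) div 2 = Suc ?m" by simp
  let ?R = "\<lambda>n. card (returning_walks L n u a v) / real n ^ (1 + length (u @ [a, a] @ v) div 2)"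
  show "\<forall>\<^sub>F n in sequentially. ?R n \<le> walk_density L (u @ v) n"
    using eventually_gt_at_top[of 0]
  proof eventually_elim
    case (elim n)
    have "real (card (returning_walks L n u a v)) \<le> real (n * card (word_walks L n (u @ v)))"
      using card_returning_walks(1)[OF sym a C] by (rule of_nat_mono)
    then have "?R n \<le> (real n * card (word_walks L n (u @ v))) / real n ^ (1 + length (u @ [a, a] @ v) div 2)"
      by (intro divide_right_mono) auto
    also have "\<dots> = walk_density L (u @ v) n"
      using elim unfolding m walk_density_def by simp
    finally show ?case .
  qed
  show "\<forall>\<^sub>F n in sequentially. (1 - real (C * ?l) / real n) * walk_density L (u @ v) n \<le> ?R n"
    using eventually_gt_at_top[of 0]
  proof eventually_elim
    case (elim n)
    \<comment> \<open>Real subtraction may be negative where the subtraction of naturals is cut off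
      at 0, so this only weakens the lower bound.\<close>
    have "(real n - real (C * ?l)) * card (word_walks L n (u @ v)) \<le> real (n - C * ?l) * card (word_walks L n (u @ v))"
      by (intro mult_right_mono) linarith+
    also have "\<dots> = real ((n - C * ?l) * card (word_walks L n (u @ v)))" by simp
    also have "\<dots> \<le> real (card (returning_walks L n u a v))"
      using card_returning_walks(2)[OF sym a C] by (rule of_nat_mono)
    finally have "(real n - real (C * ?l)) * card (word_walks L n (u @ v)) / real n ^ (1 + length (u @ [a, a] @ v) div 2) \<le> ?R n"
      by (rule divide_right_mono) simp
    moreover have "(1 - real (C * ?l) / real n) * walk_density L (u @ v) n
        = (real n - real (C * ?l)) * card (word_walks L n (u @ v)) / real n ^ (1 + length (u @ [a, a] @ v) div 2)"
      using elim unfolding m walk_density_def by (simp add: field_simps)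
    ultimately show ?case by simp
  qed
  have "(\<lambda>n. (1 - real (C * ?l) / real n) * walk_density L (u @ v) n) \<longlonglongrightarrow> (1 - 0) * c"
    by (intro tendsto_intros lim_const_over_n lim)
  then show "(\<lambda>n. (1 - real (C * ?l) / real n) * walk_density L (u @ v) n) \<longlonglongrightarrow> c" by simp
qed fact

lemma density_Nil: "walk_density L [] \<longlonglongrightarrow> 1"
proof -
  have "walk_density L ([] :: 'a list) n = 1" if "n > 0" for n
  proof -
    have "word_walks L n ([] :: 'a list) = (\<lambda>x. [x]) ` {1..n}"
      by (auto simp: word_walks_def closed_walks_def walks_def same_kernel_def length_Suc_conv)
    then have "card (word_walks L n ([] :: 'a list)) = n"
      by (simp add: card_image inj_on_def)
    then show ?thesis using that by (simp add: walk_density_def)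
  qed
  then show ?thesis
    by (intro tendsto_eventually) (auto simp: eventually_at_top_linorder intro: exI[of _ 1])
qed

lemma density_negligible:
  assumes "\<And>n. n > 0 \<Longrightarrow> real (f n) \<le> K * real n ^ m"
  shows "(\<lambda>n. real (f n) / real n ^ (1 + m)) \<longlonglongrightarrow> 0"
proof (rule tendsto_sandwich[OF _ _ tendsto_const])
  show "(\<lambda>n. K / real n) \<longlonglongrightarrow> 0" by (rule lim_const_over_n)
  show "\<forall>\<^sub>F n in sequentially. real (f n) / real n ^ (1 + m) \<le> K / real n"
    using eventually_gt_at_top[of 0]
  proof eventually_elim
    case (elim n)
    have "real (f n) / real n ^ (1 + m) \<le> K * real n ^ m / real n ^ (1 + m)"
      using assms[OF elim] by (intro divide_right_mono) auto
    also have "\<dots> = K / real n" using elim by simp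
    finally show ?case .
  qed
qed auto

text \<open>The vertices of a walk have one of finitely many equality patterns, and a pattern with
  at most \<open>m\<close> letters is labelled in at most \<open>n ^ m\<close> ways.\<close>

lemma card_walks_few_vertices_le:
  assumes "n > 0"
  shows "card {xs \<in> walks n l. card (set xs) \<le> m} \<le> card (words (Suc l)) * n ^ m"
proof -
  let ?W = "{w \<in> words (Suc l). card (set w) \<le> m}"
  let ?F = "\<lambda>w. (\<lambda>f. map f w) ` (set w \<rightarrow>\<^sub>E {1..n})"
  have "{xs \<in> walks n l. card (set xs) \<le> m} \<subseteq> (\<Union>w\<in>?W. ?F w)"
  proof
    fix xs assume xs: "xs \<in> {xs \<in> walks n l. card (set xs) \<le> m}"
    obtain f where f: "inj_on f (set (word_of xs))" "xs = map f (word_of xs)"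
      using word_of(2)[of xs] by (auto simp: same_kernel_iff_map)
    let ?w = "word_of xs"
    have "set xs = f ` set ?w" using f(2) by (metis set_map)
    then have "card (set ?w) = card (set xs)" using f(1) by (simp add: card_image)
    moreover have "?w \<in> words (Suc l)"
      using word_of_in_words[of xs] xs by (simp add: walks_def)
    moreover have "restrict f (set ?w) \<in> set ?w \<rightarrow>\<^sub>E {1..n}" "xs = map (restrict f (set ?w)) ?w"
      using xs \<open>set xs = f ` set ?w\<close> f(2) by (auto simp: walks_def cong: map_cong)
    ultimately have "?w \<in> ?W" "xs \<in> ?F ?w" using xs by auto
    then show "xs \<in> (\<Union>w\<in>?W. ?F w)" by (rule UN_I)
  qed
  then have "card {xs \<in> walks n l. card (set xs) \<le> m} \<le> card (\<Union>w\<in>?W. ?F w)"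
    by (intro card_mono finite_UN_I finite_imageI finite_PiE) auto
  also have "\<dots> \<le> (\<Sum>w\<in>?W. card (?F w))" by (intro card_UN_le) auto
  also have "\<dots> \<le> (\<Sum>w\<in>?W. n ^ m)"
  proof (rule sum_mono)
    fix w assume w: "w \<in> ?W"
    have "card (?F w) \<le> card (set w \<rightarrow>\<^sub>E {1..n})" by (intro card_image_le finite_PiE) auto
    also have "\<dots> = n ^ card (set w)" by (simp add: card_funcsetE)
    also have "\<dots> \<le> n ^ m" using w assms by (intro power_increasing) auto
    finally show "card (?F w) \<le> n ^ m" .
  qed
  also have "\<dots> \<le> card (words (Suc l)) * n ^ m"
    by (simp add: card_mono)
  finally show ?thesis .
qed

section \<open>Densities for the link (max, min)\<close>

lemma link_function_wigner: "link_function 2 wigner_link"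
  by (simp add: link_function_def wigner_link_def)

lemma symmetric_wigner: "symmetric_link wigner_link"
  by (simp add: symmetric_link_def wigner_link_def max.commute min.commute)

lemma property_B_wigner: "property_B 2 wigner_link"
proof -
  have "card {j \<in> {1..n}. wigner_link n i j = r} \<le> 2" if "length r = 2" for n i :: nat and r
  proof -
    have "{j \<in> {1..n}. wigner_link n i j = r} \<subseteq> set r"
      by (auto simp: wigner_link_def max_def min_def)
    then have "card {j \<in> {1..n}. wigner_link n i j = r} \<le> card (set r)" by (intro card_mono) auto
    then show ?thesis using card_length[of r] that by simp
  qed
  then show ?thesis unfolding property_B_def by blast
qed

lemma wigner_fibre_bound: obtains C where "fibre_bound wigner_link C"
  using property_B_fibre_bound link_function_wigner property_B_wigner by blast

text \<open>The link value determines the unordered pair of endpoints, and two equal pairs that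
  share \<open>y\<close> have the same other endpoint.\<close>

lemma wigner_walk_returns:
  assumes "xs \<in> word_walks wigner_link n (u @ [a, a] @ v)"
  shows "xs ! length u = xs ! (length u + 2)"
proof -
  obtain p x y z q where e: "xs = p @ x # y # z # q" "length p = length u" "length q = length v"
    using assms by (rule word_walks_split)
  have "same_kernel (u @ [a, a] @ v) (edges (wigner_link n) (p @ [x]) @
      [wigner_link n x y, wigner_link n y z] @ edges (wigner_link n) (z # q))"
    using assms unfolding word_walks_def e(1) mem_Collect_eq edges_three by blast
  then obtain f where "edges (wigner_link n) (p @ [x]) @
      [wigner_link n x y, wigner_link n y z] @ edges (wigner_link n) (z # q) = map f (u @ [a, a] @ v)"
    by (auto simp: same_kernel_iff_map)
  then have "wigner_link n x y = wigner_link n y z"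
    using e(2) by (auto simp: append_eq_append_conv)
  then have "x = z" by (auto simp: wigner_link_def max_def min_def split: if_splits)
  then show ?thesis using e by (simp add: nth_append)
qed

text \<open>Incidences between the visited vertices and the \<open>length w div 2\<close> distinct
  edges are counted in two ways. An edge has at most two endpoints. A vertex other than the start is
  met by two distinct edges, since the edges before and after a visit differ; the start is met by at
  least one.\<close>

lemma wigner_few_vertices:
  assumes xs: "xs \<in> word_walks wigner_link n w" and w: "paired w" "distinct_adj w" "w \<noteq> []"
  shows "card (set xs) \<le> length w div 2"
proof -
  define E where "E = edges (wigner_link n) xs"
  have len: "length xs = Suc (length w)" and ends: "hd xs = last xs" and k: "same_kernel w E"
    using xs by (auto simp: word_walks_def closed_walks_def walks_def E_def)
  have lE: "length E = length w" using k by (simp add: same_kernel_def)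
  have "card (set E) = card (set w)"
    using k by (auto simp: same_kernel_iff_map card_image)
  then have cE: "2 * card (set E) = length w" using paired_length[OF w(1)] by simp
  have E: "E ! i = [max (xs ! i) (xs ! Suc i), min (xs ! i) (xs ! Suc i)]" if "i < length w" for i
    using that len unfolding E_def by (subst edges_nth) (auto simp: wigner_link_def)
  then have setE: "set (E ! i) = {xs ! i, xs ! Suc i}" if "i < length w" for i
    using that by (auto simp: max_def min_def)
  let ?I = "SIGMA e:set E. set e \<inter> set xs"
  let ?J = "SIGMA v:set xs. {e \<in> set E. v \<in> set e}"
  have "card ?J = card ?I"
    by (rule bij_betw_same_card[of "\<lambda>(v, e). (e, v)"])
      (auto simp: bij_betw_def inj_on_def image_iff)
  also have "\<dots> = (\<Sum>e\<in>set E. card (set e \<inter> set xs))" by (intro card_SigmaI) auto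
  also have "\<dots> \<le> (\<Sum>e\<in>set E. 2)"
  proof (rule sum_mono)
    fix e assume "e \<in> set E"
    then obtain i where "i < length w" "e = E ! i" using lE by (auto simp: in_set_conv_nth)
    then have "length e = 2" using E by simp
    then have "card (set e) \<le> 2" using card_length[of e] by simp
    moreover have "card (set e \<inter> set xs) \<le> card (set e)" by (intro card_mono) auto
    ultimately show "card (set e \<inter> set xs) \<le> 2" by simp
  qed
  finally have up: "card ?J \<le> length w" using cE by simp
  have h: "hd xs = xs ! 0" using len by (auto intro!: hd_conv_nth)
  have l: "last xs = xs ! length w" using len by (metis diff_Suc_1 last_conv_nth length_0_conv nat.distinct(1))
  have hs: "hd xs \<in> set xs" using len by (metis hd_in_set length_0_conv nat.distinct(1))
  have 1: "1 \<le> card {e \<in> set E. hd xs \<in> set e}"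
  proof -
    have "E ! 0 \<in> {e \<in> set E. hd xs \<in> set e}" using w(3) lE setE[of 0] h by auto
    then have "{e \<in> set E. hd xs \<in> set e} \<noteq> {}" by blast
    then show ?thesis by (simp add: card_gt_0_iff Suc_le_eq)
  qed
  have 2: "2 \<le> card {e \<in> set E. v \<in> set e}" if "v \<in> set xs - {hd xs}" for v
  proof -
    from that have "v \<in> set xs" by simp
    then obtain i where "i < length xs" "xs ! i = v" unfolding in_set_conv_nth by blast
    then have i: "i < Suc (length w)" "xs ! i = v" using len by auto
    \<comment> \<open>The walk begins and ends at \<open>hd xs\<close>, so any other vertex is
      visited at an inner position, with an edge on either side.\<close>
    have "i \<noteq> 0" using that i(2) h by (metis DiffD2 insertI1)
    moreover have "i \<noteq> length w" using that i(2) l ends by (metis DiffD2 insertI1)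
    ultimately
    obtain j where j: "i = Suc j" "Suc j < length w" using i by (cases i) auto
    have "w ! j \<noteq> w ! Suc j" using w(2) j(2) by (simp add: distinct_adj_conv_nth)
    then have ne: "E ! j \<noteq> E ! Suc j" using k j(2) by (auto simp: same_kernel_def)
    have "{E ! j, E ! Suc j} \<subseteq> {e \<in> set E. v \<in> set e}"
      using j i lE setE[of j] setE[of "Suc j"] by auto
    then have "card {E ! j, E ! Suc j} \<le> card {e \<in> set E. v \<in> set e}" by (intro card_mono) auto
    then show ?thesis using ne by simp
  qed
  have "card ?J = (\<Sum>v\<in>set xs. card {e \<in> set E. v \<in> set e})" by (intro card_SigmaI) auto
  also have "\<dots> = card {e \<in> set E. hd xs \<in> set e} + (\<Sum>v\<in>set xs - {hd xs}. card {e \<in> set E. v \<in> set e})"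
    using hs by (intro sum.remove) auto
  also have "\<dots> \<ge> 1 + (\<Sum>v\<in>set xs - {hd xs}. 2)"
    by (intro add_mono sum_mono 1 2)
  also have "(\<Sum>v\<in>set xs - {hd xs}. 2 :: nat) = 2 * (card (set xs) - 1)"
    using hs by simp
  \<comment> \<open>With \<open>V\<close> vertices and \<open>m\<close> edges this reads
    \<open>2 V - 1 \<le> 2 m\<close>, and parity improves it to \<open>V \<le> m\<close>.\<close>
  finally have "1 + 2 * (card (set xs) - 1) \<le> length w" using up by linarith
  moreover have "length w div 2 = card (set E)" using cE by linarith
  ultimately show ?thesis using cE by linarith
qed

lemma wigner_density_distinct_adj:
  assumes "paired w" "distinct_adj w" "w \<noteq> []"
  shows "walk_density wigner_link w \<longlonglongrightarrow> 0"
  unfolding walk_density_def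
proof (rule density_negligible)
  fix n :: nat assume n: "n > 0"
  let ?m = "length w div 2"
  have "card (word_walks wigner_link n w) \<le> card {xs \<in> walks n (length w). card (set xs) \<le> ?m}"
    using wigner_few_vertices[OF _ assms]
    by (intro card_mono) (auto simp: word_walks_def closed_walks_def)
  also have "\<dots> \<le> card (words (Suc (length w))) * n ^ ?m" by (rule card_walks_few_vertices_le[OF n])
  finally have "real (card (word_walks wigner_link n w)) \<le> real (card (words (Suc (length w))) * n ^ ?m)"
    by (rule of_nat_mono)
  then show "real (card (word_walks wigner_link n w)) \<le> real (card (words (Suc (length w)))) * real n ^ ?m"
    by simp
qed

text \<open>The first argument is a stack, top first, and letters are read from the left. Started
  with the empty stack on a pair-matched word, success means that the pairing is
  noncrossing.\<close>

fun reduces :: "'a list \<Rightarrow> 'a list \<Rightarrow> bool" where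
  "reduces s [] \<longleftrightarrow> s = []"
| "reduces [] (a # w) \<longleftrightarrow> reduces [a] w"
| "reduces (b # s) (a # w) \<longleftrightarrow> (if a = b then reduces s w else reduces (a # b # s) w)"

text \<open>The letters read so far have been replaced by the reversed stack, at no cost for the
  density. The stack never holds equal neighbours, so a nonempty stack at the end of the input is a
  word of density 0.\<close>

lemma wigner_density:
  "paired (rev s @ w) \<Longrightarrow> distinct_adj s \<Longrightarrow>
     walk_density wigner_link (rev s @ w) \<longlonglongrightarrow> of_bool (reduces s w)"
proof (induction s w rule: reduces.induct)
  case (1 s)
  then show ?case
    using wigner_density_distinct_adj[of "rev s"] density_Nil by (cases "s = []") auto
next
  case (2 a w)
  then show ?case by simp
next
  case (3 b s a w)
  show ?case
  proof (cases "a = b")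
    case True
    have p: "paired (rev s @ [a, a] @ w)" using "3.prems"(1) True by simp
    have "walk_density wigner_link (rev s @ w) \<longlonglongrightarrow> of_bool (reduces s w)"
      using 3 True paired_pairD[OF p] by (auto simp: distinct_adj_Cons)
    moreover obtain C where "fibre_bound wigner_link C" by (rule wigner_fibre_bound)
    ultimately have "(\<lambda>n. card (returning_walks wigner_link n (rev s) a w) /
        real n ^ (1 + length (rev s @ [a, a] @ w) div 2)) \<longlonglongrightarrow> of_bool (reduces s w)"
      by (intro returning_walks_density symmetric_wigner paired_pairD[OF p])
    \<comment> \<open>For this link every walk backtracks at an adjacent pair, so the count for
      returning walks is the full count.\<close>
    moreover have "returning_walks wigner_link n (rev s) a w = word_walks wigner_link n (rev s @ [a, a] @ w)" for n
      using wigner_walk_returns[of _ n "rev s" a w] unfolding returning_walks_def by blast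
    ultimately show ?thesis using True by (simp add: walk_density_def)
  next
    case False
    then show ?thesis using 3 by simp
  qed
qed

section \<open>Densities for the circulant link, whose value is the distance on a cycle of n
  points\<close>

definition cyclic_dist :: "nat \<Rightarrow> nat \<Rightarrow> nat \<Rightarrow> int" where
  "cyclic_dist n i j = min \<bar>int i - int j\<bar> (int n - \<bar>int i - int j\<bar>)"

lemma circulant_link_eq:
  assumes "i \<in> {1..n}" "j \<in> {1..n}"
  shows "circulant_link n i j = [nat (cyclic_dist n i j)]"
proof -
  define k where "k = \<bar>int i - int j\<bar>"
  have k: "real_of_int k = \<bar>real i - real j\<bar>" unfolding k_def by simp
  have "real n / 2 - \<bar>real n / 2 - \<bar>real i - real j\<bar>\<bar> = real_of_int (min k (int n - k))"
    unfolding k[symmetric] by (auto simp: min_def abs_if)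
  then show ?thesis unfolding circulant_link_def cyclic_dist_def k_def[symmetric] by simp
qed

lemma circulant_link_eq_iff:
  assumes "i \<in> {1..n}" "j \<in> {1..n}" "i' \<in> {1..n}" "j' \<in> {1..n}"
  shows "circulant_link n i j = circulant_link n i' j' \<longleftrightarrow> cyclic_dist n i j = cyclic_dist n i' j'"
proof -
  have "0 \<le> cyclic_dist n i j" if "i \<in> {1..n}" "j \<in> {1..n}" for i j
    using that unfolding cyclic_dist_def by auto
  then show ?thesis using assms by (simp add: circulant_link_eq eq_nat_nat_iff)
qed

lemma link_function_circulant: "link_function 1 circulant_link"
  by (simp add: link_function_def circulant_link_def)

lemma symmetric_circulant: "symmetric_link circulant_link"
  by (simp add: symmetric_link_def circulant_link_def abs_minus_commute)

text \<open>A vertex at the same cyclic distance as \<open>j0\<close>, with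
  \<open>k = \<bar>i - j0\<bar>\<close>, differs from \<open>i\<close> by plus or minus
  \<open>k\<close> or by plus or minus \<open>n - k\<close>; this is the bound 4.\<close>

lemma property_B_circulant: "property_B 1 circulant_link"
proof -
  have "card {j \<in> {1..n}. circulant_link n i j = r} \<le> 4" if i: "i \<in> {1..n}" for n i :: nat and r
  proof (cases "\<exists>j\<in>{1..n}. circulant_link n i j = r")
    case True
    then obtain j0 where j0: "j0 \<in> {1..n}" "circulant_link n i j0 = r" by blast
    define k where "k = \<bar>int i - int j0\<bar>"
    have "{j \<in> {1..n}. circulant_link n i j = r} \<subseteq>
        {nat (int i + k), nat (int i - k), nat (int i + int n - k), nat (int i - int n + k)}"
    proof
      fix j assume "j \<in> {j \<in> {1..n}. circulant_link n i j = r}"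
      then have j: "j \<in> {1..n}" "cyclic_dist n i j = cyclic_dist n i j0"
        using j0 i circulant_link_eq_iff by auto
      then have "\<bar>int i - int j\<bar> = k \<or> \<bar>int i - int j\<bar> = int n - k"
        unfolding cyclic_dist_def k_def[symmetric] by (auto simp: min_def split: if_splits)
      then have "int j \<in> {int i + k, int i - k, int i + int n - k, int i - int n + k}"
        by (auto simp: abs_if split: if_splits)
      then show "j \<in> {nat (int i + k), nat (int i - k), nat (int i + int n - k), nat (int i - int n + k)}"
        by (metis (no_types) insert_iff empty_iff nat_int)
    qed
    then have "card {j \<in> {1..n}. circulant_link n i j = r} \<le>
      card {nat (int i + k), nat (int i - k), nat (int i + int n - k), nat (int i - int n + k)}"
      by (intro card_mono) auto
    also have "\<dots> \<le> 4" by (simp add: card_insert_if)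
    finally show ?thesis .
  next
    case False
    then have *: "{j \<in> {1..n}. circulant_link n i j = r} = {}" by blast
    show ?thesis unfolding * by simp
  qed
  then show ?thesis unfolding property_B_def by blast
qed

text \<open>The representative in \<open>{1..n}\<close> of \<open>x + z - y\<close> modulo
  \<open>n\<close>. Going from \<open>x\<close> to \<open>z\<close> through this point instead of
  \<open>y\<close> performs the same two steps in the opposite order.\<close>

definition reflect :: "nat \<Rightarrow> nat \<Rightarrow> nat \<Rightarrow> nat \<Rightarrow> nat" where
  "reflect n x y z = (if int x + int z - int y < 1 then x + z + n - y
     else if int x + int z - int y > int n then x + z - y - n else x + z - y)"

lemma reflect_cases:
  assumes "x \<in> {1..n}" "y \<in> {1..n}" "z \<in> {1..n}"
  obtains c where "c \<in> {-1, 0, 1}" "int (reflect n x y z) = int x + int z - int y + c * int n"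
    "reflect n x y z \<in> {1..n}"
proof -
  consider "int x + int z - int y < 1" | "int x + int z - int y > int n"
    | "int x + int z - int y \<in> {1..int n}" by fastforce
  then show thesis
  proof cases
    case 1
    then show thesis using assms by (intro that[of 1]) (auto simp: reflect_def)
  next
    case 2
    then show thesis using assms by (intro that[of "-1"]) (auto simp: reflect_def of_nat_diff)
  next
    case 3
    then show thesis using assms by (intro that[of 0]) (auto simp: reflect_def of_nat_diff)
  qed
qed

lemma cyclic_dist_cong:
  assumes "i \<in> {1..n}" "j \<in> {1..n}" "i' \<in> {1..n}" "j' \<in> {1..n}"
    and "c \<in> {-1, 0, 1}" "int i - int j = int i' - int j' + c * int n"
  shows "cyclic_dist n i j = cyclic_dist n i' j'"
  using assms unfolding cyclic_dist_def by (auto simp: min_def abs_if split: if_splits)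

lemma circulant_link_reflect:
  assumes "x \<in> {1..n}" "y \<in> {1..n}" "z \<in> {1..n}"
  shows "circulant_link n x (reflect n x y z) = circulant_link n y z"
    and "circulant_link n (reflect n x y z) z = circulant_link n x y"
proof -
  obtain c where c: "c \<in> {-1, 0, 1}" "int (reflect n x y z) = int x + int z - int y + c * int n"
    "reflect n x y z \<in> {1..n}"
    using assms by (rule reflect_cases)
  have "- c \<in> {-1, 0, 1}" using c(1) by auto
  then have "cyclic_dist n x (reflect n x y z) = cyclic_dist n y z"
    using assms c(2,3) by (intro cyclic_dist_cong[where c = "- c"]) auto
  then show "circulant_link n x (reflect n x y z) = circulant_link n y z"
    using assms c(3) circulant_link_eq_iff by blast
  have "cyclic_dist n (reflect n x y z) z = cyclic_dist n x y"
    using assms c by (intro cyclic_dist_cong[where c = c]) auto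
  then show "circulant_link n (reflect n x y z) z = circulant_link n x y"
    using assms c(3) circulant_link_eq_iff by blast
qed

text \<open>The value determines \<open>y\<close> modulo \<open>n\<close>, and two points of
  \<open>{1..n}\<close> differ by less than \<open>n\<close>.\<close>

lemma reflect_inj:
  assumes "x \<in> {1..n}" "y \<in> {1..n}" "z \<in> {1..n}" "y' \<in> {1..n}"
    and eq: "reflect n x y z = reflect n x y' z"
  shows "y = y'"
proof -
  obtain c where c: "c \<in> {-1, 0, 1}" "int (reflect n x y z) = int x + int z - int y + c * int n"
    using assms(1-3) by (rule reflect_cases)
  obtain c' where c': "c' \<in> {-1, 0, 1}" "int (reflect n x y' z) = int x + int z - int y' + c' * int n"
    using assms(1,4,3) by (rule reflect_cases)
  have "int y - int y' = (c - c') * int n" using c(2) c'(2) eq by (simp add: algebra_simps)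
  moreover have "\<bar>int y - int y'\<bar> < int n" using assms by auto
  ultimately show ?thesis using c(1) c'(1) by auto
qed

text \<open>Only the vertex between the two steps moves, so the other edges and both ends stay. The
  map is injective, and exchanging \<open>a\<close> and \<open>b\<close> gives the converse
  inequality.\<close>

lemma card_word_walks_swap_le:
  "card (word_walks circulant_link n (u @ [a, b] @ v)) \<le> card (word_walks circulant_link n (u @ [b, a] @ v))"
proof (rule card_inj_on_le)
  let ?i = "length u"
  define f where "f xs = xs[Suc ?i := reflect n (xs ! ?i) (xs ! Suc ?i) (xs ! Suc (Suc ?i))]" for xs
  have f: "f (p @ x # y # z # q) = p @ x # reflect n x y z # z # q" if "length p = ?i" for p x y z q
    unfolding f_def that[symmetric] by (simp add: nth_append list_update_append)
  show "f ` word_walks circulant_link n (u @ [a, b] @ v) \<subseteq> word_walks circulant_link n (u @ [b, a] @ v)"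
  proof
    fix ys assume "ys \<in> f ` word_walks circulant_link n (u @ [a, b] @ v)"
    then obtain xs where xs: "xs \<in> word_walks circulant_link n (u @ [a, b] @ v)" "ys = f xs" by blast
    obtain p x y z q where e: "xs = p @ x # y # z # q" "length p = ?i" "length q = length v"
      using xs(1) by (rule word_walks_split)
    have r: "x \<in> {1..n}" "y \<in> {1..n}" "z \<in> {1..n}"
      using xs(1) unfolding e by (auto simp: word_walks_def closed_walks_def walks_def)
    obtain c where "reflect n x y z \<in> {1..n}" using r by (rule reflect_cases)
    moreover have "same_kernel (u @ [a, b] @ v) (edges (circulant_link n) (p @ [x]) @
        [circulant_link n x y, circulant_link n y z] @ edges (circulant_link n) (z # q))"
      using xs(1) unfolding word_walks_def e(1) mem_Collect_eq edges_three by blast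
    then have "same_kernel (u @ [b, a] @ v) (edges (circulant_link n) (p @ [x]) @
        [circulant_link n y z, circulant_link n x y] @ edges (circulant_link n) (z # q))"
      by (rule same_kernel_swap) (simp add: e)
    ultimately show "ys \<in> word_walks circulant_link n (u @ [b, a] @ v)"
      using xs(1) unfolding xs(2) e(1) f[OF e(2)] word_walks_def closed_walks_def walks_def
        mem_Collect_eq edges_three hd_last_three circulant_link_reflect[OF r]
      by auto
  qed
  show "inj_on f (word_walks circulant_link n (u @ [a, b] @ v))"
  proof (rule inj_onI)
    fix xs xs' assume xs: "xs \<in> word_walks circulant_link n (u @ [a, b] @ v)"
      "xs' \<in> word_walks circulant_link n (u @ [a, b] @ v)" "f xs = f xs'"
    obtain p x y z q where e: "xs = p @ x # y # z # q" "length p = ?i" "length q = length v"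
      using xs(1) by (rule word_walks_split)
    obtain p' x' y' z' q' where e': "xs' = p' @ x' # y' # z' # q'" "length p' = ?i" "length q' = length v"
      using xs(2) by (rule word_walks_split)
    have r: "x \<in> {1..n}" "y \<in> {1..n}" "z \<in> {1..n}" "y' \<in> {1..n}"
      using xs(1,2) unfolding e e' by (auto simp: word_walks_def closed_walks_def walks_def)
    have *: "p = p'" "x = x'" "z = z'" "q = q'" "reflect n x y z = reflect n x' y' z'"
      using xs(3) e(2) e'(2) unfolding e(1) e'(1) f[OF e(2)] f[OF e'(2)] by auto
    then have "y = y'" using reflect_inj[OF r] by simp
    then show "xs = xs'" using * e e' by simp
  qed
qed simp

lemma card_word_walks_swap:
  "card (word_walks circulant_link n (u @ [a, b] @ v)) = card (word_walks circulant_link n (u @ [b, a] @ v))"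
  by (intro antisym card_word_walks_swap_le)

lemma card_word_walks_move:
  "card (word_walks circulant_link n (p @ u @ [a] @ v)) = card (word_walks circulant_link n (p @ [a] @ u @ v))"
proof (induction u arbitrary: v rule: rev_induct)
  case (snoc b u)
  have "card (word_walks circulant_link n (p @ (u @ [b]) @ [a] @ v))
      = card (word_walks circulant_link n ((p @ u) @ [b, a] @ v))" by simp
  also have "\<dots> = card (word_walks circulant_link n (p @ u @ [a] @ ([b] @ v)))"
    by (subst card_word_walks_swap) simp
  also have "\<dots> = card (word_walks circulant_link n (p @ [a] @ (u @ [b]) @ v))"
    by (subst snoc.IH) simp
  finally show ?case .
qed simp

text \<open>Two consecutive steps of equal cyclic length either return or go on in the same
  direction. In the second case \<open>y\<close> is a midpoint of \<open>x\<close> and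
  \<open>z\<close> modulo \<open>n\<close>, and the sign tells which of the at most three solutions
  it is.\<close>

lemma circulant_midpoint:
  assumes r: "x \<in> {1..n}" "y \<in> {1..n}" "z \<in> {1..n}" and "x \<noteq> z"
    and "circulant_link n x y = circulant_link n y z"
  shows "2 * int y = int x + int z + sgn (2 * int y - (int x + int z)) * int n"
proof -
  have "cyclic_dist n x y = cyclic_dist n y z" using assms circulant_link_eq_iff by blast
  then have *: "\<bar>int x - int y\<bar> = \<bar>int y - int z\<bar> \<or> \<bar>int x - int y\<bar> = int n - \<bar>int y - int z\<bar>"
    unfolding cyclic_dist_def by (auto simp: min_def split: if_splits)
  consider "2 * int y = int x + int z" | "2 * int y = int x + int z + int n" | "2 * int y = int x + int z - int n"
    using * r \<open>x \<noteq> z\<close> by (auto simp: abs_if split: if_splits)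
  then show ?thesis using r by cases auto
qed

text \<open>Such a walk is determined by its tail \<open>z # q\<close> and a sign: closedness makes
  \<open>x\<close> the last vertex of the tail, and \<open>y\<close> is then the midpoint selected
  by the sign. The tail follows \<open>v\<close>, which leaves one power of \<open>n\<close> less
  than the normalisation; the factor 3 counts the signs.\<close>

lemma circulant_not_returning_le:
  assumes "fibre_bound circulant_link C"
  shows "card (word_walks circulant_link n ([a, a] @ v) - returning_walks circulant_link n [] a v)
     \<le> 3 * (n * n ^ card (set v) * C ^ length v)"
proof -
  let ?B = "word_walks circulant_link n ([a, a] @ v) - returning_walks circulant_link n [] a v"
  let ?W = "{ys \<in> walks n (length v). same_kernel v (edges (circulant_link n) ys)}"
  define s where "s xs = sgn (2 * int (xs ! 1) - (int (xs ! 0) + int (xs ! 2)))" for xs :: "nat list"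
  have split: "\<exists>x y z q. xs = x # y # z # q \<and> x \<in> {1..n} \<and> y \<in> {1..n} \<and> z \<in> {1..n} \<and>
      z # q \<in> ?W \<and> x = last (z # q) \<and> 2 * int y = int x + int z + s xs * int n" if xs: "xs \<in> ?B" for xs
  proof -
    have xs1: "xs \<in> word_walks circulant_link n ([] @ [a, a] @ v)" using xs by simp
    then obtain p x y z q where "xs = p @ x # y # z # q" "length p = length ([]::'a list)" "length q = length v"
      by (rule word_walks_split)
    then have e: "xs = x # y # z # q" "length q = length v" by auto
    have r: "x \<in> {1..n}" "y \<in> {1..n}" "z \<in> {1..n}"
      using xs1 unfolding e by (auto simp: word_walks_def closed_walks_def walks_def)
    have "x \<noteq> z" using xs unfolding e returning_walks_def by simp
    have k: "same_kernel ([a, a] @ v) ([circulant_link n x y, circulant_link n y z] @ edges (circulant_link n) (z # q))"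
      using xs1 unfolding e word_walks_def by simp
    then obtain f where f: "inj_on f (set ([a, a] @ v))"
      "[circulant_link n x y, circulant_link n y z] @ edges (circulant_link n) (z # q) = map f ([a, a] @ v)"
      unfolding same_kernel_iff_map by blast
    then have "circulant_link n x y = circulant_link n y z" by simp
    then have "2 * int y = int x + int z + s xs * int n"
      using circulant_midpoint[OF r \<open>x \<noteq> z\<close>] by (simp add: s_def e)
    moreover have "same_kernel v (edges (circulant_link n) (z # q))"
      using f inj_on_subset[OF f(1), of "set v"] by (auto simp: same_kernel_iff_map)
    moreover have "z # q \<in> walks n (length v)" "x = last (z # q)"
      using xs1 unfolding e by (auto simp: word_walks_def closed_walks_def walks_def)
    ultimately show ?thesis using e r by blast
  qed
  have "card ?B \<le> card (?W \<times> {-1, 0, 1 :: int})"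
  proof (rule card_inj_on_le[where f = "\<lambda>xs. (drop 2 xs, s xs)"])
    show "inj_on (\<lambda>xs. (drop 2 xs, s xs)) ?B"
    proof (rule inj_onI)
      fix xs xs' assume "xs \<in> ?B" "xs' \<in> ?B" and eq: "(drop 2 xs, s xs) = (drop 2 xs', s xs')"
      from split[OF this(1)] obtain x y z q where 1: "xs = x # y # z # q"
        "x = last (z # q)" "2 * int y = int x + int z + s xs * int n" by blast
      from split[OF \<open>xs' \<in> ?B\<close>] obtain x' y' z' q' where 2: "xs' = x' # y' # z' # q'"
        "x' = last (z' # q')" "2 * int y' = int x' + int z' + s xs' * int n" by blast
      have "z = z'" "q = q'" using eq 1(1) 2(1) by auto
      then have "x = x'" using 1(2) 2(2) by simp
      then have "2 * int y = 2 * int y'" using 1(3) 2(3) eq \<open>z = z'\<close> by simp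
      then show "xs = xs'" using 1(1) 2(1) \<open>z = z'\<close> \<open>q = q'\<close> \<open>x = x'\<close> by simp
    qed
    show "(\<lambda>xs. (drop 2 xs, s xs)) ` ?B \<subseteq> ?W \<times> {-1, 0, 1}"
    proof
      fix t assume "t \<in> (\<lambda>xs. (drop 2 xs, s xs)) ` ?B"
      then obtain xs where xs: "xs \<in> ?B" "t = (drop 2 xs, s xs)" by blast
      from split[OF this(1)] have "drop 2 xs \<in> ?W" by auto
      moreover have "s xs \<in> {-1, 0, 1}" by (simp add: s_def sgn_if)
      ultimately show "t \<in> ?W \<times> {-1, 0, 1}" using xs(2) by simp
    qed
  qed simp
  also have "\<dots> = 3 * card ?W" by (simp add: card_cartesian_product)
  also have "\<dots> \<le> 3 * (n * n ^ card (set v) * C ^ length v)"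
    using card_walks_with_kernel_le[OF assms, of n v] by simp
  finally show ?thesis .
qed

lemma circulant_density_step:
  assumes p: "paired ([a, a] @ v)" and lim: "walk_density circulant_link v \<longlonglongrightarrow> 1"
  shows "walk_density circulant_link ([a, a] @ v) \<longlonglongrightarrow> 1"
proof -
  obtain C where C: "fibre_bound circulant_link C"
    using property_B_fibre_bound link_function_circulant property_B_circulant by blast
  have p': "paired ([] @ [a, a] @ v)" using p by simp
  have a: "a \<notin> set ([] @ v)" "paired v" using paired_pairD[OF p'] by auto
  let ?R = "\<lambda>n. returning_walks circulant_link n [] a v"
  let ?B = "\<lambda>n. word_walks circulant_link n ([a, a] @ v) - ?R n"
  let ?m = "length ([a, a] @ v) div 2"
  have "(\<lambda>n. card (?R n) / real n ^ (1 + length ([] @ [a, a] @ v) div 2)) \<longlonglongrightarrow> 1"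
    using lim a(1) by (intro returning_walks_density[where C = C] symmetric_circulant C) simp_all
  then have R: "(\<lambda>n. card (?R n) / real n ^ (1 + ?m)) \<longlonglongrightarrow> 1" by simp
  have m: "?m = Suc (card (set v))" using paired_length[OF a(2)] by simp
  have B: "(\<lambda>n. card (?B n) / real n ^ (1 + ?m)) \<longlonglongrightarrow> 0"
  proof (rule density_negligible)
    fix n :: nat
    have "real (card (?B n)) \<le> real (3 * (n * n ^ card (set v) * C ^ length v))"
      using circulant_not_returning_le[OF C] by (rule of_nat_mono)
    then show "real (card (?B n)) \<le> real (3 * C ^ length v) * real n ^ ?m"
      unfolding m by (simp add: mult_ac)
  qed
  have "card (word_walks circulant_link n ([a, a] @ v)) = card (?R n) + card (?B n)" for n
  proof -
    have s: "?R n \<subseteq> word_walks circulant_link n ([a, a] @ v)" by (auto simp: returning_walks_def)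
    then have "card (?R n) \<le> card (word_walks circulant_link n ([a, a] @ v))" by (intro card_mono) auto
    then show ?thesis using card_Diff_subset[OF finite_subset[OF s] s] by simp
  qed
  then have "walk_density circulant_link ([a, a] @ v) =
      (\<lambda>n. card (?R n) / real n ^ (1 + ?m) + card (?B n) / real n ^ (1 + ?m))"
    by (simp add: walk_density_def fun_eq_iff add_divide_distrib)
  then show ?thesis using tendsto_add[OF R B] by simp
qed

text \<open>Sorting and cancelling alternate: the second copy of the first letter is moved next to
  the first copy, the pair is cancelled, and the shorter word is left to the induction.\<close>

lemma circulant_density:
  "paired w \<Longrightarrow> walk_density circulant_link w \<longlonglongrightarrow> 1"
proof (induction "length w" arbitrary: w rule: less_induct)
  case less
  show ?case
  proof (cases w)
    case Nil
    then show ?thesis using density_Nil by simp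
  next
    case (Cons a w')
    have "count_list w a = 2" using less.prems Cons unfolding paired_def by auto
    then have "count_list w' a \<noteq> 0" using Cons by simp
    then have "a \<in> set w'" by (metis count_list_0_iff)
    then obtain u v where w': "w' = u @ [a] @ v" by (metis append_Cons append_Nil in_set_conv_decomp)
    have s: "set ([] @ [a, a] @ (u @ v)) = set w" "count_list ([] @ [a, a] @ (u @ v)) b = count_list w b" for b
      using Cons w' by auto
    have p: "paired ([] @ [a, a] @ (u @ v))" using less.prems unfolding paired_def s .
    then have "paired (u @ v)" using paired_pairD by fastforce
    then have "walk_density circulant_link (u @ v) \<longlonglongrightarrow> 1"
      using Cons w' by (intro less.hyps) auto
    then have "walk_density circulant_link ([a, a] @ (u @ v)) \<longlonglongrightarrow> 1"
      using p by (intro circulant_density_step) auto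
    moreover have "walk_density circulant_link ([a, a] @ (u @ v)) = walk_density circulant_link w"
      using card_word_walks_move[of _ "[a]" u a v] Cons w' by (simp add: walk_density_def fun_eq_iff)
    ultimately show ?thesis by simp
  qed
qed

section \<open>Counting indexed pair-matched words\<close>

text \<open>The normal form of words as a recursion from the left: \<open>k\<close> letters are in
  use, and the next letter is one of them or the number \<open>k\<close> itself.\<close>

fun growth :: "nat \<Rightarrow> nat list \<Rightarrow> bool" where
  "growth k [] \<longleftrightarrow> True"
| "growth k (a # w) \<longleftrightarrow> a < k \<and> growth k w \<or> a = k \<and> growth (Suc k) w"

lemma is_word_appendD: "is_word (u @ w) \<Longrightarrow> is_word u"
proof (induction w rule: rev_induct)
  case (snoc a w)
  then show ?case using is_word_snoc[of "u @ w" a] by simp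
qed simp

lemma is_word_append_iff_growth:
  "is_word u \<Longrightarrow> is_word (u @ w) \<longleftrightarrow> growth (card (set u)) w"
proof (induction w arbitrary: u)
  case (Cons a w)
  have a: "a \<in> set u \<longleftrightarrow> a < card (set u)"
    using set_is_word[OF Cons.prems] by (metis lessThan_iff)
  have e: "u @ a # w = (u @ [a]) @ w" by simp
  show ?case
  proof (cases "is_word (u @ [a])")
    case True
    then have "is_word (u @ a # w) \<longleftrightarrow> growth (card (set (u @ [a]))) w"
      unfolding e by (rule Cons.IH)
    moreover have "a < card (set u) \<or> a = card (set u)" using True a by (simp add: is_word_snoc)
    ultimately show ?thesis using a by (auto simp: insert_absorb)
  next
    case False
    then have "\<not> is_word (u @ a # w)" unfolding e using is_word_appendD by blast
    then show ?thesis using False a Cons.prems by (auto simp: is_word_snoc)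
  qed
qed simp

lemma is_word_iff_growth: "is_word w \<longleftrightarrow> growth 0 w"
  using is_word_append_iff_growth[of "[]" w] by simp

text \<open>
  The continuations of an indexed word of which \<open>k\<close> letters have been used and the letters in \<open>S\<close>
  have occurred exactly once; all other used letters have occurred twice.
\<close>

definition completions :: "nat \<Rightarrow> (nat \<times> nat) set \<Rightarrow> nat list \<Rightarrow> (nat \<times> nat) list set" where
  "completions k S rs = {v. map snd v = rs \<and> growth k (map fst v) \<and> inj_on fst (S \<union> set v) \<and>
     (\<forall>x\<in>set v. fst x < k \<longrightarrow> x \<in> S) \<and> (\<forall>x\<in>S \<union> set v. of_bool (x \<in> S) + count_list v x = 2)}"

lemma completionsI:
  assumes "map snd v = rs" "growth k (map fst v)" "inj_on fst (S \<union> set v)"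
    and "\<And>x. x \<in> set v \<Longrightarrow> fst x < k \<Longrightarrow> x \<in> S"
    and "\<And>x. x \<in> S \<union> set v \<Longrightarrow> of_bool (x \<in> S) + count_list v x = 2"
  shows "v \<in> completions k S rs"
  using assms unfolding completions_def by blast

lemma completionsD:
  assumes "v \<in> completions k S rs"
  shows "map snd v = rs" "growth k (map fst v)" "inj_on fst (S \<union> set v)"
    and "\<And>x. x \<in> set v \<Longrightarrow> fst x < k \<Longrightarrow> x \<in> S"
    and "\<And>x. x \<in> S \<union> set v \<Longrightarrow> of_bool (x \<in> S) + count_list v x = 2"
  using assms unfolding completions_def by (simp_all only: mem_Collect_eq)

lemma indexed_pair_words_eq_completions: "indexed_pair_words rs = completions 0 {} rs"
proof -
  have "(\<forall>x\<in>set v. \<forall>y\<in>set v. snd x \<noteq> snd y \<longrightarrow> fst x \<noteq> fst y) \<longleftrightarrow> inj_on fst (set v)"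
    for v :: "(nat \<times> nat) list"
    by (fastforce simp: inj_on_def prod_eq_iff)
  then show ?thesis
    by (auto simp: indexed_pair_words_def completions_def is_word_iff_growth)
qed

lemma completions_Nil: "completions k S [] = (if S = {} then {[]} else {})"
  by (auto simp: completions_def)

text \<open>The next letter either opens a new pair, and then its number must be \<open>k\<close>,
  or closes an open letter that carries the required index \<open>r\<close>.\<close>

lemma completions_Cons:
  assumes S: "\<forall>x\<in>S. fst x < k" "inj_on fst S"
  shows "completions k S (r # rs) = (#) (k, r) ` completions (Suc k) (insert (k, r) S) rs \<union>
     (\<Union>x\<in>{x \<in> S. snd x = r}. (#) x ` completions k (S - {x}) rs)"
    (is "?L = ?N \<union> ?O")
proof
  have kS: "(k, r) \<notin> S" using S(1) by force
  show "?L \<subseteq> ?N \<union> ?O"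
  proof
    fix v assume v: "v \<in> ?L"
    then obtain x v' where e: "v = x # v'" "snd x = r" "map snd v' = rs"
      by (auto simp: completions_def)
    note D = completionsD[OF v]
    have sv: "set v = insert x (set v')" using e by simp
    have cnt: "of_bool (y \<in> S) + (of_bool (x = y) + count_list v' y) = 2" if "y \<in> S \<union> set v" for y
      using D(5)[OF that] unfolding e(1) by (cases "x = y"; cases "y \<in> S") simp_all
    have "fst x < k \<and> growth k (map fst v') \<or> fst x = k \<and> growth (Suc k) (map fst v')"
      using D(2) e(1) by simp
    then show "v \<in> ?N \<union> ?O"
    proof
      assume x: "fst x < k \<and> growth k (map fst v')"
      then have xS: "x \<in> S" using D(4)[of x] sv by simp
      \<comment> \<open>An open letter has one occurrence left, and \<open>x\<close> has just used
        it up.\<close>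
      then have "count_list v' x = 0" using cnt[of x] by simp
      then have xv: "x \<notin> set v'" by (metis count_list_0_iff)
      have "v' \<in> completions k (S - {x}) rs"
      proof (rule completionsI[OF e(3)])
        show "growth k (map fst v')" using x by simp
        show "inj_on fst (S - {x} \<union> set v')" 
          by (rule inj_on_subset[OF D(3)]) (use sv in blast)
        show "y \<in> S - {x}" if "y \<in> set v'" "fst y < k" for y
        proof -
          have "y \<in> S" using D(4)[of y] that sv by simp
          then show ?thesis using that(1) xv by auto
        qed
        show "of_bool (y \<in> S - {x}) + count_list v' y = 2" if "y \<in> S - {x} \<union> set v'" for y
        proof -
          have "x \<noteq> y" using that xv by blast
          then show ?thesis using cnt[of y] that sv by (cases "y \<in> S") simp_all
        qed
      qed
      then have "v \<in> (#) x ` completions k (S - {x}) rs" unfolding e(1) by (rule imageI)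
      then have "v \<in> ?O" using xS e(2) by blast
      then show ?thesis by (rule UnI2)
    next
      assume x: "fst x = k \<and> growth (Suc k) (map fst v')"
      then have xk: "x = (k, r)" using e by (simp add: prod_eq_iff)
      have xS: "x \<notin> S" using kS xk by simp
      have s: "insert x S \<union> set v' = S \<union> set v" using sv by auto
      have "v' \<in> completions (Suc k) (insert x S) rs"
      proof (rule completionsI[OF e(3)])
        show "growth (Suc k) (map fst v')" using x by simp
        show "inj_on fst (insert x S \<union> set v')" unfolding s by (rule D(3))
        show "y \<in> insert x S" if "y \<in> set v'" "fst y < Suc k" for y
        proof (cases "fst y = k")
          case True
          then have "y = x" using inj_onD[OF D(3), of y x] x that(1) sv by simp
          then show ?thesis by simp
        next
          case False
          then show ?thesis using D(4)[of y] that sv by simp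
        qed
        show "of_bool (y \<in> insert x S) + count_list v' y = 2" if "y \<in> insert x S \<union> set v'" for y
          using cnt[of y] that xS sv by (cases "x = y"; cases "y \<in> S") simp_all
      qed
      then have "v \<in> ?N" unfolding e(1) xk by (rule imageI)
      then show ?thesis by (rule UnI1)
    qed
  qed
  show "?N \<union> ?O \<subseteq> ?L"
  proof
    fix v assume "v \<in> ?N \<union> ?O"
    then consider v' where "v = (k, r) # v'" "v' \<in> completions (Suc k) (insert (k, r) S) rs"
      | x v' where "v = x # v'" "x \<in> S" "snd x = r" "v' \<in> completions k (S - {x}) rs" by blast
    then show "v \<in> ?L"
    proof cases
      case 1
      note D = completionsD[OF 1(2)]
      have sv: "S \<union> set v = insert (k, r) S \<union> set v'" using 1(1) by auto
      show ?thesis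
      proof (rule completionsI)
        show "map snd v = r # rs" "growth k (map fst v)" using D(1,2) 1(1) by simp_all
        show "inj_on fst (S \<union> set v)" unfolding sv by (rule D(3))
        show "y \<in> S" if "y \<in> set v" "fst y < k" for y
          using D(4)[of y] that 1(1) by auto
        show "of_bool (y \<in> S) + count_list v y = 2" if "y \<in> S \<union> set v" for y
          using D(5)[of y] that kS 1(1) by (cases "y = (k, r)"; cases "y \<in> S") simp_all
      qed
    next
      case 2
      note D = completionsD[OF 2(4)]
      have xk: "fst x < k" using S 2 by blast
      have xv: "x \<notin> set v'" using D(4)[of x] xk by blast
      have sv: "S \<union> set v = insert x (S - {x} \<union> set v')" using 2 by auto
      have ne: "fst x \<noteq> fst y" if y: "y \<in> S - {x} \<union> set v'" for y
      proof
        assume eq: "fst x = fst y"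
        then have "y \<in> S - {x}" using y D(4)[of y] xk by fastforce
        then show False using inj_onD[OF S(2) eq] 2(2) by blast
      qed
      show ?thesis
      proof (rule completionsI)
        show "map snd v = r # rs" "growth k (map fst v)" using D(1,2) 2 xk by simp_all
        have "fst x \<notin> fst ` (S - {x} \<union> set v')" using ne by (metis imageE)
        then show "inj_on fst (S \<union> set v)" unfolding sv inj_on_insert using D(3) by blast
        show "y \<in> S" if "y \<in> set v" "fst y < k" for y
          using D(4)[of y] that 2 by auto
        have c0: "count_list v' x = 0" using xv by (metis count_list_0_iff)
        show "of_bool (y \<in> S) + count_list v y = 2" if "y \<in> S \<union> set v" for y
          using D(5)[of y] that c0 2(1,2) by (cases "y = x"; cases "y \<in> S") simp_all
      qed
    qed
  qed
qed

lemma finite_completions: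
  "finite S \<Longrightarrow> \<forall>x\<in>S. fst x < k \<Longrightarrow> inj_on fst S \<Longrightarrow> finite (completions k S rs)"
proof (induction rs arbitrary: k S)
  case Nil
  then show ?case by (simp add: completions_Nil)
next
  case (Cons r rs)
  have "finite (completions (Suc k) (insert (k, r) S) rs)"
    using Cons.prems by (intro Cons.IH) (auto simp: inj_on_insert less_Suc_eq)
  moreover have "finite (completions k (S - {x}) rs)" for x
    using Cons.prems by (intro Cons.IH) (auto intro: inj_on_diff)
  ultimately show ?case using Cons.prems by (subst completions_Cons) auto
qed

lemma finite_indexed_pair_words: "finite (indexed_pair_words rs)"
  unfolding indexed_pair_words_eq_completions by (rule finite_completions) auto

text \<open>The number of ways to complete a matching of \<open>k\<close> further points when \<open>h\<close> points are open.\<close>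

fun matchings :: "nat \<Rightarrow> nat \<Rightarrow> nat" where
  "matchings h 0 = of_bool (h = 0)"
| "matchings h (Suc k) = matchings (Suc h) k + h * matchings (h - 1) k"

text \<open>A distinguished open point chooses its partner among the \<open>k\<close> further
  points. The definition reads the further points one at a time, so the proof goes by induction on
  them.\<close>

lemma matchings_Suc: "matchings (Suc h) k = k * matchings h (k - 1)"
proof (induction k arbitrary: h)
  case (Suc k)
  have "matchings (Suc h) (Suc k) = k * matchings (Suc h) (k - 1) + Suc h * matchings h k"
    using Suc[of "Suc h"] by simp
  also have "k * matchings (Suc h) (k - 1) + h * matchings h k = k * matchings h k"
  proof (cases k)
    case 0
    then show ?thesis by (cases h) simp_all
  next
    case (Suc j)
    have "h * matchings h k = h * (k * matchings (h - 1) (k - 1))"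
      using Suc.IH[of "h - 1"] by (cases h) auto
    then show ?thesis using Suc by (simp add: algebra_simps)
  qed
  then have "k * matchings (Suc h) (k - 1) + Suc h * matchings h k = Suc k * matchings h k" by simp
  finally show ?case by simp
qed simp

lemma matchings_0: "matchings 0 (Suc (Suc k)) = Suc k * matchings 0 k" "matchings 0 (Suc 0) = 0"
  using matchings_Suc[of 0 "Suc k"] by simp_all

text \<open>Letters of different indices never interact, so the count is a product over the indices
  of plain matching counts. A step of the recursion at index \<open>r\<close> changes only the
  factor of \<open>r\<close>.\<close>

lemma card_completions:
  assumes "finite S" "\<forall>x\<in>S. fst x < k" "inj_on fst S" "finite D" "snd ` S \<subseteq> D" "set rs \<subseteq> D"
  shows "card (completions k S rs) = (\<Prod>c\<in>D. matchings (card {x \<in> S. snd x = c}) (count_list rs c))"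
  using assms
proof (induction rs arbitrary: k S)
  case Nil
  show ?case
  proof (cases "S = {}")
    case False
    then obtain x where x: "x \<in> S" by blast
    have "finite {y \<in> S. snd y = snd x}" using Nil.prems(1) by simp
    then have "0 < card {y \<in> S. snd y = snd x}" using x by (subst card_gt_0_iff) blast
    then have "(\<Prod>c\<in>D. matchings (card {x \<in> S. snd x = c}) (count_list [] c)) = 0"
      using Nil.prems(4,5) x by (intro prod_zero bexI[of _ "snd x"]) auto
    then show ?thesis using False by (simp add: completions_Nil)
  qed (simp add: completions_Nil)
next
  case (Cons r rs)
  let ?S1 = "insert (k, r) S"
  define h where "h = card {x \<in> S. snd x = r}"
  define P where "P = (\<Prod>c\<in>D - {r}. matchings (card {x \<in> S. snd x = c}) (count_list rs c))"
  have rD: "r \<in> D" using Cons.prems by simp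
  have kS: "(k, r) \<notin> S" using Cons.prems(2) by force
  have "card (completions (Suc k) ?S1 rs) = (\<Prod>c\<in>D. matchings (card {x \<in> ?S1. snd x = c}) (count_list rs c))"
    using Cons.prems by (intro Cons.IH) (auto simp: inj_on_insert less_Suc_eq)
  also have "\<dots> = matchings (card {x \<in> ?S1. snd x = r}) (count_list rs r) *
      (\<Prod>c\<in>D - {r}. matchings (card {x \<in> ?S1. snd x = c}) (count_list rs c))"
    using rD Cons.prems by (intro prod.remove) auto
  also have "{x \<in> ?S1. snd x = r} = insert (k, r) {x \<in> S. snd x = r}" by auto
  also have "card \<dots> = Suc h" using kS Cons.prems(1) by (simp add: h_def)
  also have "(\<Prod>c\<in>D - {r}. matchings (card {x \<in> ?S1. snd x = c}) (count_list rs c)) = P"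
    unfolding P_def by (intro prod.cong refl arg_cong2[where f = matchings] arg_cong[where f = card]) auto
  finally have new: "card (completions (Suc k) ?S1 rs) = matchings (Suc h) (count_list rs r) * P" .
  have old: "card (completions k (S - {x}) rs) = matchings (h - 1) (count_list rs r) * P"
    if x: "x \<in> S" "snd x = r" for x
  proof -
    have "card (completions k (S - {x}) rs)
        = (\<Prod>c\<in>D. matchings (card {y \<in> S - {x}. snd y = c}) (count_list rs c))"
      using Cons.prems by (intro Cons.IH) (auto intro: inj_on_diff)
    also have "\<dots> = matchings (card {y \<in> S - {x}. snd y = r}) (count_list rs r) *
        (\<Prod>c\<in>D - {r}. matchings (card {y \<in> S - {x}. snd y = c}) (count_list rs c))"
      using rD Cons.prems by (intro prod.remove) auto
    also have "{y \<in> S - {x}. snd y = r} = {y \<in> S. snd y = r} - {x}" by auto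
    also have "card \<dots> = h - 1" using x Cons.prems(1) by (simp add: h_def)
    also have "(\<Prod>c\<in>D - {r}. matchings (card {y \<in> S - {x}. snd y = c}) (count_list rs c)) = P"
      unfolding P_def using x
      by (intro prod.cong refl arg_cong2[where f = matchings] arg_cong[where f = card]) auto
    finally show ?thesis .
  qed
  let ?O = "\<Union>x\<in>{x \<in> S. snd x = r}. (#) x ` completions k (S - {x}) rs"
  have fin: "finite (completions (Suc k) ?S1 rs)" "finite (completions k (S - {x}) rs)" for x
    using Cons.prems by (auto intro!: finite_completions inj_on_diff simp: inj_on_insert less_Suc_eq)
  have "card (completions k S (r # rs)) =
      card ((#) (k, r) ` completions (Suc k) ?S1 rs) + card ?O"
    unfolding completions_Cons[OF Cons.prems(2,3)] using fin Cons.prems(1) kS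
    by (intro card_Un_disjoint) auto
  also have "card ((#) (k, r) ` completions (Suc k) ?S1 rs) = card (completions (Suc k) ?S1 rs)"
    by (intro card_image) auto
  also have "card ?O = (\<Sum>x\<in>{x \<in> S. snd x = r}. card ((#) x ` completions k (S - {x}) rs))"
    using fin Cons.prems(1) by (intro card_UN_disjoint) auto
  also have "\<dots> = (\<Sum>x\<in>{x \<in> S. snd x = r}. card (completions k (S - {x}) rs))"
    by (intro sum.cong refl card_image) auto
  also have "\<dots> = (\<Sum>x\<in>{x \<in> S. snd x = r}. matchings (h - 1) (count_list rs r) * P)"
    using old by (intro sum.cong) auto
  also have "\<dots> = h * (matchings (h - 1) (count_list rs r) * P)" by (simp add: h_def)
  finally have "card (completions k S (r # rs)) = matchings h (Suc (count_list rs r)) * P"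
    unfolding new by (simp add: algebra_simps)
  also have "P = (\<Prod>c\<in>D - {r}. matchings (card {x \<in> S. snd x = c}) (count_list (r # rs) c))"
    unfolding P_def by (intro prod.cong) auto
  also have "matchings h (Suc (count_list rs r)) * \<dots> =
      (\<Prod>c\<in>D. matchings (card {x \<in> S. snd x = c}) (count_list (r # rs) c))"
    by (simp add: prod.remove[OF Cons.prems(4) rD] h_def)
  finally show ?case .
qed

lemma card_indexed_pair_words:
  assumes "finite D" "set rs \<subseteq> D"
  shows "card (indexed_pair_words rs) = (\<Prod>c\<in>D. matchings 0 (count_list rs c))"
  unfolding indexed_pair_words_eq_completions using assms
  by (subst card_completions[where D = D]) auto

text \<open>The vacuum expectations of products of creation and annihilation operators on the full Fock space.\<close>

fun fock :: "nat list \<Rightarrow> nat list \<Rightarrow> nat" where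
  "fock s [] = of_bool (s = [])"
| "fock s (r # rs) = fock (r # s) rs + (if s \<noteq> [] \<and> hd s = r then fock (tl s) rs else 0)"

text \<open>Whatever lies on the stack must be cancelled by a later occurrence of the same
  letter.\<close>

lemma reduces_count_list: "reduces s w \<Longrightarrow> count_list s a \<le> count_list w a"
  by (induction s w rule: reduces.induct) (auto split: if_splits)

lemma reduces_map:
  "inj_on f (set s \<union> set w) \<Longrightarrow> reduces (map f s) (map f w) \<longleftrightarrow> reduces s w"
proof (induction s w rule: reduces.induct)
  case (3 b s a w)
  have "f a = f b \<longleftrightarrow> a = b" using "3.prems" by (auto dest: inj_onD)
  moreover have "inj_on f (set s \<union> set w)" using "3.prems" by (rule inj_on_subset) auto
  moreover have "set (a # b # s) \<union> set w = set (b # s) \<union> set (a # w)" by auto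
  ultimately show ?case using 3 by auto
qed auto

text \<open>Of the open letters only the top of the stack may be closed. Closing another one would
  push a second copy of it, which nothing later can cancel because the letter has no occurrence
  left. Hence only the indices on the stack matter, as for creation and annihilation.\<close>

lemma card_completions_reducing:
  "distinct s \<Longrightarrow> \<forall>x\<in>set s. fst x < k \<Longrightarrow> inj_on fst (set s) \<Longrightarrow>
     card {v \<in> completions k (set s) rs. reduces s v} = fock (map snd s) rs"
proof (induction rs arbitrary: k s)
  case Nil
  have "{v \<in> completions k (set s) []. reduces s v} = (if s = [] then {[]} else {})"
    by (auto simp: completions_Nil)
  then show ?case by simp
next
  case (Cons r rs)
  let ?x = "(k, r)"
  define N where "N = (#) ?x ` {v \<in> completions (Suc k) (set (?x # s)) rs. reduces (?x # s) v}"
  define O' where "O' = (if s \<noteq> [] \<and> snd (hd s) = r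
     then (#) (hd s) ` {v \<in> completions k (set (tl s)) rs. reduces (tl s) v} else {})"
  have xs: "?x \<notin> set s" using Cons.prems(2) by force
  have red_new: "reduces s (?x # v) \<longleftrightarrow> reduces (?x # s) v" for v
    using xs by (cases s) auto
  have red_old: "reduces s (x # v) \<longleftrightarrow> x = hd s \<and> reduces (tl s) v"
    if "x \<in> set s" "v \<in> completions k (set s - {x}) rs" for x v
  proof (cases "x = hd s")
    case True
    then show ?thesis using that(1) by (cases s) auto
  next
    case False
    have "fst x < k" using that(1) Cons.prems(2) by blast
    then have "x \<notin> set v" using that(2) unfolding completions_def by auto
    moreover have "count_list (x # s) x \<noteq> 0" by simp
    ultimately have "\<not> reduces (x # s) v"
      using reduces_count_list[of "x # s" v x] by (metis count_list_0_iff le_zero_eq)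
    then show ?thesis using that(1) False by (cases s) auto
  qed
  have "{v \<in> completions k (set s) (r # rs). reduces s v} = N \<union> O'"
  proof
    show "{v \<in> completions k (set s) (r # rs). reduces s v} \<subseteq> N \<union> O'"
    proof
      fix v assume "v \<in> {v \<in> completions k (set s) (r # rs). reduces s v}"
      then have v: "v \<in> completions k (set s) (r # rs)" "reduces s v" by auto
      from v(1) consider v' where "v = ?x # v'" "v' \<in> completions (Suc k) (insert ?x (set s)) rs"
        | x v' where "v = x # v'" "x \<in> set s" "snd x = r" "v' \<in> completions k (set s - {x}) rs"
        unfolding completions_Cons[OF Cons.prems(2,3)] by blast
      then show "v \<in> N \<union> O'"
      proof cases
        case 1
        then show ?thesis using v(2) red_new unfolding N_def by auto
      next
        case 2
        then have "x = hd s" and "reduces (tl s) v'" using v(2) red_old by auto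
        moreover have "set s - {hd s} = set (tl s)" using 2(2) Cons.prems(1) by (cases s) auto
        ultimately have m: "v' \<in> {v \<in> completions k (set (tl s)) rs. reduces (tl s) v}"
          using 2(4) \<open>x = hd s\<close> by simp
        have c: "s \<noteq> [] \<and> snd (hd s) = r" using 2(2,3) \<open>x = hd s\<close> by auto
        have "v \<in> O'" unfolding O'_def if_P[OF c] using m 2(1) \<open>x = hd s\<close> by blast
        then show ?thesis by blast
      qed
    qed
    show "N \<union> O' \<subseteq> {v \<in> completions k (set s) (r # rs). reduces s v}"
    proof
      fix v assume "v \<in> N \<union> O'"
      then consider "v \<in> N" | "v \<in> O'" by blast
      then show "v \<in> {v \<in> completions k (set s) (r # rs). reduces s v}"
      proof cases
        case 1
        then show ?thesis using red_new unfolding N_def completions_Cons[OF Cons.prems(2,3)] by auto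
      next
        case 2
        then have c: "s \<noteq> [] \<and> snd (hd s) = r" unfolding O'_def by (metis empty_iff)
        from 2 obtain v' where v: "v = hd s # v'"
          "v' \<in> completions k (set (tl s)) rs" "reduces (tl s) v'"
          unfolding O'_def if_P[OF c] by blast
        have s: "set s - {hd s} = set (tl s)" "hd s \<in> set s" using c Cons.prems(1) by (cases s; simp)+
        then have "v \<in> completions k (set s) (r # rs)"
          using c v(1,2) unfolding completions_Cons[OF Cons.prems(2,3)]
          by (intro UnI2 UN_I[of "hd s"] image_eqI[of _ _ v']) simp_all
        then show ?thesis using v s red_old[of "hd s" v'] by simp
      qed
    qed
  qed
  moreover have "card N = fock (r # map snd s) rs"
  proof -
    have "card N = card {v \<in> completions (Suc k) (set (?x # s)) rs. reduces (?x # s) v}"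
      unfolding N_def by (rule card_image) auto
    also have "\<dots> = fock (map snd (?x # s)) rs"
      using Cons.prems xs by (intro Cons.IH) (auto simp: less_Suc_eq)
    finally show ?thesis by simp
  qed
  moreover have "card O' = (if map snd s \<noteq> [] \<and> hd (map snd s) = r then fock (tl (map snd s)) rs else 0)"
  proof (cases "s \<noteq> [] \<and> snd (hd s) = r")
    case True
    have "card O' = card {v \<in> completions k (set (tl s)) rs. reduces (tl s) v}"
      using True unfolding O'_def by (simp add: card_image)
    also have "\<dots> = fock (map snd (tl s)) rs"
    proof (rule Cons.IH)
      show "distinct (tl s)" using Cons.prems(1) by (rule distinct_tl)
      show "\<forall>x\<in>set (tl s). fst x < k" using Cons.prems(2) by (meson list.set_sel(2) True)
      show "inj_on fst (set (tl s))"
        using Cons.prems(3) by (rule inj_on_subset) (meson list.set_sel(2) True subsetI)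
    qed
    finally show ?thesis using True by (simp add: hd_map map_tl)
  qed (auto simp: O'_def hd_map)
  moreover have "N \<inter> O' = {}"
    using xs unfolding N_def O'_def by (auto split: if_splits)
  moreover have "finite N" "finite O'"
  proof -
    have "finite {v \<in> completions k (set s) (r # rs). reduces s v}"
      using Cons.prems finite_completions[of "set s" k "r # rs"] by simp
    then show "finite N" "finite O'" using calculation(1) by simp_all
  qed
  ultimately show ?case by (simp add: card_Un_disjoint)
qed

lemma card_indexed_pair_words_reducing:
  "card {v \<in> indexed_pair_words rs. reduces [] (drop_indices v)} = fock [] rs"
proof -
  have "reduces [] (drop_indices v) \<longleftrightarrow> reduces [] v" if "v \<in> indexed_pair_words rs" for v
    using that reduces_map[of fst "[]" v]
    by (auto simp: indexed_pair_words_eq_completions completions_def drop_indices_def)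
  then have "{v \<in> indexed_pair_words rs. reduces [] (drop_indices v)} =
      {v \<in> completions 0 (set []) rs. reduces [] v}"
    by (auto simp: indexed_pair_words_eq_completions)
  then show ?thesis using card_completions_reducing[of "[]" 0 rs] by simp
qed

section \<open>Moments of the increments\<close>

lemma prod_list_map_eq_prod_count:
  fixes f :: "'a \<Rightarrow> 'b :: comm_monoid_mult"
  shows "finite A \<Longrightarrow> set xs \<subseteq> A \<Longrightarrow> prod_list (map f xs) = (\<Prod>x\<in>A. f x ^ count_list xs x)"
proof (induction xs)
  case (Cons y xs)
  have "(\<Prod>x\<in>A. f x ^ count_list (y # xs) x) = (\<Prod>x\<in>A. (if x = y then f x else 1) * f x ^ count_list xs x)"
    by (intro prod.cong refl) auto
  also have "\<dots> = (\<Prod>x\<in>A. if x = y then f x else 1) * (\<Prod>x\<in>A. f x ^ count_list xs x)"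
    by (rule prod.distrib)
  also have "(\<Prod>x\<in>A. if x = y then f x else 1) = f y" using Cons.prems by (simp add: prod.delta)
  also have "(\<Prod>x\<in>A. f x ^ count_list xs x) = prod_list (map f xs)" using Cons by simp
  finally show ?case by simp
qed simp

section \<open>Moments of finite sums of input variables\<close>

locale input_variables = prob_space M for M :: "'w measure" +
  fixes X :: "'w input"
  assumes input: "assumption_I M X"
begin

definition index :: "nat list \<Rightarrow> bool" where "index a \<longleftrightarrow> length a \<in> {1, 2}"

lemma indep_inputs: "indep_vars (\<lambda>_. borel) (\<lambda>(r, k). X r k) input_indices"
  using input by (simp add: assumption_I_def)

lemma input_indices_iff: "(a, k) \<in> input_indices \<longleftrightarrow> index a \<and> 1 \<le> k"
  by (auto simp: input_indices_def index_def)

lemma measurable_input: "index a \<Longrightarrow> 1 \<le> k \<Longrightarrow> X a k \<in> borel_measurable M"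
  using indep_inputs input_indices_iff[of a k] unfolding indep_vars_def by auto

lemma input_facts:
  assumes "index a" "1 \<le> k"
  shows "integrable M (X a k)" "integrable M (\<lambda>\<omega>. (X a k \<omega>)\<^sup>2)"
    "expectation (X a k) = 0" "expectation (\<lambda>\<omega>. (X a k \<omega>)\<^sup>2) = 1"
proof -
  have "(a, k) \<in> input_indices" using assms by (simp add: input_indices_iff)
  then have *: "integrable M (X a k) \<and> integrable M (\<lambda>\<omega>. (X a k \<omega>)\<^sup>2) \<and>
      expectation (X a k) = 0 \<and> variance (X a k) = 1"
    using input unfolding assumption_I_def by blast
  then show "integrable M (X a k)" "integrable M (\<lambda>\<omega>. (X a k \<omega>)\<^sup>2)" by auto
  from * show e0: "expectation (X a k) = 0" by blast
  from * have "variance (X a k) = 1" by blast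
  then show "expectation (\<lambda>\<omega>. (X a k \<omega>)\<^sup>2) = 1" by (simp only: e0 diff_zero)
qed

text \<open>Assumption I gives uniform bounds from degree 3 on; degrees 1 and 2 come from the
  normalisation.\<close>

lemma input_moments:
  "\<exists>C\<ge>0. \<forall>a k. index a \<longrightarrow> 1 \<le> k \<longrightarrow>
     integrable M (\<lambda>\<omega>. X a k \<omega> ^ q) \<and> \<bar>expectation (\<lambda>\<omega>. X a k \<omega> ^ q)\<bar> \<le> C"
proof -
  consider "q = 0" | "q = 1" | "q = 2" | "3 \<le> q" by linarith
  then show ?thesis
  proof cases
    case 1
    then show ?thesis by (intro exI[of _ 1]) (simp add: prob_space)
  next
    case 2
    then show ?thesis using input_facts by (intro exI[of _ 0]) simp
  next
    case 3
    then show ?thesis using input_facts by (intro exI[of _ 1]) simp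
  next
    case 4
    obtain C where C: "\<And>i j k. 1 \<le> k \<Longrightarrow>
        integrable M (\<lambda>\<omega>. \<bar>X [i, j] k \<omega>\<bar> ^ q + \<bar>X [i] k \<omega>\<bar> ^ q) \<and>
        expectation (\<lambda>\<omega>. \<bar>X [i, j] k \<omega>\<bar> ^ q + \<bar>X [i] k \<omega>\<bar> ^ q) \<le> C"
      using input 4 unfolding assumption_I_def by meson
    have bound: "integrable M (\<lambda>\<omega>. X a k \<omega> ^ q) \<and> \<bar>expectation (\<lambda>\<omega>. X a k \<omega> ^ q)\<bar> \<le> C"
      if a: "index a" and k: "1 \<le> k" for a k
    proof -
      obtain i j where ij: "a = [i, j] \<or> a = [i]"
        using a unfolding index_def by (auto simp: length_Suc_conv numeral_2_eq_2)
      let ?g = "\<lambda>\<omega>. \<bar>X [i, j] k \<omega>\<bar> ^ q + \<bar>X [i] k \<omega>\<bar> ^ q"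
      have le: "\<bar>X a k \<omega> ^ q\<bar> \<le> ?g \<omega>" for \<omega>
        using ij by (auto simp: power_abs)
      have int: "integrable M ?g" using C[OF k] by blast
      have meas: "X a k \<in> borel_measurable M" using a k by (rule measurable_input)
      have "integrable M (\<lambda>\<omega>. X a k \<omega> ^ q)"
      proof (rule Bochner_Integration.integrable_bound[OF int])
        show "AE \<omega> in M. norm (X a k \<omega> ^ q) \<le> norm (?g \<omega>)"
          using le by (intro AE_I2) (simp add: order_trans[OF le abs_ge_self])
      qed (use meas in measurable)
      moreover have "\<bar>expectation (\<lambda>\<omega>. X a k \<omega> ^ q)\<bar> \<le> expectation (\<lambda>\<omega>. \<bar>X a k \<omega> ^ q\<bar>)"
        by (rule integral_abs_bound)
      moreover have "expectation (\<lambda>\<omega>. \<bar>X a k \<omega> ^ q\<bar>) \<le> expectation ?g"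
        using calculation(1) int le by (intro integral_mono integrable_abs) auto
      ultimately show ?thesis using C[OF k, of i j] by linarith
    qed
    then show ?thesis by (intro exI[of _ "max 0 C"]) fastforce
  qed
qed

lemma integrable_input_power: "index a \<Longrightarrow> 1 \<le> k \<Longrightarrow> integrable M (\<lambda>\<omega>. X a k \<omega> ^ q)"
  using input_moments[of q] by blast

definition block_sum :: "nat list \<Rightarrow> nat set \<Rightarrow> 'w \<Rightarrow> real" where
  "block_sum a I \<omega> = (\<Sum>k\<in>I. X a k \<omega>)"

lemma block_sum_indep:
  assumes "index a" "finite I" "insert k I \<subseteq> {1..}" "k \<notin> I"
  shows "indep_var borel (X a k) borel (block_sum a I)"
proof -
  have "indep_vars (\<lambda>_. borel) (\<lambda>(r, k). X r k) (insert (a, k) (Pair a ` I))"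
    using assms by (intro indep_vars_subset[OF indep_inputs]) (auto simp: input_indices_iff)
  then have "indep_var borel ((\<lambda>(r, k). X r k) (a, k)) borel (\<lambda>\<omega>. \<Sum>i\<in>Pair a ` I. (\<lambda>(r, k). X r k) i \<omega>)"
    using assms by (intro indep_vars_sum) auto
  moreover have "(\<lambda>\<omega>. \<Sum>i\<in>Pair a ` I. (\<lambda>(r, k). X r k) i \<omega>) = block_sum a I"
    by (simp add: fun_eq_iff block_sum_def sum.reindex inj_on_def)
  ultimately show ?thesis by simp
qed

lemma block_sum_insert:
  assumes a: "index a" "finite I" "insert k I \<subseteq> {1..}" "k \<notin> I"
    and int: "\<And>i. integrable M (\<lambda>\<omega>. block_sum a I \<omega> ^ i)"
  shows "integrable M (\<lambda>\<omega>. block_sum a (insert k I) \<omega> ^ q)"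
    and "expectation (\<lambda>\<omega>. block_sum a (insert k I) \<omega> ^ q) =
      (\<Sum>j\<le>q. real (q choose j) * expectation (\<lambda>\<omega>. X a k \<omega> ^ j) * expectation (\<lambda>\<omega>. block_sum a I \<omega> ^ (q - j)))"
proof -
  have k: "1 \<le> k" using a by auto
  have ind: "indep_var borel (\<lambda>\<omega>. X a k \<omega> ^ j) borel (\<lambda>\<omega>. block_sum a I \<omega> ^ i)" for i j
    using indep_var_compose[OF block_sum_indep[OF a], of "\<lambda>x. x ^ j" borel "\<lambda>x. x ^ i" borel]
    by (simp add: comp_def)
  have eq: "block_sum a (insert k I) \<omega> ^ q =
      (\<Sum>j\<le>q. real (q choose j) * (X a k \<omega> ^ j * block_sum a I \<omega> ^ (q - j)))" for \<omega>
    using a by (simp add: block_sum_def binomial_ring mult.assoc)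
  have int': "integrable M (\<lambda>\<omega>. X a k \<omega> ^ j * block_sum a I \<omega> ^ i)" for i j
    using ind int integrable_input_power[OF a(1) k] by (intro indep_var_integrable)
  show "integrable M (\<lambda>\<omega>. block_sum a (insert k I) \<omega> ^ q)"
    unfolding eq by (intro Bochner_Integration.integrable_sum integrable_mult_right int')
  show "expectation (\<lambda>\<omega>. block_sum a (insert k I) \<omega> ^ q) =
      (\<Sum>j\<le>q. real (q choose j) * expectation (\<lambda>\<omega>. X a k \<omega> ^ j) * expectation (\<lambda>\<omega>. block_sum a I \<omega> ^ (q - j)))"
    unfolding eq using int' int integrable_input_power[OF a(1) k]
    by (subst Bochner_Integration.integral_sum)
      (auto intro!: sum.cong simp: indep_var_lebesgue_integral[OF ind])
qed

lemma integrable_block_sum_power: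
  "finite I \<Longrightarrow> I \<subseteq> {1..} \<Longrightarrow> index a \<Longrightarrow> integrable M (\<lambda>\<omega>. block_sum a I \<omega> ^ q)"
proof (induction I arbitrary: q rule: finite_induct)
  case empty
  then show ?case by (simp add: block_sum_def)
next
  case (insert k I)
  then show ?case by (intro block_sum_insert) auto
qed

lemma block_sum_mean_variance:
  "finite I \<Longrightarrow> I \<subseteq> {1..} \<Longrightarrow> index a \<Longrightarrow>
     expectation (block_sum a I) = 0 \<and> expectation (\<lambda>\<omega>. (block_sum a I \<omega>)\<^sup>2) = real (card I)"
proof (induction I rule: finite_induct)
  case empty
  then show ?case by (simp add: block_sum_def[abs_def])
next
  case (insert k I)
  then have IH: "expectation (block_sum a I) = 0" "expectation (\<lambda>\<omega>. (block_sum a I \<omega>)\<^sup>2) = real (card I)"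
    by auto
  have k: "1 \<le> k" using insert.prems by auto
  note e = block_sum_insert(2)[OF insert.prems(2) insert.hyps(1) insert.prems(1) insert.hyps(2)
      integrable_block_sum_power[OF insert.hyps(1) _ insert.prems(2)]]
  have 1: "expectation (block_sum a (insert k I)) = 0"
    using e[of 1] insert.prems IH input_facts[OF insert.prems(2) k] by (simp add: prob_space)
  have "{..2::nat} = {0, 1, 2}" by auto
  then have "expectation (\<lambda>\<omega>. (block_sum a (insert k I) \<omega>)\<^sup>2) = real (card I) + 1"
    using e[of 2] insert.prems IH input_facts[OF insert.prems(2) k] by (simp add: prob_space)
  then show ?case using 1 insert.hyps by simp
qed

text \<open>
  In the binomial expansion of \<open>(S + X)\<^sup>q\<close> the term linear in \<open>X\<close> has mean zero, so adding one variable
  changes the moment by at most the order of the moments of degree \<open>q - 2\<close>.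
\<close>

lemma block_sum_moment_bound:
  "\<exists>K\<ge>0. \<forall>a I. index a \<longrightarrow> finite I \<longrightarrow> I \<subseteq> {1..} \<longrightarrow>
     \<bar>expectation (\<lambda>\<omega>. block_sum a I \<omega> ^ q)\<bar> \<le> K * real (card I) ^ (q div 2)"
proof (induction q rule: less_induct)
  case (less q)
  consider "q = 0" | "q = 1" | "2 \<le> q" by linarith
  then show ?case
  proof cases
    case 1
    then show ?thesis by (intro exI[of _ 1]) (simp add: prob_space)
  next
    case 2
    then show ?thesis using block_sum_mean_variance by (intro exI[of _ 0]) simp
  next
    case 3
    have "\<forall>i. \<exists>K\<ge>0. i < q \<longrightarrow> (\<forall>a I. index a \<longrightarrow> finite I \<longrightarrow> I \<subseteq> {1..} \<longrightarrow>
        \<bar>expectation (\<lambda>\<omega>. block_sum a I \<omega> ^ i)\<bar> \<le> K * real (card I) ^ (i div 2))"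
      using less by (metis order_refl)
    then obtain K where K: "\<And>i. K i \<ge> 0" "\<And>i a I. i < q \<Longrightarrow> index a \<Longrightarrow> finite I \<Longrightarrow> I \<subseteq> {1..} \<Longrightarrow>
        \<bar>expectation (\<lambda>\<omega>. block_sum a I \<omega> ^ i)\<bar> \<le> K i * real (card I) ^ (i div 2)" by metis
    obtain C where C: "\<And>j. C j \<ge> 0" "\<And>j a k. index a \<Longrightarrow> 1 \<le> k \<Longrightarrow>
        \<bar>expectation (\<lambda>\<omega>. X a k \<omega> ^ j)\<bar> \<le> C j" using input_moments by metis
    define h where "h = (q - 2) div 2"
    \<comment> \<open>Adding a variable to \<open>c\<close> others costs at most
      \<open>B * (c + 1) ^ h\<close>. Since
      \<open>B * c * (c + 1) ^ h + B * (c + 1) ^ h = B * (c + 1) ^ Suc h\<close>, the induction on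
      the set closes with the same \<open>B\<close>.\<close>
    define B where "B = (\<Sum>j\<in>{2..q}. real (q choose j) * C j * K (q - j))"
    have B: "B \<ge> 0" unfolding B_def by (intro sum_nonneg mult_nonneg_nonneg C K) simp
    have qh: "q div 2 = Suc h" using 3 by (simp add: h_def)
    have "\<bar>expectation (\<lambda>\<omega>. block_sum a I \<omega> ^ q)\<bar> \<le> B * real (card I) ^ Suc h"
      if "finite I" "I \<subseteq> {1..}" "index a" for a I
      using that
    proof (induction I rule: finite_induct)
      case empty
      then show ?case using 3 by (simp add: block_sum_def power_0_left)
    next
      case (insert k I)
      let ?E = "\<lambda>i. expectation (\<lambda>\<omega>. block_sum a I \<omega> ^ i)" and ?c = "real (card I)"
      let ?m = "\<lambda>j. real (q choose j) * expectation (\<lambda>\<omega>. X a k \<omega> ^ j) * ?E (q - j)"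
      have k: "1 \<le> k" using insert.prems by auto
      have I: "I \<subseteq> {1..}" using insert.prems by auto
      have "expectation (\<lambda>\<omega>. block_sum a (insert k I) \<omega> ^ q) = (\<Sum>j\<le>q. ?m j)"
        using insert by (intro block_sum_insert integrable_block_sum_power) auto
      also have "{..q} = insert 0 (insert 1 {2..q})" using 3 by auto
      also have "(\<Sum>j\<in>\<dots>. ?m j) = ?E q + (\<Sum>j\<in>{2..q}. ?m j)"
        using input_facts(3)[OF insert.prems(2) k] by (simp add: prob_space)
      finally have e: "expectation (\<lambda>\<omega>. block_sum a (insert k I) \<omega> ^ q) = ?E q + (\<Sum>j\<in>{2..q}. ?m j)" .
      have "\<bar>?m j\<bar> \<le> (real (q choose j) * C j * K (q - j)) * (?c + 1) ^ h" if j: "j \<in> {2..q}" for j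
      proof -
        have "\<bar>?E (q - j)\<bar> \<le> K (q - j) * ?c ^ ((q - j) div 2)"
          using j 3 insert I by (intro K(2)) auto
        also have "?c ^ ((q - j) div 2) \<le> (?c + 1) ^ ((q - j) div 2)" by (intro power_mono) auto
        also have "\<dots> \<le> (?c + 1) ^ h"
          using j unfolding h_def by (intro power_increasing div_le_mono) auto
        finally have "\<bar>?E (q - j)\<bar> \<le> K (q - j) * (?c + 1) ^ h"
          using K(1) by (simp add: mult_left_mono)
        then have "\<bar>?m j\<bar> \<le> real (q choose j) * C j * (K (q - j) * (?c + 1) ^ h)"
          unfolding abs_mult using C K(1) insert.prems k by (intro mult_mono) auto
        then show ?thesis by (simp add: mult.assoc)
      qed
      then have "\<bar>\<Sum>j\<in>{2..q}. ?m j\<bar> \<le> B * (?c + 1) ^ h"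
        unfolding B_def sum_distrib_right by (intro order_trans[OF sum_abs] sum_mono)
      moreover have "\<bar>?E q\<bar> \<le> B * ?c ^ Suc h" using insert I by auto
      moreover have "B * ?c ^ Suc h \<le> B * (?c * (?c + 1) ^ h)"
        using B by (intro mult_left_mono) (auto intro!: mult_left_mono power_mono)
      ultimately have "\<bar>expectation (\<lambda>\<omega>. block_sum a (insert k I) \<omega> ^ q)\<bar>
          \<le> B * (?c * (?c + 1) ^ h) + B * (?c + 1) ^ h" unfolding e by linarith
      also have "\<dots> = B * real (card (insert k I)) ^ Suc h"
        using insert.hyps by (simp add: algebra_simps)
      finally show ?case .
    qed
    then show ?thesis using B qh by (intro exI[of _ B]) auto
  qed
qed

end

section \<open>Time grids and the blocks of summation indices that belong to them\<close>

lemma tendsto_floor_over_n: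
  assumes "0 \<le> x"
  shows "(\<lambda>n. real (nat \<lfloor>real n * x\<rfloor>) / real n) \<longlonglongrightarrow> x"
proof (rule tendsto_sandwich)
  show "\<forall>\<^sub>F n in sequentially. x - 1 / real n \<le> real (nat \<lfloor>real n * x\<rfloor>) / real n"
    using eventually_gt_at_top[of 0]
  proof eventually_elim
    case (elim n)
    have "real n * x - 1 \<le> real (nat \<lfloor>real n * x\<rfloor>)" using assms by linarith
    then have "(real n * x - 1) / real n \<le> real (nat \<lfloor>real n * x\<rfloor>) / real n"
      by (rule divide_right_mono) simp
    then show ?case using elim by (simp add: diff_divide_distrib)
  qed
  show "\<forall>\<^sub>F n in sequentially. real (nat \<lfloor>real n * x\<rfloor>) / real n \<le> x"
    using eventually_gt_at_top[of 0]
  proof eventually_elim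
    case (elim n)
    have "real (nat \<lfloor>real n * x\<rfloor>) \<le> real n * x" using assms by simp
    then show ?case using elim by (simp add: field_simps)
  qed
  have "(\<lambda>n. x - 1 / real n) \<longlonglongrightarrow> x - 0" by (intro tendsto_intros lim_const_over_n)
  then show "(\<lambda>n. x - 1 / real n) \<longlonglongrightarrow> x" by simp
qed simp

definition increasing_times :: "nat \<Rightarrow> (nat \<Rightarrow> real) \<Rightarrow> bool" where
  "increasing_times p t \<longleftrightarrow> 0 \<le> t 0 \<and> (\<forall>r\<in>{1..p}. t (r - 1) < t r)"

lemma increasing_times_mono:
  assumes "increasing_times p t" "r \<le> r'" "r' \<le> p"
  shows "t r \<le> t r'"
  using assms(2,3)
proof (induction r' rule: dec_induct)
  case (step m)
  have "Suc m \<in> {1..p}" using step.prems by simp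
  then have "t (Suc m - 1) < t (Suc m)" using assms(1) unfolding increasing_times_def by blast
  then show ?case using step by simp
qed simp

lemma increasing_times_nonneg:
  assumes "increasing_times p t" "r \<le> p"
  shows "0 \<le> t r"
  using increasing_times_mono[OF assms(1), of 0 r] assms by (auto simp: increasing_times_def)

definition block :: "(nat \<Rightarrow> real) \<Rightarrow> nat \<Rightarrow> nat \<Rightarrow> nat set" where
  "block t n r = {nat \<lfloor>real n * t (r - 1)\<rfloor><..nat \<lfloor>real n * t r\<rfloor>}"

lemma finite_block [simp]: "finite (block t n r)" and block_subset: "block t n r \<subseteq> {1..}"
  by (auto simp: block_def)

lemma block_disjoint:
  assumes t: "increasing_times p t" and "r \<in> {1..p}" "r' \<in> {1..p}" "r \<noteq> r'"
  shows "block t n r \<inter> block t n r' = {}"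
proof -
  have "block t n i \<inter> block t n j = {}" if "i \<le> j - 1" "j \<le> p" for i j
  proof -
    have "t i \<le> t (j - 1)" using that by (intro increasing_times_mono[OF t]) auto
    then have "real n * t i \<le> real n * t (j - 1)" by (intro mult_left_mono) auto
    then have "nat \<lfloor>real n * t i\<rfloor> \<le> nat \<lfloor>real n * t (j - 1)\<rfloor>"
      by (intro nat_mono floor_mono)
    moreover have "{a<..b} \<inter> {c<..d} = {}" if "b \<le> c" for a b c d :: nat using that by auto
    ultimately show ?thesis unfolding block_def by blast
  qed
  note * = this
  show ?thesis
  proof (cases "r < r'")
    case True
    then show ?thesis using assms(3) by (intro *) auto
  next
    case False
    then have "block t n r' \<inter> block t n r = {}" using assms(2,4) by (intro *) auto
    then show ?thesis by (simp add: Int_commute)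
  qed
qed

text \<open>The factor \<open>1 + t p\<close> instead of \<open>t p\<close> is at least 1, which
  later lets its square root absorb rounding in exponents.\<close>

lemma card_block_bound:
  assumes t: "increasing_times p t" and "r \<in> {1..p}"
  shows "real (card (block t n r)) \<le> (1 + t p) * real n"
proof -
  have "0 \<le> t r" "t r \<le> t p"
    using assms(2) increasing_times_nonneg[OF t] increasing_times_mono[OF t] by auto
  then have "real (nat \<lfloor>real n * t r\<rfloor>) \<le> real n * t r" by simp
  also have "\<dots> \<le> real n * (1 + t p)" using \<open>t r \<le> t p\<close> by (intro mult_left_mono) auto
  finally have "real (nat \<lfloor>real n * t r\<rfloor>) \<le> (1 + t p) * real n" by (simp add: mult.commute)
  then show ?thesis by (simp add: block_def)
qed

lemma card_block_limit:
  assumes t: "increasing_times p t" and r: "r \<in> {1..p}"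
  shows "(\<lambda>n. real (card (block t n r)) / real n) \<longlonglongrightarrow> t r - t (r - 1)"
proof -
  have nn: "0 \<le> t r" "0 \<le> t (r - 1)" using r increasing_times_nonneg[OF t] by auto
  have le: "t (r - 1) \<le> t r" using r by (intro increasing_times_mono[OF t]) auto
  have "nat \<lfloor>real n * t (r - 1)\<rfloor> \<le> nat \<lfloor>real n * t r\<rfloor>" for n
    using le by (intro nat_mono floor_mono mult_left_mono) auto
  then have "real (card (block t n r)) / real n =
      real (nat \<lfloor>real n * t r\<rfloor>) / real n - real (nat \<lfloor>real n * t (r - 1)\<rfloor>) / real n" for n
    by (simp add: block_def of_nat_diff diff_divide_distrib)
  then show ?thesis using tendsto_diff[OF tendsto_floor_over_n[OF nn(1)] tendsto_floor_over_n[OF nn(2)]]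
    by simp
qed

text \<open>Every position carries a standard deviation, so that a matched pair of positions with
  the same interval contributes the variance.\<close>

definition weight :: "(nat \<Rightarrow> real) \<Rightarrow> nat list \<Rightarrow> real" where
  "weight t rs = prod_list (map (\<lambda>r. sqrt (t r - t (r - 1))) rs)"

definition compatible :: "'a list \<Rightarrow> nat list \<Rightarrow> bool" where
  "compatible w rs \<longleftrightarrow> length w = length rs \<and>
     (\<forall>i<length w. \<forall>j<length w. w ! i = w ! j \<longrightarrow> rs ! i = rs ! j)"

text \<open>The indices of an indexed word are fixed by \<open>rs\<close>, so only the pairing is
  free, and it must join positions of equal index.\<close>

lemma bij_betw_indexed_pair_words:
  "bij_betw drop_indices (indexed_pair_words rs) {w \<in> words (length rs). paired w \<and> compatible w rs}"
proof (rule bij_betw_byWitness[where f' = "\<lambda>w. zip w rs"])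
  show "\<forall>v\<in>indexed_pair_words rs. zip (drop_indices v) rs = v"
    by (auto simp: indexed_pair_words_def drop_indices_def zip_map_fst_snd)
  show "\<forall>w\<in>{w \<in> words (length rs). paired w \<and> compatible w rs}. drop_indices (zip w rs) = w"
    by (auto simp: drop_indices_def words_def)
  show "drop_indices ` indexed_pair_words rs \<subseteq> {w \<in> words (length rs). paired w \<and> compatible w rs}"
  proof
    fix w assume "w \<in> drop_indices ` indexed_pair_words rs"
    then obtain v where v: "v \<in> indexed_pair_words rs" "w = drop_indices v" by blast
    then have "w \<in> pair_words (length rs)" using drop_indices_pair_words by blast
    then have "w \<in> words (length rs)" "paired w" by (auto simp: pair_words_def words_def paired_def)
    moreover have "compatible w rs" unfolding compatible_def
    proof (intro conjI allI impI)
      have sr: "map snd v = rs" and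
        ne: "\<And>x y. x \<in> set v \<Longrightarrow> y \<in> set v \<Longrightarrow> snd x \<noteq> snd y \<Longrightarrow> fst x \<noteq> fst y"
        using v(1) unfolding indexed_pair_words_def by auto
      show "length w = length rs" using v(2) sr by (auto simp: drop_indices_def)
      fix i j assume ij: "i < length w" "j < length w" "w ! i = w ! j"
      then have "i < length v" "j < length v" "fst (v ! i) = fst (v ! j)"
        unfolding v(2) drop_indices_def by auto
      moreover have "v ! i \<in> set v" "v ! j \<in> set v" using calculation(1,2) by auto
      ultimately have "snd (v ! i) = snd (v ! j)" using ne by blast
      then show "rs ! i = rs ! j" using \<open>i < length v\<close> \<open>j < length v\<close> unfolding sr[symmetric] by simp
    qed
    ultimately show "w \<in> {w \<in> words (length rs). paired w \<and> compatible w rs}" by simp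
  qed
  show "(\<lambda>w. zip w rs) ` {w \<in> words (length rs). paired w \<and> compatible w rs} \<subseteq> indexed_pair_words rs"
  proof
    fix v assume "v \<in> (\<lambda>w. zip w rs) ` {w \<in> words (length rs). paired w \<and> compatible w rs}"
    then obtain w where w: "w \<in> words (length rs)" "paired w" "compatible w rs" "v = zip w rs" by blast
    have l: "length w = length rs" using w by (simp add: words_def)
    have k: "same_kernel v w" unfolding same_kernel_def
    proof (intro conjI allI impI)
      show "length v = length w" using l w(4) by simp
      fix i j assume ij: "i < length v" "j < length v"
      then have "i < length w" "j < length w" using w(4) l by simp_all
      then have "w ! i = w ! j \<Longrightarrow> rs ! i = rs ! j" using w(3) unfolding compatible_def by blast
      moreover have "v ! i = (w ! i, rs ! i)" "v ! j = (w ! j, rs ! j)" using ij w(4) l by auto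
      ultimately show "v ! i = v ! j \<longleftrightarrow> w ! i = w ! j" by (metis prod.inject)
    qed
    have wi: "w ! i = fst (v ! i)" if "i < length v" for i using that w(4) l by simp
    have f: "w = map fst v" and s: "map snd v = rs" using w(4) l by auto
    have inj: "inj_on fst (set v)"
    proof (rule inj_onI)
      fix x y assume xy: "x \<in> set v" "y \<in> set v" "fst x = fst y"
      from xy(1) obtain i where i: "i < length v" "x = v ! i" by (metis in_set_conv_nth)
      from xy(2) obtain j where j: "j < length v" "y = v ! j" by (metis in_set_conv_nth)
      have "w ! i = w ! j" using xy(3) i j wi by simp
      then show "x = y" using k i j unfolding same_kernel_def by blast
    qed
    have "count_list v x = 2" if "x \<in> set v" for x
      using same_kernel_count_list[OF inj that] w(2) that unfolding f paired_def by auto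
    moreover have "is_word (map fst v)" using w(1) f by (simp add: words_def)
    moreover have "\<forall>x\<in>set v. \<forall>y\<in>set v. snd x \<noteq> snd y \<longrightarrow> fst x \<noteq> fst y"
      using inj unfolding inj_on_def by blast
    ultimately show "v \<in> indexed_pair_words rs" using s by (simp add: indexed_pair_words_def)
  qed
qed

lemma count_list_eq_card: "count_list xs x = card {i. i < length xs \<and> xs ! i = x}"
  by (simp add: count_list_eq_length_filter length_filter_conv_card eq_commute)

context input_variables
begin

definition increment :: "(nat \<Rightarrow> real) \<Rightarrow> nat \<Rightarrow> nat list \<times> nat \<Rightarrow> 'w \<Rightarrow> real" where
  "increment t n c = block_sum (fst c) (block t n (snd c))"

lemma walk_increment:
  assumes "t (r - 1) \<le> t r"
  shows "walk X n a (t r) \<omega> - walk X n a (t (r - 1)) \<omega> = increment t n (a, r) \<omega>"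
proof -
  have le: "nat \<lfloor>real n * t (r - 1)\<rfloor> \<le> nat \<lfloor>real n * t r\<rfloor>" (is "?a \<le> ?b")
    using assms by (intro nat_mono floor_mono mult_left_mono) auto
  then have e: "{1..?b} = {1..?a} \<union> {?a<..?b}" by auto
  have "(\<Sum>k=1..?b. X a k \<omega>) = (\<Sum>k=1..?a. X a k \<omega>) + (\<Sum>k\<in>{?a<..?b}. X a k \<omega>)"
    unfolding e by (rule sum.union_disjoint) auto
  then show ?thesis by (simp add: walk_def increment_def block_sum_def block_def)
qed

definition valid_index :: "nat \<Rightarrow> nat list \<times> nat \<Rightarrow> bool" where
  "valid_index p c \<longleftrightarrow> index (fst c) \<and> snd c \<in> {1..p}"

text \<open>Increments with different labels are sums over disjoint sets of input variables: either
  the link values differ or the blocks are disjoint.\<close>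

lemma indep_increments:
  assumes t: "increasing_times p t"
  shows "indep_vars (\<lambda>_. borel) (increment t n) {c. valid_index p c}"
proof -
  let ?K = "\<lambda>c. Pair (fst c) ` block t n (snd c)"
  have "indep_vars (\<lambda>c. PiM (?K c) (\<lambda>_. borel :: real measure))
      (\<lambda>c \<omega>. restrict (\<lambda>i. (\<lambda>(r, k). X r k) i \<omega>) (?K c)) {c. valid_index p c}"
  proof (rule indep_vars_restrict[OF indep_inputs])
    show "?K c \<subseteq> input_indices" if "c \<in> {c. valid_index p c}" for c
      using that block_subset[of t n "snd c"] by (auto simp: input_indices_iff valid_index_def)
    show "disjoint_family_on ?K {c. valid_index p c}"
      unfolding disjoint_family_on_def
    proof (intro ballI impI)
      fix c c' assume c: "c \<in> {c. valid_index p c}" "c' \<in> {c. valid_index p c}" "c \<noteq> c'"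
      show "?K c \<inter> ?K c' = {}"
      proof (cases "fst c = fst c'")
        case True
        then have "snd c \<noteq> snd c'" using c by (auto simp: prod_eq_iff)
        then show ?thesis using c block_disjoint[OF t, of "snd c" "snd c'" n]
          by (auto simp: valid_index_def)
      qed auto
    qed
  qed
  then have "indep_vars (\<lambda>_. borel)
      (\<lambda>c \<omega>. (\<lambda>f. \<Sum>i\<in>?K c. f i) (restrict (\<lambda>i. (\<lambda>(r, k). X r k) i \<omega>) (?K c))) {c. valid_index p c}"
    by (rule indep_vars_compose2) (auto intro!: borel_measurable_sum measurable_component_singleton)
  moreover have "(\<lambda>c \<omega>. (\<lambda>f. \<Sum>i\<in>?K c. f i) (restrict (\<lambda>i. (\<lambda>(r, k). X r k) i \<omega>) (?K c))) = increment t n"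
    by (auto simp: fun_eq_iff increment_def block_sum_def sum.reindex inj_on_def)
  ultimately show ?thesis by simp
qed

lemma increment_power_integrable: "valid_index p c \<Longrightarrow> integrable M (\<lambda>\<omega>. increment t n c \<omega> ^ q)"
  unfolding increment_def by (intro integrable_block_sum_power block_subset) (auto simp: valid_index_def)

lemma increment_mean_variance:
  assumes "valid_index p c"
  shows "expectation (increment t n c) = 0"
    and "expectation (\<lambda>\<omega>. (increment t n c \<omega>)\<^sup>2) = real (card (block t n (snd c)))"
  using block_sum_mean_variance[OF finite_block block_subset, of "fst c"] assms
  by (auto simp: increment_def valid_index_def)

lemma increment_product:
  assumes t: "increasing_times p t" and cs: "\<forall>c\<in>set cs. valid_index p c"
  shows "integrable M (\<lambda>\<omega>. prod_list (map (\<lambda>c. increment t n c \<omega>) cs))"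
    and "expectation (\<lambda>\<omega>. prod_list (map (\<lambda>c. increment t n c \<omega>) cs)) =
      (\<Prod>c\<in>set cs. expectation (\<lambda>\<omega>. increment t n c \<omega> ^ count_list cs c))"
proof -
  have eq: "prod_list (map (\<lambda>c. increment t n c \<omega>) cs) =
      (\<Prod>c\<in>set cs. increment t n c \<omega> ^ count_list cs c)" for \<omega>
    by (rule prod_list_map_eq_prod_count) auto
  have "indep_vars (\<lambda>_. borel) (increment t n) (set cs)"
    using cs by (intro indep_vars_subset[OF indep_increments[OF t]]) auto
  then have ind: "indep_vars (\<lambda>_. borel) (\<lambda>c \<omega>. increment t n c \<omega> ^ count_list cs c) (set cs)"
    by (rule indep_vars_compose2) auto
  have int: "integrable M (\<lambda>\<omega>. increment t n c \<omega> ^ count_list cs c)" if "c \<in> set cs" for c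
    using cs that increment_power_integrable by blast
  show "integrable M (\<lambda>\<omega>. prod_list (map (\<lambda>c. increment t n c \<omega>) cs))"
    unfolding eq by (rule indep_vars_integrable[OF finite_set ind int])
  show "expectation (\<lambda>\<omega>. prod_list (map (\<lambda>c. increment t n c \<omega>) cs)) =
      (\<Prod>c\<in>set cs. expectation (\<lambda>\<omega>. increment t n c \<omega> ^ count_list cs c))"
    unfolding eq by (rule indep_vars_lebesgue_integral[OF finite_set ind int])
qed

lemma increment_product_singleton:
  assumes t: "increasing_times p t" and cs: "\<forall>c\<in>set cs. valid_index p c"
    and "count_list cs c = 1"
  shows "expectation (\<lambda>\<omega>. prod_list (map (\<lambda>c. increment t n c \<omega>) cs)) = 0"
proof -
  have "count_list cs c \<noteq> 0" using assms(3) by simp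
  then have "c \<in> set cs" by (metis count_list_0_iff)
  moreover have "expectation (\<lambda>\<omega>. increment t n c \<omega> ^ count_list cs c) = 0"
    using increment_mean_variance(1)[of p c] cs assms(3) calculation by auto
  ultimately show ?thesis unfolding increment_product(2)[OF t cs] by (intro prod_zero) auto
qed

lemma increment_product_paired:
  assumes t: "increasing_times p t" and cs: "\<forall>c\<in>set cs. valid_index p c" and "paired cs"
  shows "expectation (\<lambda>\<omega>. prod_list (map (\<lambda>c. increment t n c \<omega>) cs)) =
     prod_list (map (\<lambda>r. sqrt (card (block t n r))) (map snd cs))"
proof -
  have "expectation (\<lambda>\<omega>. prod_list (map (\<lambda>c. increment t n c \<omega>) cs)) =
      (\<Prod>c\<in>set cs. sqrt (card (block t n (snd c))) ^ count_list cs c)"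
    unfolding increment_product(2)[OF t cs]
    using increment_mean_variance(2) cs assms(3) by (intro prod.cong refl) (auto simp: paired_def)
  also have "\<dots> = prod_list (map (\<lambda>c. sqrt (card (block t n (snd c)))) cs)"
    by (rule prod_list_map_eq_prod_count[symmetric]) auto
  finally show ?thesis by (simp add: comp_def)
qed

text \<open>A label of multiplicity \<open>q\<close> contributes \<open>O(n ^ (q div 2))\<close>,
  which is at most \<open>O(sqrt n ^ q)\<close>. So the product has the order
  \<open>sqrt n ^ l\<close> whatever labels coincide.\<close>

lemma increment_product_bound:
  assumes t: "increasing_times p t"
  shows "\<exists>K\<ge>0. \<forall>n cs. n > 0 \<longrightarrow> length cs = l \<longrightarrow> (\<forall>c\<in>set cs. valid_index p c) \<longrightarrow>
     \<bar>expectation (\<lambda>\<omega>. prod_list (map (\<lambda>c. increment t n c \<omega>) cs))\<bar> \<le> K * sqrt (real n) ^ l"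
proof -
  define b where "b = sqrt (1 + t p)"
  have tp: "0 \<le> t p" using increasing_times_nonneg[OF t] by simp
  then have b1: "b \<ge> 1" by (simp add: b_def)
  obtain K where K: "\<And>q. K q \<ge> 0" "\<And>q a I. index a \<Longrightarrow> finite I \<Longrightarrow> I \<subseteq> {1..} \<Longrightarrow>
      \<bar>expectation (\<lambda>\<omega>. block_sum a I \<omega> ^ q)\<bar> \<le> K q * real (card I) ^ (q div 2)"
    using block_sum_moment_bound by metis
  \<comment> \<open>The summand 1 keeps \<open>K'\<close> at least 1, so its power over the distinct
    labels is bounded by \<open>K' ^ l\<close>.\<close>
  define K' where "K' = 1 + (\<Sum>q\<le>l. K q)"
  have K'1: "K' \<ge> 1" unfolding K'_def using K(1) by (simp add: sum_nonneg)
  have KK': "K q \<le> K'" if "q \<le> l" for q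
  proof -
    have "K q \<le> (\<Sum>q\<le>l. K q)" using that K(1) by (intro member_le_sum) auto
    then show ?thesis by (simp add: K'_def)
  qed
  have main: "\<bar>expectation (\<lambda>\<omega>. prod_list (map (\<lambda>c. increment t n c \<omega>) cs))\<bar> \<le> K' ^ l * b ^ l * sqrt (real n) ^ l"
    if n: "n > 0" and l: "length cs = l" and cs: "\<forall>c\<in>set cs. valid_index p c" for n cs
  proof -
    define s where "s = b * sqrt (real n)"
    have s2: "s\<^sup>2 = (1 + t p) * real n" using tp by (simp add: s_def b_def power_mult_distrib)
    have "1 * 1 \<le> b * sqrt (real n)" using b1 n by (intro mult_mono) auto
    then have s1: "s \<ge> 1" by (simp add: s_def)
    have one: "\<bar>expectation (\<lambda>\<omega>. increment t n c \<omega> ^ count_list cs c)\<bar> \<le> K' * s ^ count_list cs c"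
      if c: "c \<in> set cs" for c
    proof -
      let ?q = "count_list cs c"
      have v: "valid_index p c" using cs c by blast
      have "\<bar>expectation (\<lambda>\<omega>. increment t n c \<omega> ^ ?q)\<bar> \<le> K ?q * real (card (block t n (snd c))) ^ (?q div 2)"
        unfolding increment_def using v by (intro K(2) block_subset) (auto simp: valid_index_def)
      also have "\<dots> \<le> K' * (s\<^sup>2) ^ (?q div 2)"
        using card_block_bound[OF t, of "snd c" n] v K(1) K'1 KK'[of ?q] count_le_length[of cs c] l
        unfolding s2 by (intro mult_mono power_mono) (auto simp: valid_index_def)
      also have "(s\<^sup>2) ^ (?q div 2) = s ^ (2 * (?q div 2))" by (simp add: power_mult)
      \<comment> \<open>Since \<open>s\<close> is at least 1, the rounding of an odd multiplicity
        costs nothing.\<close>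
      also have "\<dots> \<le> s ^ ?q" using s1 by (intro power_increasing) auto
      finally show ?thesis using K'1 by (simp add: mult_left_mono)
    qed
    have "\<bar>expectation (\<lambda>\<omega>. prod_list (map (\<lambda>c. increment t n c \<omega>) cs))\<bar> \<le> (\<Prod>c\<in>set cs. K' * s ^ count_list cs c)"
      unfolding increment_product(2)[OF t cs] abs_prod using one by (intro prod_mono) auto
    also have "\<dots> = K' ^ card (set cs) * (\<Prod>c\<in>set cs. s ^ count_list cs c)" by (simp add: prod.distrib)
    also have "(\<Prod>c\<in>set cs. s ^ count_list cs c) = prod_list (map (\<lambda>_. s) cs)"
      by (rule prod_list_map_eq_prod_count[symmetric]) auto
    also have "\<dots> = s ^ l" using l by (simp add: map_replicate_const prod_list_replicate)
    also have "K' ^ card (set cs) * s ^ l \<le> K' ^ l * s ^ l"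
      using K'1 s1 l card_length[of cs] by (intro mult_right_mono power_increasing) auto
    finally show ?thesis by (simp add: s_def power_mult_distrib)
  qed
  show ?thesis using main K'1 b1 by (intro exI[of _ "K' ^ l * b ^ l"]) auto
qed

end

section \<open>The trace as a sum over walks\<close>

lemma same_kernel_zip:
  assumes k: "same_kernel w es" and c: "compatible w rs"
  shows "same_kernel w (zip es rs)"
  unfolding same_kernel_def
proof (intro conjI allI impI)
  have l: "length es = length w" "length rs = length w"
    using k c by (simp_all add: same_kernel_def compatible_def)
  then show "length w = length (zip es rs)" by simp
  fix i j assume ij: "i < length w" "j < length w"
  then have "w ! i = w ! j \<longleftrightarrow> es ! i = es ! j" using k unfolding same_kernel_def by blast
  moreover have "w ! i = w ! j \<Longrightarrow> rs ! i = rs ! j" using c ij unfolding compatible_def by blast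
  moreover have "zip es rs ! i = (es ! i, rs ! i)" "zip es rs ! j = (es ! j, rs ! j)"
    using ij l by simp_all
  ultimately show "w ! i = w ! j \<longleftrightarrow> zip es rs ! i = zip es rs ! j" by (metis prod.inject)
qed

context input_variables
begin

definition walk_moment :: "link \<Rightarrow> (nat \<Rightarrow> real) \<Rightarrow> nat list \<Rightarrow> nat \<Rightarrow> nat list \<Rightarrow> real" where
  "walk_moment L t rs n xs =
     expectation (\<lambda>\<omega>. prod_list (map (\<lambda>c. increment t n c \<omega>) (zip (edges (L n) xs) rs)))"

lemma valid_index_edges:
  assumes "d \<in> {1, 2}" "link_function d L" "set rs \<subseteq> {1..p}" "xs \<in> walks n l"
  shows "\<forall>c\<in>set (zip (edges (L n) xs) rs). valid_index p c"
proof
  fix c assume "c \<in> set (zip (edges (L n) xs) rs)"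
  then have "(fst c, snd c) \<in> set (zip (edges (L n) xs) rs)" by simp
  then have c: "fst c \<in> set (edges (L n) xs)" "snd c \<in> set rs"
    by (rule set_zip_leftD, rule set_zip_rightD)
  from c(1) obtain i where "i < length (edges (L n) xs)" "edges (L n) xs ! i = fst c"
    by (metis in_set_conv_nth)
  then have i: "i < length xs - 1" "fst c = edges (L n) xs ! i" by simp_all
  have "xs ! i \<in> set xs" "xs ! Suc i \<in> set xs" using i(1) by (intro nth_mem; simp)+
  then have "xs ! i \<in> {1..n}" "xs ! Suc i \<in> {1..n}" using assms(4) unfolding walks_def by blast+
  moreover have "fst c = L n (xs ! i) (xs ! Suc i)" using i by (simp add: edges_nth)
  ultimately have "length (fst c) = d" using assms(2) unfolding link_function_def by auto
  then show "valid_index p c" using assms(1,3) c(2) by (auto simp: valid_index_def index_def)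
qed

lemma word_walks_subset: "word_walks L n w \<subseteq> walks n (length w)"
  by (auto simp: word_walks_def closed_walks_def)

context
  fixes d L C p t rs
  assumes d: "d \<in> {1, 2}" and link: "link_function d L" and C: "fibre_bound L C"
    and t: "increasing_times p t" and rs: "set rs \<subseteq> {1..p}"
begin

lemma walk_moment_compatible:
  assumes "paired w" "compatible w rs" "xs \<in> word_walks L n w"
  shows "walk_moment L t rs n xs = prod_list (map (\<lambda>r. sqrt (card (block t n r))) rs)"
proof -
  let ?cs = "zip (edges (L n) xs) rs"
  have k: "same_kernel w (edges (L n) xs)" using assms(3) by (simp add: word_walks_def)
  have l: "length w = length rs" "length (edges (L n) xs) = length rs"
    using assms(2) k by (auto simp: compatible_def same_kernel_def)
  have "same_kernel w ?cs"
    using k assms(2) by (rule same_kernel_zip)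
  then obtain g where g: "inj_on g (set w)" "?cs = map g w" by (auto simp: same_kernel_iff_map)
  have "paired ?cs"
    using assms(1) same_kernel_count_list[OF g(1)] unfolding g(2) paired_def by auto
  moreover have "xs \<in> walks n (length w)" using assms(3) word_walks_subset by blast
  ultimately show ?thesis
    unfolding walk_moment_def
    using increment_product_paired[OF t valid_index_edges[OF d link rs]] l(2) map_snd_zip by metis
qed

text \<open>The factor at position \<open>i\<close> is repeated nowhere, so by independence its mean
  0 splits off. This covers both letters that occur once and pairs with unequal intervals.\<close>

lemma walk_moment_zero:
  assumes "xs \<in> word_walks L n w" "length w = length rs" "i < length w"
    and uniq: "\<And>k. k < length w \<Longrightarrow> w ! k = w ! i \<Longrightarrow> rs ! k = rs ! i \<Longrightarrow> k = i"
  shows "walk_moment L t rs n xs = 0"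
proof -
  let ?es = "edges (L n) xs"
  have k: "same_kernel w ?es" using assms(1) by (simp add: word_walks_def)
  have l: "length ?es = length rs" using k assms(2) by (metis same_kernel_length)
  have "{k. k < length (zip ?es rs) \<and> zip ?es rs ! k = (?es ! i, rs ! i)} = {i}"
  proof (intro equalityI subsetI)
    fix j assume "j \<in> {k. k < length (zip ?es rs) \<and> zip ?es rs ! k = (?es ! i, rs ! i)}"
    then have "j < length ?es" "j < length rs" "zip ?es rs ! j = (?es ! i, rs ! i)" using l by simp_all
    then have j: "j < length w" "?es ! j = ?es ! i" "rs ! j = rs ! i" using nth_zip l assms(2) by simp_all
    then have "w ! j = w ! i" using k assms(3) unfolding same_kernel_def by blast
    then show "j \<in> {i}" using uniq j by blast
  next
    fix j assume "j \<in> {i}"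
    then show "j \<in> {k. k < length (zip ?es rs) \<and> zip ?es rs ! k = (?es ! i, rs ! i)}"
      using assms(2,3) l by simp
  qed
  then have "count_list (zip ?es rs) (?es ! i, rs ! i) = 1"
    unfolding count_list_eq_card by simp
  then show ?thesis unfolding walk_moment_def
    by (rule increment_product_singleton[OF t valid_index_edges[OF d link rs subsetD[OF word_walks_subset assms(1)]]])
qed

text \<open>If the two positions of a letter belong to different intervals, the factor at either of
  them is isolated, since there is no third position.\<close>

lemma walk_moment_incompatible:
  assumes "paired w" "\<not> compatible w rs" "length w = length rs" "xs \<in> word_walks L n w"
  shows "walk_moment L t rs n xs = 0"
proof -
  obtain i j where ij: "i < length w" "j < length w" "w ! i = w ! j" "rs ! i \<noteq> rs ! j"
    using assms(2,3) unfolding compatible_def by auto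
  have c: "card {k. k < length w \<and> w ! k = w ! i} = 2"
    using assms(1) ij(1) by (simp add: count_list_eq_card[symmetric] paired_def)
  show ?thesis
  proof (rule walk_moment_zero[OF assms(4,3) ij(1)])
    fix k assume k: "k < length w" "w ! k = w ! i" "rs ! k = rs ! i"
    show "k = i"
    proof (rule ccontr)
      assume "k \<noteq> i"
      moreover have "j \<noteq> i" "j \<noteq> k" using ij(4) k(3) by metis+
      ultimately have "card {i, j, k} = 3" by simp
      moreover have "{i, j, k} \<subseteq> {k. k < length w \<and> w ! k = w ! i}" using ij k by auto
      then have "card {i, j, k} \<le> 2" unfolding c[symmetric] by (intro card_mono) auto
      ultimately show False by simp
    qed
  qed
qed

lemma walk_moment_single:
  assumes "a \<in> set w" "count_list w a = 1" "length w = length rs" "xs \<in> word_walks L n w"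
  shows "walk_moment L t rs n xs = 0"
proof -
  obtain i where i: "i < length w" "w ! i = a" using assms(1) by (auto simp: in_set_conv_nth)
  have "card {k. k < length w \<and> w ! k = a} = 1" using assms(2) by (simp add: count_list_eq_card)
  then obtain j where j: "{k. k < length w \<and> w ! k = a} = {j}" by (auto simp: card_1_singleton_iff)
  show ?thesis
  proof (rule walk_moment_zero[OF assms(4,3) i(1)])
    fix k assume "k < length w" "w ! k = w ! i"
    then have "k \<in> {k. k < length w \<and> w ! k = a}" "i \<in> {k. k < length w \<and> w ! k = a}" using i by auto
    then show "k = i" unfolding j by simp
  qed
qed

text \<open>The contribution of \<open>w\<close> to the mean trace: one factor \<open>n\<close> for
  the normalised trace, and one for each matrix, whose entries are increments divided by
  \<open>n\<close>.\<close>

definition word_share :: "nat \<Rightarrow> nat list \<Rightarrow> real" where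
  "word_share n w = (\<Sum>xs\<in>word_walks L n w. walk_moment L t rs n xs) / (real n * real n ^ length rs)"

text \<open>For length \<open>2 * m\<close> the factor \<open>n ^ (2 * m)\<close> splits evenly:
  \<open>n ^ m\<close> goes with \<open>n\<close> into the density, the other \<open>n ^ m\<close>
  scales the \<open>m\<close> variances.\<close>

lemma word_share_compatible:
  assumes "paired w" "compatible w rs" "n > 0"
  shows "word_share n w = walk_density L w n * prod_list (map (\<lambda>r. sqrt (card (block t n r) / n)) rs)"
proof -
  have l: "length w = length rs" using assms(2) by (simp add: compatible_def)
  have m: "length rs = 2 * (length w div 2)" using paired_length[OF assms(1)] l by simp
  let ?q = "length w div 2"
  have "prod_list (map (\<lambda>r. sqrt (card (block t n r) / n)) us) * sqrt n ^ length us =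
      prod_list (map (\<lambda>r. sqrt (card (block t n r))) us)" for us
    using assms(3) by (induction us) (auto simp: real_sqrt_divide)
  from this[of rs] have "prod_list (map (\<lambda>r. sqrt (card (block t n r))) rs) =
      prod_list (map (\<lambda>r. sqrt (card (block t n r) / n)) rs) * sqrt n ^ (2 * ?q)" using m by simp
  also have "sqrt n ^ (2 * ?q) = real n ^ ?q" by (simp add: power_mult)
  finally have e: "prod_list (map (\<lambda>r. sqrt (card (block t n r))) rs) =
      prod_list (map (\<lambda>r. sqrt (card (block t n r) / n)) rs) * real n ^ ?q" .
  have "real n ^ length rs = real n ^ ?q * real n ^ ?q"
    by (subst m) (simp add: power_add[symmetric] mult_2)
  then show ?thesis
    unfolding word_share_def walk_density_def using walk_moment_compatible[OF assms(1,2)] assms(3)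
    by (simp add: e)
qed

text \<open>Letters occur at least twice and some letter more often, so \<open>k\<close> letters
  satisfy \<open>2 * k + 1 \<le> l\<close>. Then \<open>O(n ^ (1 + k))\<close> walks with moments
  \<open>O(n ^ (l / 2))\<close>, divided by \<open>n ^ (1 + l)\<close>, leave
  \<open>O(n ^ (- 1 / 2))\<close>.\<close>

lemma word_share_negligible:
  assumes w: "length w = length rs" "\<not> paired w" "\<And>a. a \<in> set w \<Longrightarrow> count_list w a \<noteq> 1"
  shows "(\<lambda>n. word_share n w) \<longlonglongrightarrow> 0"
proof -
  let ?l = "length rs" and ?k = "card (set w)"
  have ge2: "2 \<le> count_list w a" if "a \<in> set w" for a
  proof -
    have "count_list w a \<noteq> 0" using that by (metis count_list_0_iff)
    then show ?thesis using w(3)[OF that] by linarith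
  qed
  have "2 * ?k < length w"
  proof -
    obtain b where b: "b \<in> set w" "count_list w b \<noteq> 2" using w(2) unfolding paired_def by blast
    have "(\<Sum>a\<in>set w. 2) < (\<Sum>a\<in>set w. count_list w a)"
      using b ge2 by (intro sum_strict_mono_ex1) (auto intro!: bexI[of _ b] simp: le_less)
    then show ?thesis using sum_count_set[of w "set w"] by simp
  qed
  then have kl: "2 * ?k + 1 \<le> ?l" using w(1) by simp
  obtain K where K: "K \<ge> 0" "\<And>n cs. n > 0 \<Longrightarrow> length cs = ?l \<Longrightarrow> (\<forall>c\<in>set cs. valid_index p c) \<Longrightarrow>
     \<bar>expectation (\<lambda>\<omega>. prod_list (map (\<lambda>c. increment t n c \<omega>) cs))\<bar> \<le> K * sqrt (real n) ^ ?l"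
    using increment_product_bound[OF t] by blast
  have bound: "\<bar>word_share n w\<bar> \<le> (K * real C ^ ?l) / sqrt (real n)" if n: "n > 0" for n
  proof -
    have "\<bar>walk_moment L t rs n xs\<bar> \<le> K * sqrt (real n) ^ ?l" if "xs \<in> word_walks L n w" for xs
      unfolding walk_moment_def using that w(1)
      by (intro K(2)[OF n] valid_index_edges[OF d link rs])
        (auto simp: word_walks_def closed_walks_def walks_def)
    then have "\<bar>\<Sum>xs\<in>word_walks L n w. walk_moment L t rs n xs\<bar>
        \<le> real (card (word_walks L n w)) * (K * sqrt (real n) ^ ?l)"
      by (intro order_trans[OF sum_abs] sum_bounded_above)
    also have "\<dots> \<le> real (n * n ^ ?k * C ^ ?l) * (K * sqrt (real n) ^ ?l)"
      using card_word_walks_le[OF C, of n w] K(1) w(1) by (intro mult_right_mono of_nat_mono) auto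
    finally have *: "\<bar>\<Sum>xs\<in>word_walks L n w. walk_moment L t rs n xs\<bar>
        \<le> real (n * n ^ ?k * C ^ ?l) * (K * sqrt (real n) ^ ?l)" .
    have "\<bar>word_share n w\<bar> = \<bar>\<Sum>xs\<in>word_walks L n w. walk_moment L t rs n xs\<bar> / (real n * real n ^ ?l)"
      by (simp add: word_share_def abs_divide abs_mult)
    also have "\<dots> \<le> real (n * n ^ ?k * C ^ ?l) * (K * sqrt (real n) ^ ?l) / (real n * real n ^ ?l)"
      by (rule divide_right_mono[OF *]) simp
    also have "real n ^ ?l = sqrt (real n) ^ ?l * sqrt (real n) ^ ?l"
      by (simp add: power_mult_distrib[symmetric])
    also have "real (n * n ^ ?k * C ^ ?l) * (K * sqrt (real n) ^ ?l) / (real n * (sqrt (real n) ^ ?l * sqrt (real n) ^ ?l))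
        = (K * real C ^ ?l) * (real n ^ ?k / sqrt (real n) ^ ?l)"
      using n by (simp add: field_simps)
    also have "real n ^ ?k / sqrt (real n) ^ ?l \<le> 1 / sqrt (real n)"
    proof -
      have "real n ^ ?k * sqrt (real n) = sqrt (real n) ^ (2 * ?k + 1)" by (simp add: power_mult)
      also have "\<dots> \<le> sqrt (real n) ^ ?l" using n kl by (intro power_increasing) auto
      finally show ?thesis using n by (simp add: field_simps)
    qed
    finally show ?thesis using K(1) by (simp add: mult_left_mono)
  qed
  have "(\<lambda>n. (K * real C ^ ?l) / sqrt (real n)) \<longlonglongrightarrow> 0"
    by (intro tendsto_divide_0[OF tendsto_const] filterlim_at_top_imp_at_infinity
        filterlim_compose[OF sqrt_at_top] filterlim_real_sequentially)
  then show ?thesis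
    by (rule Lim_null_comparison[rotated])
      (use bound in \<open>auto simp: eventually_at_top_linorder intro!: exI[of _ 1]\<close>)
qed

lemma sqrt_weight_limit:
  "set us \<subseteq> {1..p} \<Longrightarrow> (\<lambda>n. prod_list (map (\<lambda>r. sqrt (card (block t n r) / n)) us))
     \<longlonglongrightarrow> prod_list (map (\<lambda>r. sqrt (t r - t (r - 1))) us)"
proof (induction us)
  case (Cons r us)
  have "(\<lambda>n. sqrt (card (block t n r) / n)) \<longlonglongrightarrow> sqrt (t r - t (r - 1))"
    using Cons.prems by (intro tendsto_real_sqrt card_block_limit[OF t]) auto
  then show ?case using Cons by (simp add: tendsto_mult)
qed simp

lemma word_share_limit:
  assumes "w \<in> words (length rs)" and "paired w \<Longrightarrow> compatible w rs \<Longrightarrow> convergent (walk_density L w)"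
  shows "(\<lambda>n. word_share n w) \<longlonglongrightarrow>
     (if paired w \<and> compatible w rs then lim (walk_density L w) * weight t rs else 0)"
proof -
  have l: "length w = length rs" using assms(1) by (simp add: words_def)
  consider "paired w" "compatible w rs" | "paired w" "\<not> compatible w rs"
    | a where "a \<in> set w" "count_list w a = 1"
    | "\<not> paired w" "\<And>a. a \<in> set w \<Longrightarrow> count_list w a \<noteq> 1" by blast
  then show ?thesis
  proof cases
    case 1
    have "(\<lambda>n. walk_density L w n * prod_list (map (\<lambda>r. sqrt (card (block t n r) / n)) rs))
        \<longlonglongrightarrow> lim (walk_density L w) * weight t rs"
      unfolding weight_def using assms(2)[OF 1]
      by (intro tendsto_mult sqrt_weight_limit rs) (simp add: convergent_LIMSEQ_iff)
    moreover have "\<forall>\<^sub>F n in sequentially.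
        walk_density L w n * prod_list (map (\<lambda>r. sqrt (card (block t n r) / n)) rs) = word_share n w"
      using eventually_gt_at_top[of 0] by eventually_elim (simp add: word_share_compatible[OF 1])
    ultimately have "(\<lambda>n. word_share n w) \<longlonglongrightarrow> lim (walk_density L w) * weight t rs"
      by (rule Lim_transform_eventually)
    then show ?thesis using 1 by simp
  next
    case 2
    then have "word_share n w = 0" for n
      unfolding word_share_def using walk_moment_incompatible[OF 2 l] by simp
    then show ?thesis using 2 by simp
  next
    case 3
    then have "word_share n w = 0" for n
      unfolding word_share_def using walk_moment_single[OF 3 l] by simp
    moreover have "\<not> paired w" unfolding paired_def using 3 by (metis numeral_eq_one_iff semiring_norm(85))
    ultimately show ?thesis by simp
  next
    case 4
    then show ?thesis using word_share_negligible[OF l 4] by simp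
  qed
qed

theorem walk_moment_limit:
  assumes "\<And>v. v \<in> indexed_pair_words rs \<Longrightarrow> convergent (walk_density L (drop_indices v))"
  shows "(\<lambda>n. (\<Sum>xs\<in>closed_walks n (length rs). walk_moment L t rs n xs) / (real n * real n ^ length rs))
     \<longlonglongrightarrow> weight t rs * (\<Sum>v\<in>indexed_pair_words rs. lim (walk_density L (drop_indices v)))"
proof -
  let ?W = "{w \<in> words (length rs). paired w \<and> compatible w rs}"
  note bij = bij_betw_indexed_pair_words[of rs]
  have conv: "convergent (walk_density L w)" if "w \<in> ?W" for w
    using assms that bij unfolding bij_betw_def by (metis (no_types, lifting) imageE)
  have "(\<lambda>n. \<Sum>w\<in>words (length rs). word_share n w) \<longlonglongrightarrow>
      (\<Sum>w\<in>words (length rs). if paired w \<and> compatible w rs then lim (walk_density L w) * weight t rs else 0)"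
    using conv by (intro tendsto_sum word_share_limit) auto
  also have "(\<lambda>n. \<Sum>w\<in>words (length rs). word_share n w) =
      (\<lambda>n. (\<Sum>xs\<in>closed_walks n (length rs). walk_moment L t rs n xs) / (real n * real n ^ length rs))"
    unfolding word_share_def sum_divide_distrib[symmetric] sum_closed_walks_by_word[where L = L] ..
  also have "(\<Sum>w\<in>words (length rs). if paired w \<and> compatible w rs then lim (walk_density L w) * weight t rs else 0)
      = (\<Sum>w\<in>?W. lim (walk_density L w) * weight t rs)"
    by (intro sum.mono_neutral_cong_right) auto
  also have "\<dots> = (\<Sum>v\<in>indexed_pair_words rs. lim (walk_density L (drop_indices v)) * weight t rs)"
    by (rule sum.reindex_bij_betw[OF bij, symmetric])
  finally show ?thesis by (simp add: sum_distrib_left sum_distrib_right mult.commute)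
qed

end

end

section \<open>Words in matrices and non-commutative polynomials\<close>

text \<open>Products of matrices as plain functions on indices from 1 to \<open>n\<close>, matching
  the vertices of walks. The general semiring serves real increments and complex entries
  alike.\<close>

fun mat_word :: "nat \<Rightarrow> ('v \<Rightarrow> nat \<Rightarrow> nat \<Rightarrow> 'c::comm_semiring_1) \<Rightarrow> 'v list \<Rightarrow> nat \<Rightarrow> nat \<Rightarrow> 'c" where
  "mat_word n a [] i j = of_bool (i = j)"
| "mat_word n a (x # u) i j = (\<Sum>k\<in>{1..n}. a x i k * mat_word n a u k j)"

lemma mat_word_append:
  "i \<in> {1..n} \<Longrightarrow> mat_word n a (u @ v) i j = (\<Sum>k\<in>{1..n}. mat_word n a u i k * mat_word n a v k j)"
proof (induction u arbitrary: i)
  case Nil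
  have "(\<Sum>k\<in>{1..n}. of_bool (i = k) * mat_word n a v k j) = (\<Sum>k\<in>{1..n}. if i = k then mat_word n a v k j else 0)"
    by (intro sum.cong) auto
  then show ?case using Nil by simp
next
  case (Cons x u)
  have "mat_word n a ((x # u) @ v) i j =
      (\<Sum>k\<in>{1..n}. a x i k * (\<Sum>l\<in>{1..n}. mat_word n a u k l * mat_word n a v l j))"
    using Cons.IH by simp
  also have "\<dots> = (\<Sum>l\<in>{1..n}. \<Sum>k\<in>{1..n}. a x i k * (mat_word n a u k l * mat_word n a v l j))"
    unfolding sum_distrib_left by (rule sum.swap)
  finally show ?case by (simp add: sum_distrib_right mult.assoc)
qed

lemma mat_word_cong:
  assumes "\<And>x i j. x \<in> set u \<Longrightarrow> i \<in> {1..n} \<Longrightarrow> j \<in> {1..n} \<Longrightarrow> a x i j = b x i j"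
    and "i \<in> {1..n}" "j \<in> {1..n}"
  shows "mat_word n a u i j = mat_word n b u i j"
  using assms by (induction u arbitrary: i) (auto intro!: sum.cong)

text \<open>Reversing a word of symmetric matrices transposes the product; this is what makes the
  formal star agree with the adjoint.\<close>

lemma mat_word_transpose:
  fixes a :: "'v \<Rightarrow> nat \<Rightarrow> nat \<Rightarrow> 'c::comm_semiring_1"
  assumes "\<And>x i j. x \<in> set u \<Longrightarrow> i \<in> {1..n} \<Longrightarrow> j \<in> {1..n} \<Longrightarrow> a x i j = a x j i"
    and "i \<in> {1..n}" "j \<in> {1..n}"
  shows "mat_word n a (rev u) i j = mat_word n a u j i"
  using assms
proof (induction u arbitrary: i j)
  case (Cons x u)
  have e: "mat_word n a [x] k j = a x k j" if "k \<in> {1..n}" for k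
  proof -
    have "mat_word n a [x] k j = (\<Sum>l\<in>{1..n}. if l = j then a x k l else 0)"
      by (auto intro!: sum.cong)
    then show ?thesis using Cons.prems(3) by simp
  qed
  have "mat_word n a (rev (x # u)) i j = (\<Sum>k\<in>{1..n}. mat_word n a (rev u) i k * mat_word n a [x] k j)"
    using Cons.prems(2) by (simp only: rev.simps mat_word_append)
  also have "\<dots> = (\<Sum>k\<in>{1..n}. mat_word n a u k i * a x j k)"
  proof (intro sum.cong refl)
    fix k assume k: "k \<in> {1..n}"
    have "mat_word n a (rev u) i k = mat_word n a u k i"
      using Cons.prems k by (intro Cons.IH) auto
    moreover have "a x k j = a x j k" using Cons.prems k by auto
    ultimately show "mat_word n a (rev u) i k * mat_word n a [x] k j = mat_word n a u k i * a x j k"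
      using e[OF k] by simp
  qed
  finally show ?case by (simp add: mult.commute)
qed auto

lemma mat_word_of_real:
  "mat_word n (\<lambda>x i j. of_real (a x i j) :: complex) u i j = of_real (mat_word n a u i j)"
  by (induction u arbitrary: i) auto

lemma mat_word_scale:
  "mat_word n (\<lambda>x i j. c * a x i j) u i j = c ^ length u * mat_word n a u i j"
  by (induction u arbitrary: i) (auto simp: sum_distrib_left mult_ac)

lemma mat_word_paths:
  assumes "i \<in> {1..n}" "j \<in> {1..n}"
  shows "mat_word n (\<lambda>x i j. g (L i j, x)) u i j =
     (\<Sum>xs\<in>{xs \<in> walks n (length u). hd xs = i \<and> last xs = j}. prod_list (map g (zip (edges L xs) u)))"
  using assms
proof (induction u arbitrary: i)
  case Nil
  have "{xs \<in> walks n (length ([]::'b list)). hd xs = i \<and> last xs = j} = (if i = j then {[i]} else {})"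
    using Nil by (auto simp: walks_def length_Suc_conv)
  then show ?case by simp
next
  case (Cons x u)
  let ?h = "\<lambda>ys. g (L i (hd ys), x) * prod_list (map g (zip (edges L ys) u))"
  let ?S = "{ys \<in> walks n (length u). last ys = j}"
  have "mat_word n (\<lambda>x i j. g (L i j, x)) (x # u) i j =
      (\<Sum>k\<in>{1..n}. \<Sum>ys\<in>{ys \<in> ?S. hd ys = k}. ?h ys)"
    using Cons by (auto intro!: sum.cong simp: sum_distrib_left)
  also have "\<dots> = (\<Sum>ys\<in>?S. ?h ys)"
  proof (rule sum.group)
    show "hd ` ?S \<subseteq> {1..n}"
    proof
      fix k assume "k \<in> hd ` ?S"
      then obtain ys where "ys \<in> walks n (length u)" "k = hd ys" by blast
      then show "k \<in> {1..n}" by (cases ys) (auto simp: walks_def)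
    qed
  qed auto
  also have "\<dots> = (\<Sum>xs\<in>(#) i ` ?S. prod_list (map g (zip (edges L xs) (x # u))))"
  proof -
    have "?h ys = prod_list (map g (zip (edges L (i # ys)) (x # u)))" if "ys \<in> ?S" for ys
      using that by (cases ys) (auto simp: walks_def)
    then show ?thesis by (subst sum.reindex) auto
  qed
  also have "(#) i ` ?S = {xs \<in> walks n (length (x # u)). hd xs = i \<and> last xs = j}"
  proof
    show "(#) i ` ?S \<subseteq> {xs \<in> walks n (length (x # u)). hd xs = i \<and> last xs = j}"
      using Cons.prems by (auto simp: walks_def)
    show "{xs \<in> walks n (length (x # u)). hd xs = i \<and> last xs = j} \<subseteq> (#) i ` ?S"
    proof
      fix xs assume xs: "xs \<in> {xs \<in> walks n (length (x # u)). hd xs = i \<and> last xs = j}"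
      then obtain ys where e: "xs = i # ys" by (cases xs) (auto simp: walks_def)
      have "ys \<noteq> []" using xs unfolding e by (auto simp: walks_def)
      with e show "xs \<in> (#) i ` ?S" using xs by (auto simp: walks_def)
    qed
  qed
  finally show ?case .
qed

lemma mat_word_trace:
  "(\<Sum>i\<in>{1..n}. mat_word n (\<lambda>x i j. g (L i j, x)) u i i) =
     (\<Sum>xs\<in>closed_walks n (length u). prod_list (map g (zip (edges L xs) u)))"
proof -
  let ?h = "\<lambda>xs. prod_list (map g (zip (edges L xs) u))"
  have "(\<Sum>i\<in>{1..n}. mat_word n (\<lambda>x i j. g (L i j, x)) u i i) =
      (\<Sum>i\<in>{1..n}. \<Sum>xs\<in>{xs \<in> closed_walks n (length u). hd xs = i}. ?h xs)"
    by (intro sum.cong refl) (subst mat_word_paths; (auto simp: closed_walks_def intro!: sum.cong)?)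
  also have "\<dots> = (\<Sum>xs\<in>closed_walks n (length u). ?h xs)"
  proof (rule sum.group)
    show "hd ` closed_walks n (length u) \<subseteq> {1..n}"
    proof
      fix k assume "k \<in> hd ` closed_walks n (length u)"
      then obtain ys where "ys \<in> walks n (length u)" "k = hd ys" by (auto simp: closed_walks_def)
      then show "k \<in> {1..n}" by (cases ys) (auto simp: walks_def)
    qed
  qed auto
  finally show ?thesis .
qed

lemma sum_set_Cons:
  "(\<Sum>zs\<in>set_Cons A B. f zs) = (\<Sum>x\<in>A. \<Sum>xs\<in>B. f (x # xs))"
proof -
  have "set_Cons A B = (\<lambda>(x, xs). x # xs) ` (A \<times> B)" by (auto simp: set_Cons_def)
  then show ?thesis
    by (simp add: sum.reindex inj_on_def sum.cartesian_product case_prod_unfold)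
qed

text \<open>Multilinear expansion: an element of \<open>listset (map R u)\<close> selects one
  summand for each factor. It is applied to telescoping sums over time intervals.\<close>

lemma mat_word_sum:
  "mat_word n (\<lambda>x i j. \<Sum>r\<in>R x. b r i j) u i j = (\<Sum>rs\<in>listset (map R u). mat_word n b rs i j)"
proof (induction u arbitrary: i)
  case (Cons x u)
  have "mat_word n (\<lambda>x i j. \<Sum>r\<in>R x. b r i j) (x # u) i j =
      (\<Sum>k\<in>{1..n}. \<Sum>r\<in>R x. \<Sum>rs\<in>listset (map R u). b r i k * mat_word n b rs k j)"
    by (simp add: Cons.IH sum_product)
  also have "\<dots> = (\<Sum>r\<in>R x. \<Sum>rs\<in>listset (map R u). \<Sum>k\<in>{1..n}. b r i k * mat_word n b rs k j)"
    by (subst sum.swap, intro sum.cong refl, rule sum.swap)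
  finally show ?case by (simp add: sum_set_Cons)
qed simp

section \<open>Linear functionals on non-commutative polynomials, given by their values on
  words\<close>

definition linear_ext :: "('v list \<Rightarrow> complex) \<Rightarrow> 'v ncpoly \<Rightarrow> complex" where
  "linear_ext \<phi> h = (\<Sum>w\<in>Poly_Mapping.keys h. Poly_Mapping.lookup h w * \<phi> (letters w))"

lemma linear_ext_superset:
  assumes "finite S" "Poly_Mapping.keys h \<subseteq> S"
  shows "linear_ext \<phi> h = (\<Sum>w\<in>S. Poly_Mapping.lookup h w * \<phi> (letters w))"
  unfolding linear_ext_def using assms by (intro sum.mono_neutral_left) (auto simp: in_keys_iff)

lemma linear_ext_add: "linear_ext \<phi> (g + h) = linear_ext \<phi> g + linear_ext \<phi> h"
proof -
  let ?S = "Poly_Mapping.keys g \<union> Poly_Mapping.keys h"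
  have "Poly_Mapping.keys (g + h) \<subseteq> ?S" by (rule Poly_Mapping.keys_add)
  then show ?thesis
    by (simp add: linear_ext_superset[of ?S] lookup_add distrib_right sum.distrib)
qed

lemma linear_ext_zero [simp]: "linear_ext \<phi> 0 = 0"
  by (simp add: linear_ext_def)

lemma linear_ext_sum: "linear_ext \<phi> (\<Sum>x\<in>A. f x) = (\<Sum>x\<in>A. linear_ext \<phi> (f x))"
  by (induction A rule: infinite_finite_induct) (auto simp: linear_ext_add)

lemma linear_ext_single: "linear_ext \<phi> (Poly_Mapping.single w c) = c * \<phi> (letters w)"
  by (cases "c = 0") (auto simp: linear_ext_def)

lemma poly_mapping_expand:
  "h = (\<Sum>w\<in>Poly_Mapping.keys h. Poly_Mapping.single w (Poly_Mapping.lookup h w))"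
proof (rule poly_mapping_eqI)
  fix k
  have "Poly_Mapping.lookup (\<Sum>w\<in>Poly_Mapping.keys h. Poly_Mapping.single w (Poly_Mapping.lookup h w)) k
      = (\<Sum>w\<in>Poly_Mapping.keys h. if w = k then Poly_Mapping.lookup h k else 0)"
    unfolding lookup_sum by (intro sum.cong refl) (auto simp: lookup_single when_def)
  then show "Poly_Mapping.lookup h k =
      Poly_Mapping.lookup (\<Sum>w\<in>Poly_Mapping.keys h. Poly_Mapping.single w (Poly_Mapping.lookup h w)) k"
    by (auto simp: in_keys_iff)
qed

lemma ncpoly_mult_expand:
  fixes g h :: "'v ncpoly"
  shows "g * h = (\<Sum>u\<in>Poly_Mapping.keys g. \<Sum>v\<in>Poly_Mapping.keys h.
     Poly_Mapping.single (u + v) (Poly_Mapping.lookup g u * Poly_Mapping.lookup h v))"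
  by (subst poly_mapping_expand[of g], subst poly_mapping_expand[of h]) (simp add: sum_product mult_single)

lemma letters_plus [simp]: "letters (u + v) = letters u @ letters v"
  by (simp add: plus_ncmono_def)

lemma letters_zero [simp]: "letters 0 = []"
  by (simp add: zero_ncmono_def)

lemma linear_ext_mult:
  "linear_ext \<phi> (g * h) = (\<Sum>u\<in>Poly_Mapping.keys g. \<Sum>v\<in>Poly_Mapping.keys h.
     Poly_Mapping.lookup g u * Poly_Mapping.lookup h v * \<phi> (letters u @ letters v))"
  unfolding ncpoly_mult_expand linear_ext_sum by (simp add: linear_ext_single)

lemma linear_ext_smult: "linear_ext \<phi> (Poly_Mapping.single 0 c * h) = c * linear_ext \<phi> h"
proof (cases "c = 0")
  case False
  then show ?thesis unfolding linear_ext_mult by (simp add: linear_ext_def sum_distrib_left mult.assoc)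
qed simp

lemma linear_ext_uminus: "linear_ext \<phi> (- h) = - linear_ext \<phi> h"
  using linear_ext_add[of \<phi> h "- h"] by (simp add: eq_neg_iff_add_eq_0 add.commute)

lemma linear_ext_one: "linear_ext \<phi> 1 = \<phi> []"
  using linear_ext_single[of \<phi> 0 1] by simp

lemma linear_ext_tendsto:
  assumes "h \<in> ncpolys T" "\<And>u. set u \<subseteq> T \<Longrightarrow> (\<lambda>n. \<phi> n u) \<longlonglongrightarrow> \<psi> u"
  shows "(\<lambda>n. linear_ext (\<phi> n) h) \<longlonglongrightarrow> linear_ext \<psi> h"
  unfolding linear_ext_def using assms by (intro tendsto_intros) (auto simp: ncpolys_def)

definition mat_poly :: "nat \<Rightarrow> ('v \<Rightarrow> nat \<Rightarrow> nat \<Rightarrow> complex) \<Rightarrow> 'v ncpoly \<Rightarrow> nat \<Rightarrow> nat \<Rightarrow> complex" where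
  "mat_poly n a h i j = linear_ext (\<lambda>u. mat_word n a u i j) h"

lemma mat_poly_mult:
  assumes "i \<in> {1..n}"
  shows "mat_poly n a (g * h) i j = (\<Sum>k\<in>{1..n}. mat_poly n a g i k * mat_poly n a h k j)"
proof -
  have "mat_poly n a (g * h) i j = (\<Sum>u\<in>Poly_Mapping.keys g. \<Sum>v\<in>Poly_Mapping.keys h. \<Sum>k\<in>{1..n}.
      (Poly_Mapping.lookup g u * mat_word n a (letters u) i k) * (Poly_Mapping.lookup h v * mat_word n a (letters v) k j))"
    unfolding mat_poly_def linear_ext_mult mat_word_append[OF assms]
    by (simp add: sum_distrib_left mult_ac)
  also have "\<dots> = (\<Sum>k\<in>{1..n}. \<Sum>u\<in>Poly_Mapping.keys g. \<Sum>v\<in>Poly_Mapping.keys h.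
      (Poly_Mapping.lookup g u * mat_word n a (letters u) i k) * (Poly_Mapping.lookup h v * mat_word n a (letters v) k j))"
    by (subst (2) sum.swap, subst sum.swap) rule
  finally show ?thesis by (simp add: mat_poly_def linear_ext_def sum_product)
qed

lemma mat_poly_prod_list:
  assumes "i \<in> {1..n}"
  shows "mat_poly n a (prod_list (map f rs)) i j = mat_word n (\<lambda>r. mat_poly n a (f r)) rs i j"
  using assms
proof (induction rs arbitrary: i)
  case Nil
  then show ?case by (simp add: mat_poly_def linear_ext_one)
next
  case (Cons r rs)
  then show ?case by (simp add: mat_poly_mult)
qed

section \<open>The star algebra of non-commutative polynomials\<close>

lemma free_star_alg_sel [simp]:
  "carrier (free_star_alg T) = ncpolys T" "mult (free_star_alg T) = (*)" "one (free_star_alg T) = 1"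
  "zero (free_star_alg T) = 0" "add (free_star_alg T) = (+)"
  "smult (free_star_alg T) c h = Poly_Mapping.single 0 c * h" "star (free_star_alg T) = ncstar"
  by (simp_all add: free_star_alg_def)

lemma ncpolys_zero [simp]: "0 \<in> ncpolys T"
  by (simp add: ncpolys_def)

lemma ncpolys_single: "set (letters w) \<subseteq> T \<Longrightarrow> Poly_Mapping.single w c \<in> ncpolys T"
  by (auto simp: ncpolys_def split: if_splits)

lemma ncpolys_one [simp]: "1 \<in> ncpolys T"
  using ncpolys_single[of 0 T 1] by simp

lemma ncpolys_add: "g \<in> ncpolys T \<Longrightarrow> h \<in> ncpolys T \<Longrightarrow> g + h \<in> ncpolys T"
  using Poly_Mapping.keys_add[of g h] unfolding ncpolys_def by blast

lemma ncpolys_uminus: "h \<in> ncpolys T \<Longrightarrow> - h \<in> ncpolys T"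
  by (auto simp: ncpolys_def in_keys_iff)

lemma ncpolys_diff: "g \<in> ncpolys T \<Longrightarrow> h \<in> ncpolys T \<Longrightarrow> g - h \<in> ncpolys T"
  using ncpolys_add[OF _ ncpolys_uminus, of g T h] by simp

lemma ncpolys_mult:
  assumes "g \<in> ncpolys T" "h \<in> ncpolys T"
  shows "g * h \<in> ncpolys T"
  unfolding ncpolys_def
proof (intro CollectI ballI)
  fix w assume "w \<in> Poly_Mapping.keys (g * h)"
  then obtain u v where "u \<in> Poly_Mapping.keys g" "v \<in> Poly_Mapping.keys h" "w = u + v"
    using Poly_Mapping.keys_mult[of g h] by blast
  then show "set (letters w) \<subseteq> T" using assms unfolding ncpolys_def by auto
qed

lemma ncpolys_smult: "h \<in> ncpolys T \<Longrightarrow> Poly_Mapping.single 0 c * h \<in> ncpolys T"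
  by (intro ncpolys_mult ncpolys_single) auto

lemma ncpolys_sum: "(\<And>x. x \<in> A \<Longrightarrow> f x \<in> ncpolys T) \<Longrightarrow> (\<Sum>x\<in>A. f x) \<in> ncpolys T"
  by (induction A rule: infinite_finite_induct) (auto intro: ncpolys_add)

lemma ncpolys_ncvar: "v \<in> T \<Longrightarrow> ncvar v \<in> ncpolys T"
  by (simp add: ncvar_def ncpolys_single)

lemma lookup_ncstar:
  "Poly_Mapping.lookup (ncstar h) w = cnj (Poly_Mapping.lookup h (NCMono (rev (letters w))))"
proof -
  have "Poly_Mapping.lookup (ncstar h) w = (\<Sum>u\<in>Poly_Mapping.keys h.
      if u = NCMono (rev (letters w)) then cnj (Poly_Mapping.lookup h u) else 0)"
    unfolding ncstar_def lookup_sum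
  proof (intro sum.cong refl)
    fix u
    have "NCMono (rev (letters u)) = w \<longleftrightarrow> u = NCMono (rev (letters w))"
      by (cases u; cases w) auto
    then show "Poly_Mapping.lookup (Poly_Mapping.single (NCMono (rev (letters u))) (cnj (Poly_Mapping.lookup h u))) w
        = (if u = NCMono (rev (letters w)) then cnj (Poly_Mapping.lookup h u) else 0)"
      by (auto simp: lookup_single when_def)
  qed
  also have "\<dots> = cnj (Poly_Mapping.lookup h (NCMono (rev (letters w))))"
    by (auto simp: in_keys_iff)
  finally show ?thesis .
qed

lemma ncstar_add: "ncstar (g + h) = ncstar g + ncstar h"
  by (rule poly_mapping_eqI) (simp add: lookup_ncstar lookup_add)

lemma ncstar_zero [simp]: "ncstar 0 = 0"
  by (rule poly_mapping_eqI) (simp add: lookup_ncstar)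

lemma ncstar_sum: "ncstar (\<Sum>x\<in>A. f x) = (\<Sum>x\<in>A. ncstar (f x))"
  by (induction A rule: infinite_finite_induct) (auto simp: ncstar_add)

lemma ncstar_single: "ncstar (Poly_Mapping.single w c) = Poly_Mapping.single (NCMono (rev (letters w))) (cnj c)"
  by (cases "c = 0") (auto simp: ncstar_def)

lemma ncstar_ncstar: "ncstar (ncstar h) = h"
proof (rule poly_mapping_eqI)
  fix w show "Poly_Mapping.lookup (ncstar (ncstar h)) w = Poly_Mapping.lookup h w"
    by (cases w) (simp add: lookup_ncstar)
qed

lemma ncstar_mult: "ncstar (g * h) = ncstar h * ncstar g"
proof -
  let ?s = "\<lambda>h w. Poly_Mapping.single (NCMono (rev (letters w))) (cnj (Poly_Mapping.lookup h w))"
  have "ncstar (g * h) = (\<Sum>u\<in>Poly_Mapping.keys g. \<Sum>v\<in>Poly_Mapping.keys h. ?s h v * ?s g u)"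
    unfolding ncpoly_mult_expand[of g h] ncstar_sum ncstar_single mult_single
    by (intro sum.cong refl) (auto simp: plus_ncmono_def mult.commute)
  also have "\<dots> = (\<Sum>v\<in>Poly_Mapping.keys h. \<Sum>u\<in>Poly_Mapping.keys g. ?s h v * ?s g u)"
    by (rule sum.swap)
  also have "\<dots> = ncstar h * ncstar g"
    unfolding ncstar_def by (simp add: sum_product)
  finally show ?thesis .
qed

lemma ncpolys_ncstar:
  assumes "h \<in> ncpolys T"
  shows "ncstar h \<in> ncpolys T"
  unfolding ncpolys_def
proof (intro CollectI ballI)
  fix w assume "w \<in> Poly_Mapping.keys (ncstar h)"
  then have "NCMono (rev (letters w)) \<in> Poly_Mapping.keys h" by (simp add: in_keys_iff lookup_ncstar)
  then have "set (letters (NCMono (rev (letters w)))) \<subseteq> T" using assms unfolding ncpolys_def by blast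
  then show "set (letters w) \<subseteq> T" by simp
qed

lemma ncstar_ncvar: "ncstar (ncvar v) = ncvar v"
  by (simp add: ncvar_def ncstar_single)

lemma abelian_group_free_star_alg: "abelian_group (free_star_alg T)"
proof (rule abelian_groupI)
  fix x assume "x \<in> carrier (free_star_alg T)"
  then show "\<exists>y\<in>carrier (free_star_alg T). y \<oplus>\<^bsub>free_star_alg T\<^esub> x = \<zero>\<^bsub>free_star_alg T\<^esub>"
    by (intro bexI[of _ "- x"]) (auto simp: ncpolys_uminus)
qed (simp_all add: ncpolys_add add.assoc add.commute)

lemma star_algebra_free_star_alg: "star_algebra (free_star_alg T)"
proof -
  have "monoid (free_star_alg T)"
    by (rule monoidI) (simp_all add: ncpolys_mult mult.assoc)
  then have "ring (free_star_alg T)"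
    by (intro ringI abelian_group_free_star_alg) (simp_all add: distrib_left distrib_right)
  moreover have "Module.module (class_ring :: complex ring) (free_star_alg T)"
  proof (rule moduleI)
    show "cring (class_ring :: complex ring)"
      using class_field by (rule domain.axioms(1)[OF field.axioms(1)])
    fix a b :: complex and x y assume "x \<in> carrier (free_star_alg T)" "y \<in> carrier (free_star_alg T)"
    show "(a \<oplus>\<^bsub>class_ring\<^esub> b) \<odot>\<^bsub>free_star_alg T\<^esub> x = a \<odot>\<^bsub>free_star_alg T\<^esub> x \<oplus>\<^bsub>free_star_alg T\<^esub> b \<odot>\<^bsub>free_star_alg T\<^esub> x"
      by (simp add: single_add distrib_right)
    show "a \<odot>\<^bsub>free_star_alg T\<^esub> (x \<oplus>\<^bsub>free_star_alg T\<^esub> y) = a \<odot>\<^bsub>free_star_alg T\<^esub> x \<oplus>\<^bsub>free_star_alg T\<^esub> a \<odot>\<^bsub>free_star_alg T\<^esub> y"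
      by (simp add: distrib_left)
    show "(a \<otimes>\<^bsub>class_ring\<^esub> b) \<odot>\<^bsub>free_star_alg T\<^esub> x = a \<odot>\<^bsub>free_star_alg T\<^esub> (b \<odot>\<^bsub>free_star_alg T\<^esub> x)"
      by (simp add: mult.assoc[symmetric] mult_single)
  qed (simp_all add: abelian_group_free_star_alg ncpolys_smult)
  moreover have "star_algebra_axioms (free_star_alg T)"
  proof
    fix c and x y :: "'a ncpoly"
    \<comment> \<open>Scalars sit at the empty word, the unit of the free monoid, and are therefore
      central.\<close>
    have "Poly_Mapping.single 0 c * x = x * Poly_Mapping.single 0 c"
      unfolding ncpoly_mult_expand[of x] by (subst poly_mapping_expand[of x]) (cases "c = 0"; simp add: sum_distrib_left mult_single mult.commute)
    then show "x \<otimes>\<^bsub>free_star_alg T\<^esub> (c \<odot>\<^bsub>free_star_alg T\<^esub> y) = c \<odot>\<^bsub>free_star_alg T\<^esub> (x \<otimes>\<^bsub>free_star_alg T\<^esub> y)"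
      by (simp add: mult.assoc[symmetric])
    show "star (free_star_alg T) (c \<odot>\<^bsub>free_star_alg T\<^esub> x) = cnj c \<odot>\<^bsub>free_star_alg T\<^esub> star (free_star_alg T) x"
      by (rule poly_mapping_eqI) (simp add: lookup_ncstar mult_map_scale_conv_mult[symmetric] Poly_Mapping.map.rep_eq when_def)
  qed (simp_all add: mult.assoc ncpolys_ncstar ncstar_ncstar ncstar_add ncstar_mult)
  ultimately show ?thesis unfolding star_algebra_def by blast
qed

lemma free_star_alg_minus:
  assumes "x \<in> ncpolys T" "y \<in> ncpolys T"
  shows "x \<ominus>\<^bsub>free_star_alg T\<^esub> y = x - y"
proof -
  interpret abelian_group "free_star_alg T" by (rule abelian_group_free_star_alg)
  have "\<ominus>\<^bsub>free_star_alg T\<^esub> y = - y"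
    using assms by (intro minus_equality) (auto simp: ncpolys_uminus)
  then show ?thesis by (simp add: minus_eq)
qed

lemma free_star_alg_pow: "x [^]\<^bsub>free_star_alg T\<^esub> (k :: nat) = x ^ k"
  by (induction k) (simp_all add: power_Suc2 del: power_Suc)

lemma alg_prod_free_star_alg: "alg_prod (free_star_alg T) xs = prod_list xs"
  by (simp add: alg_prod_def prod_list.eq_foldr)

lemma finsum_free_star_alg:
  assumes "finite S" "\<And>x. x \<in> S \<Longrightarrow> f x \<in> ncpolys T"
  shows "finsum (free_star_alg T) f S = sum f S"
proof -
  interpret abelian_group "free_star_alg T" by (rule abelian_group_free_star_alg)
  show ?thesis using assms
    by (induction S rule: finite_induct) (auto simp: Pi_def)
qed

lemma prod_list_ncvar: "prod_list (map ncvar u) = Poly_Mapping.single (NCMono u) 1"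
proof (induction u)
  case Nil
  then show ?case using single_one[where 'a = "'a ncmono" and 'b = complex] by (simp add: zero_ncmono_def)
next
  case (Cons x u)
  then show ?case by (simp add: ncvar_def mult_single plus_ncmono_def)
qed

text \<open>Substitution relabels letters. Different indices may stand for the same time, so words
  may merge; the result is therefore described through a linear functional and not by its
  coefficients.\<close>

lemma nc_eval_ncvar:
  assumes "h \<in> ncpolys S" "\<And>i. i \<in> S \<Longrightarrow> s i \<in> T"
  shows "linear_ext \<phi> (nc_eval (free_star_alg T) (\<lambda>i. ncvar (s i)) h) = linear_ext (\<lambda>u. \<phi> (map s u)) h"
    and "nc_eval (free_star_alg T) (\<lambda>i. ncvar (s i)) h \<in> ncpolys T"
proof -
  have m: "Poly_Mapping.single (NCMono (map s (letters w))) (Poly_Mapping.lookup h w) \<in> ncpolys T"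
    if "w \<in> Poly_Mapping.keys h" for w
  proof (rule ncpolys_single)
    have "set (letters w) \<subseteq> S" using assms(1) that unfolding ncpolys_def by blast
    then show "set (letters (NCMono (map s (letters w)))) \<subseteq> T" using assms(2) by auto
  qed
  have e: "Poly_Mapping.lookup h w \<odot>\<^bsub>free_star_alg T\<^esub> alg_prod (free_star_alg T) (map (\<lambda>i. ncvar (s i)) (letters w))
      = Poly_Mapping.single (NCMono (map s (letters w))) (Poly_Mapping.lookup h w)" for w
  proof -
    have "map (\<lambda>i. ncvar (s i)) (letters w) = map ncvar (map s (letters w))" by simp
    then show ?thesis by (simp only: alg_prod_free_star_alg prod_list_ncvar free_star_alg_sel mult_single) simp
  qed
  have eq: "nc_eval (free_star_alg T) (\<lambda>i. ncvar (s i)) h =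
      (\<Sum>w\<in>Poly_Mapping.keys h. Poly_Mapping.single (NCMono (map s (letters w))) (Poly_Mapping.lookup h w))"
    unfolding nc_eval_def e using m by (intro finsum_free_star_alg) auto
  then show "nc_eval (free_star_alg T) (\<lambda>i. ncvar (s i)) h \<in> ncpolys T"
    using m by (simp add: ncpolys_sum)
  show "linear_ext \<phi> (nc_eval (free_star_alg T) (\<lambda>i. ncvar (s i)) h) = linear_ext (\<lambda>u. \<phi> (map s u)) h"
    unfolding eq linear_ext_sum linear_ext_single by (simp add: linear_ext_def)
qed

section \<open>Random variables with moments of all orders\<close>

context prob_space
begin

lemma all_Lp_power:
  assumes "f \<in> all_Lp M"
  shows "integrable M (\<lambda>\<omega>. norm (f \<omega>) ^ k)"
proof (cases "k = 0")
  case False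
  have "integrable M (\<lambda>\<omega>. norm (f \<omega>) powr real k)" using assms False by (simp add: all_Lp_def)
  moreover have "norm (f \<omega>) powr real k = norm (f \<omega>) ^ k" for \<omega>
    using False by (simp add: powr_realpow')
  ultimately show ?thesis by simp
qed simp

lemma all_Lp_measurable: "f \<in> all_Lp M \<Longrightarrow> f \<in> borel_measurable M"
  by (simp add: all_Lp_def)

lemma all_Lp_integrable:
  assumes "f \<in> all_Lp M"
  shows "integrable M f"
  using all_Lp_power[OF assms, of 1] all_Lp_measurable[OF assms]
  by (simp add: integrable_norm_iff)

text \<open>Integer moments control real ones because \<open>x powr p \<le> 1 + x ^ k\<close> for
  nonnegative \<open>x\<close> and \<open>k = nat \<lceil>p\<rceil>\<close>.\<close>

lemma all_LpI:
  assumes [measurable]: "f \<in> borel_measurable M" and int: "\<And>k. integrable M (\<lambda>\<omega>. norm (f \<omega>) ^ k)"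
  shows "f \<in> all_Lp M"
  unfolding all_Lp_def
proof (intro CollectI conjI allI impI)
  fix p :: real assume p: "1 \<le> p"
  define k where "k = nat \<lceil>p\<rceil>"
  have k: "p \<le> real k" using p unfolding k_def by linarith
  have le: "x powr p \<le> 1 + x ^ k" if "x \<ge> 0" for x :: real
  proof (cases "x \<le> 1")
    case True
    then have "x powr p \<le> 1" using that p by (intro powr_le1) auto
    then show ?thesis using zero_le_power[OF that, of k] by linarith
  next
    case False
    then have "x powr p \<le> x powr real k" using k by (intro powr_mono) auto
    then show ?thesis using False by (simp add: powr_realpow)
  qed
  show "integrable M (\<lambda>\<omega>. norm (f \<omega>) powr p)"
  proof (rule Bochner_Integration.integrable_bound)
    show "integrable M (\<lambda>\<omega>. 1 + norm (f \<omega>) ^ k)" using int by simp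
    show "AE \<omega> in M. norm (norm (f \<omega>) powr p) \<le> norm (1 + norm (f \<omega>) ^ k)"
      using le by (intro AE_I2) (simp add: order_trans[OF le abs_ge_self])
  qed measurable
qed fact

lemma all_Lp_const: "(\<lambda>_. c) \<in> all_Lp M"
  by (rule all_LpI) auto

lemma all_Lp_add:
  assumes f: "f \<in> all_Lp M" and g: "g \<in> all_Lp M"
  shows "(\<lambda>\<omega>. f \<omega> + g \<omega>) \<in> all_Lp M"
proof (rule all_LpI)
  note [measurable] = all_Lp_measurable[OF f] all_Lp_measurable[OF g]
  show "(\<lambda>\<omega>. f \<omega> + g \<omega>) \<in> borel_measurable M" by measurable
  fix k
  have le: "norm (x + y) ^ k \<le> 2 ^ k * (norm x ^ k + norm y ^ k)" for x y :: complex
  proof -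
    have "norm (x + y) \<le> 2 * max (norm x) (norm y)" using norm_triangle_ineq[of x y] by linarith
    then have "norm (x + y) ^ k \<le> (2 * max (norm x) (norm y)) ^ k" by (intro power_mono) auto
    also have "\<dots> = 2 ^ k * max (norm x) (norm y) ^ k" by (rule power_mult_distrib)
    also have "max (norm x) (norm y) ^ k \<le> norm x ^ k + norm y ^ k" by (simp add: max_def)
    finally show ?thesis by simp
  qed
  show "integrable M (\<lambda>\<omega>. norm (f \<omega> + g \<omega>) ^ k)"
  proof (rule Bochner_Integration.integrable_bound)
    show "integrable M (\<lambda>\<omega>. 2 ^ k * (norm (f \<omega>) ^ k + norm (g \<omega>) ^ k))"
      using all_Lp_power[OF f] all_Lp_power[OF g] by simp
    show "AE \<omega> in M. norm (norm (f \<omega> + g \<omega>) ^ k) \<le> norm (2 ^ k * (norm (f \<omega>) ^ k + norm (g \<omega>) ^ k))"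
      using le by (intro AE_I2) (simp add: abs_mult)
  qed measurable
qed

lemma all_Lp_mult:
  assumes f: "f \<in> all_Lp M" and g: "g \<in> all_Lp M"
  shows "(\<lambda>\<omega>. f \<omega> * g \<omega>) \<in> all_Lp M"
proof (rule all_LpI)
  note [measurable] = all_Lp_measurable[OF f] all_Lp_measurable[OF g]
  show "(\<lambda>\<omega>. f \<omega> * g \<omega>) \<in> borel_measurable M" by measurable
  fix k
  have le: "norm (x * y) ^ k \<le> norm x ^ (2 * k) + norm y ^ (2 * k)" for x y :: complex
  proof -
    have "a * b \<le> a ^ 2 + b ^ 2" if "0 \<le> a" "0 \<le> b" for a b :: real
      using sum_squares_bound[of a b] mult_nonneg_nonneg[OF that] by linarith
    from this[of "norm x ^ k" "norm y ^ k"] show ?thesis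
      by (simp add: norm_mult power_mult_distrib power_mult mult.commute[of 2])
  qed
  show "integrable M (\<lambda>\<omega>. norm (f \<omega> * g \<omega>) ^ k)"
  proof (rule Bochner_Integration.integrable_bound)
    show "integrable M (\<lambda>\<omega>. norm (f \<omega>) ^ (2 * k) + norm (g \<omega>) ^ (2 * k))"
      using all_Lp_power[OF f] all_Lp_power[OF g] by simp
    show "AE \<omega> in M. norm (norm (f \<omega> * g \<omega>) ^ k) \<le> norm (norm (f \<omega>) ^ (2 * k) + norm (g \<omega>) ^ (2 * k))"
      using le by (intro AE_I2) simp
  qed measurable
qed

lemma all_Lp_sum: "(\<And>x. x \<in> A \<Longrightarrow> f x \<in> all_Lp M) \<Longrightarrow> (\<lambda>\<omega>. \<Sum>x\<in>A. f x \<omega>) \<in> all_Lp M"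
  by (induction A rule: infinite_finite_induct) (auto intro: all_Lp_const all_Lp_add)

lemma all_Lp_of_real:
  assumes "Y \<in> borel_measurable M" "\<And>k. integrable M (\<lambda>\<omega>. Y \<omega> ^ k)"
  shows "(\<lambda>\<omega>. complex_of_real (Y \<omega>)) \<in> all_Lp M"
proof (rule all_LpI)
  show "(\<lambda>\<omega>. complex_of_real (Y \<omega>)) \<in> borel_measurable M" using assms(1) by measurable
  show "integrable M (\<lambda>\<omega>. norm (complex_of_real (Y \<omega>)) ^ k)" for k
    using integrable_abs[OF assms(2)[of k]] by (simp add: power_abs)
qed

end

section \<open>The algebra of random matrices\<close>

context prob_space
begin

lemma rmat_alg_sel [simp]:
  "mult (rmat_alg M n) A B = (\<lambda>\<omega>. A \<omega> * B \<omega>)" "one (rmat_alg M n) = (\<lambda>_. 1\<^sub>m n)"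
  "zero (rmat_alg M n) = (\<lambda>_. 0\<^sub>m n n)" "add (rmat_alg M n) A B = (\<lambda>\<omega>. A \<omega> + B \<omega>)"
  "smult (rmat_alg M n) c A = (\<lambda>\<omega>. c \<cdot>\<^sub>m A \<omega>)"
  by (simp_all add: rmat_alg_def)

lemma rmat_carrier_iff:
  "A \<in> carrier (rmat_alg M n) \<longleftrightarrow> (\<forall>\<omega>. A \<omega> \<in> carrier_mat n n) \<and>
     (\<forall>i<n. \<forall>j<n. (\<lambda>\<omega>. A \<omega> $$ (i, j)) \<in> all_Lp M)"
  by (simp add: rmat_alg_def)

lemma rmat_carrierD:
  assumes "A \<in> carrier (rmat_alg M n)"
  shows "A \<omega> \<in> carrier_mat n n" "dim_row (A \<omega>) = n" "dim_col (A \<omega>) = n"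
    and "i < n \<Longrightarrow> j < n \<Longrightarrow> (\<lambda>\<omega>. A \<omega> $$ (i, j)) \<in> all_Lp M"
proof -
  show "A \<omega> \<in> carrier_mat n n" using assms by (simp add: rmat_carrier_iff)
  then show "dim_row (A \<omega>) = n" "dim_col (A \<omega>) = n" by auto
qed (use assms in \<open>simp add: rmat_carrier_iff\<close>)

lemma rmat_add_carrier:
  assumes "A \<in> carrier (rmat_alg M n)" "B \<in> carrier (rmat_alg M n)"
  shows "(\<lambda>\<omega>. A \<omega> + B \<omega>) \<in> carrier (rmat_alg M n)"
  unfolding rmat_carrier_iff
  using rmat_carrierD[OF assms(1)] rmat_carrierD[OF assms(2)] by (auto intro: all_Lp_add)

lemma rmat_mult_carrier:
  assumes "A \<in> carrier (rmat_alg M n)" "B \<in> carrier (rmat_alg M n)"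
  shows "(\<lambda>\<omega>. A \<omega> * B \<omega>) \<in> carrier (rmat_alg M n)"
  unfolding rmat_carrier_iff
proof (intro conjI allI impI)
  show "A \<omega> * B \<omega> \<in> carrier_mat n n" for \<omega>
    using rmat_carrierD(1)[OF assms(1)] rmat_carrierD(1)[OF assms(2)] by (rule mult_carrier_mat)
  fix i j assume ij: "i < n" "j < n"
  have "(A \<omega> * B \<omega>) $$ (i, j) = (\<Sum>k\<in>{0..<n}. A \<omega> $$ (i, k) * B \<omega> $$ (k, j))" for \<omega>
    using rmat_carrierD(2,3)[OF assms(1)] rmat_carrierD(2,3)[OF assms(2)] ij by (simp add: scalar_prod_def)
  then show "(\<lambda>\<omega>. (A \<omega> * B \<omega>) $$ (i, j)) \<in> all_Lp M"
    using rmat_carrierD(4)[OF assms(1)] rmat_carrierD(4)[OF assms(2)] ij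
    by (auto intro!: all_Lp_sum all_Lp_mult)
qed

lemma rmat_smult_carrier:
  assumes "A \<in> carrier (rmat_alg M n)"
  shows "(\<lambda>\<omega>. c \<cdot>\<^sub>m A \<omega>) \<in> carrier (rmat_alg M n)"
  unfolding rmat_carrier_iff
  using rmat_carrierD[OF assms] by (auto intro!: all_Lp_mult all_Lp_const)

lemma rmat_one_carrier: "(\<lambda>_. 1\<^sub>m n) \<in> carrier (rmat_alg M n)"
  by (simp add: rmat_carrier_iff all_Lp_const)

lemma rmat_zero_carrier: "(\<lambda>_. 0\<^sub>m n n) \<in> carrier (rmat_alg M n)"
  by (simp add: rmat_carrier_iff all_Lp_const)

lemma abelian_monoid_rmat_alg: "abelian_monoid (rmat_alg M n)"
proof (rule abelian_monoidI)
  fix x y z assume "x \<in> carrier (rmat_alg M n)" "y \<in> carrier (rmat_alg M n)" "z \<in> carrier (rmat_alg M n)"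
  then show "x \<oplus>\<^bsub>rmat_alg M n\<^esub> y \<oplus>\<^bsub>rmat_alg M n\<^esub> z = x \<oplus>\<^bsub>rmat_alg M n\<^esub> (y \<oplus>\<^bsub>rmat_alg M n\<^esub> z)"
    using rmat_carrierD(1)[of x] rmat_carrierD(1)[of y] rmat_carrierD(1)[of z]
    by (auto simp: assoc_add_mat[of _ n n])
next
  fix x assume "x \<in> carrier (rmat_alg M n)"
  then show "\<zero>\<^bsub>rmat_alg M n\<^esub> \<oplus>\<^bsub>rmat_alg M n\<^esub> x = x"
    using rmat_carrierD(1)[of x] by (auto simp: left_add_zero_mat[of _ n n])
next
  fix x y assume "x \<in> carrier (rmat_alg M n)" "y \<in> carrier (rmat_alg M n)"
  then show "x \<oplus>\<^bsub>rmat_alg M n\<^esub> y = y \<oplus>\<^bsub>rmat_alg M n\<^esub> x"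
    using rmat_carrierD(1)[of x] rmat_carrierD(1)[of y] by (auto intro!: ext comm_add_mat[of _ n n])
qed (auto intro: rmat_add_carrier rmat_zero_carrier)

lemma finsum_rmat_alg:
  assumes "finite S" "\<And>x. x \<in> S \<Longrightarrow> f x \<in> carrier (rmat_alg M n)"
  shows "finsum (rmat_alg M n) f S \<in> carrier (rmat_alg M n) \<and>
    (\<forall>\<omega>. \<forall>i<n. \<forall>j<n. finsum (rmat_alg M n) f S \<omega> $$ (i, j) = (\<Sum>x\<in>S. f x \<omega> $$ (i, j)))"
proof -
  interpret abelian_monoid "rmat_alg M n" by (rule abelian_monoid_rmat_alg)
  show ?thesis using assms
  proof (induction S rule: finite_induct)
    case empty
    then show ?case using rmat_zero_carrier[of n] by (simp add: finsum_empty)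
  next
    case (insert x S)
    let ?F = "finsum (rmat_alg M n) f S"
    have IH: "?F \<in> carrier (rmat_alg M n)"
      "\<And>\<omega> i j. i < n \<Longrightarrow> j < n \<Longrightarrow> ?F \<omega> $$ (i, j) = (\<Sum>x\<in>S. f x \<omega> $$ (i, j))"
      using insert by auto
    have fx: "f x \<in> carrier (rmat_alg M n)" using insert.prems by simp
    have "finsum (rmat_alg M n) f (insert x S) = (\<lambda>\<omega>. f x \<omega> + ?F \<omega>)"
      using insert by (subst finsum_insert) auto
    then show ?case
      using insert.hyps rmat_add_carrier[OF fx IH(1)] IH(2) rmat_carrierD(2,3)[OF fx] rmat_carrierD(2,3)[OF IH(1)]
      by simp
  qed
qed

lemma alg_prod_rmat_carrier:
  "\<forall>x\<in>set u. A x \<in> carrier (rmat_alg M n) \<Longrightarrow> alg_prod (rmat_alg M n) (map A u) \<in> carrier (rmat_alg M n)"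
  by (induction u) (auto simp: alg_prod_def intro: rmat_one_carrier rmat_mult_carrier)

text \<open>Translates between matrix positions counted from 0 and walk vertices counted from
  1.\<close>

definition entry :: "'a rmat \<Rightarrow> 'a \<Rightarrow> nat \<Rightarrow> nat \<Rightarrow> complex" where
  "entry A \<omega> i j = A \<omega> $$ (i - 1, j - 1)"

lemma alg_prod_rmat_entry:
  assumes "\<forall>x\<in>set u. A x \<in> carrier (rmat_alg M n)" "i \<in> {1..n}" "j \<in> {1..n}"
  shows "entry (alg_prod (rmat_alg M n) (map A u)) \<omega> i j = mat_word n (\<lambda>x. entry (A x) \<omega>) u i j"
  using assms
proof (induction u arbitrary: i)
  case Nil
  then show ?case by (auto simp: alg_prod_def entry_def)
next
  case (Cons x u)
  let ?P = "alg_prod (rmat_alg M n) (map A u)"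
  have P: "?P \<in> carrier (rmat_alg M n)" using Cons.prems by (intro alg_prod_rmat_carrier) auto
  have Ax: "A x \<in> carrier (rmat_alg M n)" using Cons.prems by simp
  have ij: "i - 1 < n" "j - 1 < n" using Cons.prems(2,3) by auto
  have "alg_prod (rmat_alg M n) (map A (x # u)) \<omega> = A x \<omega> * ?P \<omega>" by (simp add: alg_prod_def)
  then have "entry (alg_prod (rmat_alg M n) (map A (x # u))) \<omega> i j =
      (\<Sum>k\<in>{0..<n}. A x \<omega> $$ (i - 1, k) * ?P \<omega> $$ (k, j - 1))"
    using rmat_carrierD(2,3)[OF P] rmat_carrierD(2,3)[OF Ax] ij
    by (simp add: entry_def scalar_prod_def)
  also have "\<dots> = (\<Sum>k\<in>{1..n}. entry (A x) \<omega> i k * entry ?P \<omega> k j)"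
    by (simp add: entry_def sum.atLeast1_atMost_eq atLeast0LessThan)
  also have "\<dots> = (\<Sum>k\<in>{1..n}. entry (A x) \<omega> i k * mat_word n (\<lambda>x. entry (A x) \<omega>) u k j)"
    using Cons by (intro sum.cong refl) auto
  finally show ?case by simp
qed

lemma mean_trace_entry: "mean_trace M n A = (\<integral>\<omega>. (\<Sum>i\<in>{1..n}. entry A \<omega> i i) \<partial>M) / of_nat n"
  by (simp add: mean_trace_def entry_def sum.atLeast1_atMost_eq)

lemma mean_trace_alg_prod:
  assumes "\<forall>x\<in>set u. A x \<in> carrier (rmat_alg M n)"
  shows "mean_trace M n (alg_prod (rmat_alg M n) (map A u)) =
     (\<integral>\<omega>. (\<Sum>i\<in>{1..n}. mat_word n (\<lambda>x. entry (A x) \<omega>) u i i) \<partial>M) / of_nat n"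
  unfolding mean_trace_entry using assms by (simp add: alg_prod_rmat_entry)

lemma integrable_trace:
  assumes "A \<in> carrier (rmat_alg M n)"
  shows "integrable M (\<lambda>\<omega>. \<Sum>i\<in>{1..n}. entry A \<omega> i i)"
  unfolding entry_def using rmat_carrierD(4)[OF assms]
  by (intro Bochner_Integration.integrable_sum all_Lp_integrable) auto

lemma nc_eval_rmat:
  assumes "h \<in> ncpolys T" "\<forall>x\<in>T. A x \<in> carrier (rmat_alg M n)"
  shows "nc_eval (rmat_alg M n) A h \<in> carrier (rmat_alg M n)"
    and "i \<in> {1..n} \<Longrightarrow> j \<in> {1..n} \<Longrightarrow>
      entry (nc_eval (rmat_alg M n) A h) \<omega> i j = mat_poly n (\<lambda>x. entry (A x) \<omega>) h i j"
proof -
  let ?P = "\<lambda>w. alg_prod (rmat_alg M n) (map A (letters w))"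
  have P: "?P w \<in> carrier (rmat_alg M n)" and T: "set (letters w) \<subseteq> T" if "w \<in> Poly_Mapping.keys h" for w
  proof -
    show "set (letters w) \<subseteq> T" using assms(1) that by (simp add: ncpolys_def)
    then show "?P w \<in> carrier (rmat_alg M n)" using assms(2) by (intro alg_prod_rmat_carrier) auto
  qed
  let ?f = "\<lambda>w. Poly_Mapping.lookup h w \<odot>\<^bsub>rmat_alg M n\<^esub> ?P w"
  have f: "?f w \<in> carrier (rmat_alg M n)" if "w \<in> Poly_Mapping.keys h" for w
    using rmat_smult_carrier[OF P[OF that]] by simp
  note s = finsum_rmat_alg[OF finite_keys, of h ?f n, OF f]
  then show "nc_eval (rmat_alg M n) A h \<in> carrier (rmat_alg M n)" unfolding nc_eval_def by blast
  assume ij: "i \<in> {1..n}" "j \<in> {1..n}"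
  then have ij': "i - 1 < n" "j - 1 < n" by auto
  have "entry (nc_eval (rmat_alg M n) A h) \<omega> i j = (\<Sum>w\<in>Poly_Mapping.keys h. entry (?f w) \<omega> i j)"
    using s ij unfolding nc_eval_def entry_def by auto
  also have "\<dots> = (\<Sum>w\<in>Poly_Mapping.keys h. Poly_Mapping.lookup h w * mat_word n (\<lambda>x. entry (A x) \<omega>) (letters w) i j)"
  proof (intro sum.cong refl)
    fix w assume w: "w \<in> Poly_Mapping.keys h"
    have "entry (?f w) \<omega> i j = Poly_Mapping.lookup h w * entry (?P w) \<omega> i j"
      using rmat_carrierD(2,3)[OF P[OF w], of \<omega>] ij' by (simp add: entry_def)
    also have "entry (?P w) \<omega> i j = mat_word n (\<lambda>x. entry (A x) \<omega>) (letters w) i j"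
      using T[OF w] assms(2) ij by (intro alg_prod_rmat_entry) auto
    finally show "entry (?f w) \<omega> i j = Poly_Mapping.lookup h w * mat_word n (\<lambda>x. entry (A x) \<omega>) (letters w) i j" .
  qed
  finally show "entry (nc_eval (rmat_alg M n) A h) \<omega> i j = mat_poly n (\<lambda>x. entry (A x) \<omega>) h i j"
    by (simp add: mat_poly_def linear_ext_def)
qed

text \<open>The first form is linear in the words and serves for limits. The second works with the
  entries of the evaluated polynomial, as needed for positivity and for products of
  increments.\<close>

lemma mean_trace_nc_eval:
  assumes "h \<in> ncpolys T" "\<forall>x\<in>T. A x \<in> carrier (rmat_alg M n)"
  shows "mean_trace M n (nc_eval (rmat_alg M n) A h) =
     linear_ext (\<lambda>u. mean_trace M n (alg_prod (rmat_alg M n) (map A u))) h"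
    and "mean_trace M n (nc_eval (rmat_alg M n) A h) =
     (\<integral>\<omega>. (\<Sum>i\<in>{1..n}. mat_poly n (\<lambda>x. entry (A x) \<omega>) h i i) \<partial>M) / of_nat n"
proof -
  show 2: "mean_trace M n (nc_eval (rmat_alg M n) A h) =
     (\<integral>\<omega>. (\<Sum>i\<in>{1..n}. mat_poly n (\<lambda>x. entry (A x) \<omega>) h i i) \<partial>M) / of_nat n"
    unfolding mean_trace_entry using nc_eval_rmat(2)[OF assms] by simp
  have c: "\<forall>x\<in>set (letters w). A x \<in> carrier (rmat_alg M n)" if "w \<in> Poly_Mapping.keys h" for w
    using assms that by (auto simp: ncpolys_def)
  have int: "integrable M (\<lambda>\<omega>. \<Sum>i\<in>{1..n}. mat_word n (\<lambda>x. entry (A x) \<omega>) (letters w) i i)"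
    if "w \<in> Poly_Mapping.keys h" for w
    using integrable_trace[OF alg_prod_rmat_carrier[OF c[OF that]]]
    by (simp add: alg_prod_rmat_entry[OF c[OF that]])
  have "(\<lambda>\<omega>. \<Sum>i\<in>{1..n}. mat_poly n (\<lambda>x. entry (A x) \<omega>) h i i) = (\<lambda>\<omega>. \<Sum>w\<in>Poly_Mapping.keys h.
      Poly_Mapping.lookup h w * (\<Sum>i\<in>{1..n}. mat_word n (\<lambda>x. entry (A x) \<omega>) (letters w) i i))"
    unfolding mat_poly_def linear_ext_def sum_distrib_left by (subst sum.swap) rule
  then show "mean_trace M n (nc_eval (rmat_alg M n) A h) =
     linear_ext (\<lambda>u. mean_trace M n (alg_prod (rmat_alg M n) (map A u))) h"
    unfolding 2 linear_ext_def using int c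
    by (simp add: Bochner_Integration.integral_sum mean_trace_alg_prod sum_divide_distrib)
qed

end

text \<open>The point 0 is inserted because the walks vanish there, so that a walk at any grid time
  is the sum of its increments.\<close>

lemma time_grid:
  assumes "finite S" "S \<subseteq> {0::real..}"
  obtains p t idx where "increasing_times p t" "t 0 = 0" "\<And>s. s \<in> S \<Longrightarrow> idx s \<le> p \<and> t (idx s) = s"
proof -
  define xs where "xs = sorted_list_of_set (insert 0 S)"
  have "finite (insert 0 S)" using assms(1) by simp
  then have set: "set xs = insert 0 S" unfolding xs_def by (rule set_sorted_list_of_set)
  have less: "xs ! i < xs ! j" if "i < j" "j < length xs" for i j
    using that strict_sorted_list_of_set[of "insert 0 S"] unfolding xs_def[symmetric]
    by (rule sorted_wrt_nth_less[rotated])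
  have ne: "xs \<noteq> []" using set by auto
  have "xs ! 0 \<in> set xs" using ne by (intro nth_mem) simp
  then have ge: "0 \<le> xs ! 0" using set assms(2) by auto
  obtain k where k: "k < length xs" "xs ! k = 0" using set by (metis in_set_conv_nth insertI1)
  have 0: "xs ! 0 = 0" using less[of 0 k] k ge by (cases "k = 0") auto
  have "\<forall>s\<in>S. \<exists>i. i < length xs \<and> xs ! i = s" using set by (metis in_set_conv_nth insertI2)
  then obtain idx where idx: "\<And>s. s \<in> S \<Longrightarrow> idx s < length xs \<and> xs ! idx s = s" by metis
  show thesis
  proof (rule that[of "length xs - 1" "\<lambda>i. xs ! i" idx])
    show "increasing_times (length xs - 1) ((!) xs)"
      unfolding increasing_times_def using 0 less by auto
    show "xs ! 0 = 0" by (rule 0)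
    show "idx s \<le> length xs - 1 \<and> xs ! idx s = s" if "s \<in> S" for s
      using idx[OF that] by auto
  qed
qed

lemma listset_set: "zs \<in> listset As \<Longrightarrow> set zs \<subseteq> \<Union>(set As)"
  by (induction As arbitrary: zs) (fastforce simp: set_Cons_def)+

lemma indexed_pair_words_drop:
  assumes "v \<in> indexed_pair_words rs"
  shows "paired (drop_indices v)" "length (drop_indices v) = length rs" "even (length rs)"
proof -
  have "drop_indices v \<in> pair_words (length rs)" using assms by (rule drop_indices_pair_words)
  then show "paired (drop_indices v)" and l: "length (drop_indices v) = length rs"
    by (auto simp: pair_words_def paired_def)
  show "even (length rs)" using paired_length[OF \<open>paired (drop_indices v)\<close>] l by simp
qed

lemma word_density_eq_density: "length w = 2 * m \<Longrightarrow> word_density L m w = walk_density L w"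
  by (simp add: word_density_def walk_density_def card_Pi_circuits fun_eq_iff)

lemma word_limits_existD:
  assumes "word_limits_exist L rs" "v \<in> indexed_pair_words rs" "rs \<noteq> []"
  shows "convergent (walk_density L (drop_indices v))"
proof -
  obtain m where m: "length rs = 2 * m" using indexed_pair_words_drop(3)[OF assms(2)] by (elim evenE)
  then have "m \<ge> 1" using assms(3) by (cases m) auto
  then have "convergent (word_density L m (drop_indices v))"
    using assms m unfolding word_limits_exist_def by blast
  then show ?thesis using m indexed_pair_words_drop(2)[OF assms(2)] by (simp add: word_density_eq_density)
qed

definition limit_density_sum :: "link \<Rightarrow> nat list \<Rightarrow> real" where
  "limit_density_sum L rs = (\<Sum>v\<in>indexed_pair_words rs. lim (walk_density L (drop_indices v)))"

lemma mat_poly_ncstar: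
  assumes sym: "\<And>x i j. x \<in> T \<Longrightarrow> i \<in> {1..n} \<Longrightarrow> j \<in> {1..n} \<Longrightarrow> a x i j = a x j i"
    and h: "h \<in> ncpolys T" and ij: "i \<in> {1..n}" "j \<in> {1..n}"
  shows "mat_poly n (\<lambda>x i j. complex_of_real (a x i j)) (ncstar h) i j =
     cnj (mat_poly n (\<lambda>x i j. complex_of_real (a x i j)) h j i)"
proof -
  have "mat_word n (\<lambda>x i j. complex_of_real (a x i j)) (rev (letters w)) i j =
      cnj (mat_word n (\<lambda>x i j. complex_of_real (a x i j)) (letters w) j i)"
    if "w \<in> Poly_Mapping.keys h" for w
  proof -
    have "set (letters w) \<subseteq> T" using h that unfolding ncpolys_def by blast
    then have "mat_word n a (rev (letters w)) i j = mat_word n a (letters w) j i"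
      using ij sym by (intro mat_word_transpose) auto
    then show ?thesis by (simp add: mat_word_of_real)
  qed
  then show ?thesis
    unfolding mat_poly_def ncstar_def linear_ext_sum linear_ext_single
    by (simp add: linear_ext_def)
qed

context input_variables
begin

context
  fixes d L C
  assumes d: "d \<in> {1, 2}" and link: "link_function d L" and C: "fibre_bound L C"
begin

lemma index_link: "i < n \<Longrightarrow> j < n \<Longrightarrow> index (L n (Suc i) (Suc j))"
  using link d unfolding link_function_def index_def by fastforce

lemma walk_eq_block_sum: "walk X n a s = block_sum a {1..nat \<lfloor>real n * s\<rfloor>}"
  by (simp add: walk_def block_sum_def fun_eq_iff)

lemma scaled_matrix_entry:
  "i < n \<Longrightarrow> j < n \<Longrightarrow> scaled_matrix X L n s \<omega> $$ (i, j) =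
     complex_of_real (walk X n (L n (Suc i) (Suc j)) s \<omega> / real n)"
  by (simp add: scaled_matrix_def walk_matrix_def of_real_mult[symmetric] del: of_real_mult)

lemma entry_scaled_matrix:
  "i \<in> {1..n} \<Longrightarrow> j \<in> {1..n} \<Longrightarrow> entry (scaled_matrix X L n s) \<omega> i j =
     complex_of_real (walk X n (L n i j) s \<omega> / real n)"
  unfolding entry_def by (subst scaled_matrix_entry) auto

lemma scaled_matrix_carrier: "scaled_matrix X L n s \<in> carrier (rmat_alg M n)"
  unfolding rmat_carrier_iff
proof (intro conjI allI impI)
  show "scaled_matrix X L n s \<omega> \<in> carrier_mat n n" for \<omega>
    by (simp add: scaled_matrix_def walk_matrix_def)
  fix i j assume ij: "i < n" "j < n"
  let ?I = "{1..nat \<lfloor>real n * s\<rfloor>}" and ?a = "L n (Suc i) (Suc j)"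
  have int: "integrable M (\<lambda>\<omega>. block_sum ?a ?I \<omega> ^ k)" for k
    using index_link[OF ij] by (intro integrable_block_sum_power) auto
  have "integrable M (\<lambda>\<omega>. block_sum ?a ?I \<omega> ^ 1)" by (rule int)
  then have meas: "block_sum ?a ?I \<in> borel_measurable M" by (simp add: borel_measurable_integrable)
  have "(\<lambda>\<omega>. complex_of_real (block_sum ?a ?I \<omega> / real n)) \<in> all_Lp M"
  proof (rule all_Lp_of_real)
    show "(\<lambda>\<omega>. block_sum ?a ?I \<omega> / real n) \<in> borel_measurable M" using meas by measurable
    show "integrable M (\<lambda>\<omega>. (block_sum ?a ?I \<omega> / real n) ^ k)" for k
      using int[of k] by (simp add: power_divide)
  qed
  then show "(\<lambda>\<omega>. scaled_matrix X L n s \<omega> $$ (i, j)) \<in> all_Lp M"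
    using ij by (simp add: scaled_matrix_entry walk_eq_block_sum)
qed

lemma increment_matrix_eq: "increment_matrix X L t n r \<omega> = scaled_matrix X L n (t r) \<omega> - scaled_matrix X L n (t (r - 1)) \<omega>"
  by (rule eq_matI) (auto simp: increment_matrix_def scaled_matrix_def walk_matrix_def algebra_simps)

lemma increment_matrix_carrier: "increment_matrix X L t n r \<in> carrier (rmat_alg M n)"
proof -
  note dims = rmat_carrierD(2,3)[OF scaled_matrix_carrier]
  have "increment_matrix X L t n r = (\<lambda>\<omega>. scaled_matrix X L n (t r) \<omega> + (- 1) \<cdot>\<^sub>m scaled_matrix X L n (t (r - 1)) \<omega>)"
  proof
    fix \<omega> show "increment_matrix X L t n r \<omega> = scaled_matrix X L n (t r) \<omega> + (- 1) \<cdot>\<^sub>m scaled_matrix X L n (t (r - 1)) \<omega>"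
      unfolding increment_matrix_eq by (rule eq_matI) (simp_all add: dims)
  qed
  then show ?thesis
    by (simp add: rmat_add_carrier rmat_smult_carrier scaled_matrix_carrier)
qed

lemma entry_increment_matrix:
  assumes "i \<in> {1..n}" "j \<in> {1..n}"
  shows "entry (increment_matrix X L t n r) \<omega> i j =
     entry (scaled_matrix X L n (t r)) \<omega> i j - entry (scaled_matrix X L n (t (r - 1))) \<omega> i j"
proof -
  have "i - 1 < n" "j - 1 < n" using assms by auto
  then show ?thesis
    using rmat_carrierD(2,3)[OF scaled_matrix_carrier, of n] unfolding entry_def increment_matrix_eq
    by simp
qed

definition increment_trace :: "(nat \<Rightarrow> real) \<Rightarrow> nat list \<Rightarrow> nat \<Rightarrow> complex" where
  "increment_trace t rs n = mean_trace M n (alg_prod (rmat_alg M n) (map (increment_matrix X L t n) rs))"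

text \<open>Each entry is an increment divided by \<open>n\<close>, from two factors
  \<open>n ^ (- 1 / 2)\<close>. Expanding the trace over closed walks pairs each link value with the
  interval of its factor.\<close>

lemma increment_trace_eq:
  assumes t: "increasing_times p t" and rs: "set rs \<subseteq> {1..p}"
  shows "increment_trace t rs n = complex_of_real
     ((\<Sum>xs\<in>closed_walks n (length rs). walk_moment L t rs n xs) / (real n * real n ^ length rs))"
proof -
  let ?Q = "\<lambda>\<omega> xs. prod_list (map (\<lambda>c. increment t n c \<omega>) (zip (edges (L n) xs) rs))"
  have e: "entry (increment_matrix X L t n r) \<omega> i j = complex_of_real ((1 / real n) * increment t n (L n i j, r) \<omega>)"
    if "r \<in> set rs" "i \<in> {1..n}" "j \<in> {1..n}" for r \<omega> i j
  proof -
    have r: "r \<in> {1..p}" using that(1) rs by blast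
    then have "t (r - 1) \<le> t r" by (intro increasing_times_mono[OF t]) auto
    from walk_increment[OF this, of n "L n i j" \<omega>] show ?thesis
      unfolding entry_increment_matrix[OF that(2,3)] entry_scaled_matrix[OF that(2,3)]
      by (simp add: diff_divide_distrib[symmetric] of_real_diff[symmetric] del: of_real_diff)
  qed
  have "(\<Sum>i\<in>{1..n}. mat_word n (\<lambda>r. entry (increment_matrix X L t n r) \<omega>) rs i i) =
      complex_of_real ((1 / real n) ^ length rs * (\<Sum>xs\<in>closed_walks n (length rs). ?Q \<omega> xs))" for \<omega>
  proof -
    have "mat_word n (\<lambda>r. entry (increment_matrix X L t n r) \<omega>) rs i i =
        complex_of_real ((1 / real n) ^ length rs * mat_word n (\<lambda>r i j. increment t n (L n i j, r) \<omega>) rs i i)"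
      if "i \<in> {1..n}" for i
      unfolding mat_word_scale[symmetric] mat_word_of_real[symmetric] using that e
      by (intro mat_word_cong) auto
    then have "(\<Sum>i\<in>{1..n}. mat_word n (\<lambda>r. entry (increment_matrix X L t n r) \<omega>) rs i i) =
        complex_of_real ((1 / real n) ^ length rs * (\<Sum>i\<in>{1..n}. mat_word n (\<lambda>r i j. increment t n (L n i j, r) \<omega>) rs i i))"
      by (simp add: sum_distrib_left)
    also have "(\<Sum>i\<in>{1..n}. mat_word n (\<lambda>r i j. increment t n (L n i j, r) \<omega>) rs i i) = (\<Sum>xs\<in>closed_walks n (length rs). ?Q \<omega> xs)"
      by (rule mat_word_trace[where g = "\<lambda>c. increment t n c \<omega>" and L = "L n"])
    finally show ?thesis .
  qed
  moreover have "\<forall>x\<in>set rs. increment_matrix X L t n x \<in> carrier (rmat_alg M n)"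
    by (simp add: increment_matrix_carrier)
  ultimately have "increment_trace t rs n =
      (\<integral>\<omega>. complex_of_real ((1 / real n) ^ length rs * (\<Sum>xs\<in>closed_walks n (length rs). ?Q \<omega> xs)) \<partial>M) / of_nat n"
    unfolding increment_trace_def by (simp only: mean_trace_alg_prod)
  also have "\<dots> = complex_of_real ((1 / real n) ^ length rs *
      (\<integral>\<omega>. (\<Sum>xs\<in>closed_walks n (length rs). ?Q \<omega> xs) \<partial>M) / real n)"
    by (simp add: integral_complex_of_real del: of_real_mult of_real_sum of_real_power of_real_divide) simp
  also have "(\<integral>\<omega>. (\<Sum>xs\<in>closed_walks n (length rs). ?Q \<omega> xs) \<partial>M) =
      (\<Sum>xs\<in>closed_walks n (length rs). walk_moment L t rs n xs)"
    unfolding walk_moment_def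
  proof (rule Bochner_Integration.integral_sum)
    fix xs assume "xs \<in> closed_walks n (length rs)"
    then have "xs \<in> walks n (length rs)" by (simp add: closed_walks_def)
    then show "integrable M (\<lambda>\<omega>. ?Q \<omega> xs)"
      by (rule increment_product(1)[OF t valid_index_edges[OF d link rs]])
  qed
  finally show ?thesis by (simp add: field_simps)
qed

lemma increment_trace_limit:
  assumes t: "increasing_times p t" and rs: "set rs \<subseteq> {1..p}"
    and conv: "\<And>v. v \<in> indexed_pair_words rs \<Longrightarrow> convergent (walk_density L (drop_indices v))"
  shows "increment_trace t rs \<longlonglongrightarrow> complex_of_real (weight t rs * limit_density_sum L rs)"
  using tendsto_of_real[OF walk_moment_limit[OF d link C t rs conv]]
  unfolding limit_density_sum_def increment_trace_eq[OF t rs, abs_def] .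

definition word_trace :: "real list \<Rightarrow> nat \<Rightarrow> complex" where
  "word_trace u n = mean_trace M n (alg_prod (rmat_alg M n) (map (scaled_matrix X L n) u))"

lemma walk_telescope:
  fixes t :: "nat \<Rightarrow> real"
  assumes "t 0 = 0"
  shows "walk X n a (t k) \<omega> = (\<Sum>r\<in>{1..k}. walk X n a (t r) \<omega> - walk X n a (t (r - 1)) \<omega>)"
proof (induction k)
  case 0
  then show ?case using assms by (simp add: walk_def)
qed simp

text \<open>A factor at time \<open>s\<close> telescopes over the intervals \<open>1\<close> to
  \<open>idx s\<close>, and multiplying out chooses one interval for each factor.\<close>

lemma word_trace_eq:
  fixes t :: "nat \<Rightarrow> real"
  assumes t0: "t 0 = 0" and idx: "\<And>s. s \<in> set u \<Longrightarrow> t (idx s) = s"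
  shows "word_trace u n = (\<Sum>rs\<in>listset (map (\<lambda>s. {1..idx s}) u). increment_trace t rs n)"
proof -
  have c: "\<forall>x\<in>set u. scaled_matrix X L n x \<in> carrier (rmat_alg M n)"
    "\<forall>r\<in>set rs. increment_matrix X L t n r \<in> carrier (rmat_alg M n)" for rs
    by (simp_all add: scaled_matrix_carrier increment_matrix_carrier)
  have e: "entry (scaled_matrix X L n s) \<omega> i j = (\<Sum>r\<in>{1..idx s}. entry (increment_matrix X L t n r) \<omega> i j)"
    if "s \<in> set u" "i \<in> {1..n}" "j \<in> {1..n}" for s \<omega> i j
    unfolding entry_increment_matrix[OF that(2,3)] entry_scaled_matrix[OF that(2,3)]
    using walk_telescope[where t = t and n = n and a = "L n i j" and k = "idx s" and \<omega> = \<omega>, OF t0] idx[OF that(1)]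
    by (simp add: sum_divide_distrib diff_divide_distrib)
  have "(\<Sum>i\<in>{1..n}. mat_word n (\<lambda>s. entry (scaled_matrix X L n s) \<omega>) u i i) =
      (\<Sum>i\<in>{1..n}. \<Sum>rs\<in>listset (map (\<lambda>s. {1..idx s}) u). mat_word n (\<lambda>r. entry (increment_matrix X L t n r) \<omega>) rs i i)" for \<omega>
    unfolding mat_word_sum[symmetric] using e by (intro sum.cong refl mat_word_cong) auto
  then have "word_trace u n = (\<integral>\<omega>. (\<Sum>rs\<in>listset (map (\<lambda>s. {1..idx s}) u).
      \<Sum>i\<in>{1..n}. mat_word n (\<lambda>r. entry (increment_matrix X L t n r) \<omega>) rs i i) \<partial>M) / of_nat n"
    unfolding word_trace_def mean_trace_alg_prod[OF c(1)] by (subst sum.swap) simp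
  also have "\<dots> = (\<Sum>rs\<in>listset (map (\<lambda>s. {1..idx s}) u).
      (\<integral>\<omega>. (\<Sum>i\<in>{1..n}. mat_word n (\<lambda>r. entry (increment_matrix X L t n r) \<omega>) rs i i) \<partial>M)) / of_nat n"
  proof (intro arg_cong2[where f = "(/)"] refl Bochner_Integration.integral_sum)
    fix rs
    show "integrable M (\<lambda>\<omega>. \<Sum>i\<in>{1..n}. mat_word n (\<lambda>r. entry (increment_matrix X L t n r) \<omega>) rs i i)"
      using integrable_trace[OF alg_prod_rmat_carrier[OF c(2)[of rs]]]
      by (simp add: alg_prod_rmat_entry[OF c(2)[of rs]])
  qed
  finally show ?thesis
    unfolding increment_trace_def mean_trace_alg_prod[OF c(2)] by (simp add: sum_divide_distrib)
qed

lemma mean_trace_eq_linear_ext: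
  "h \<in> ncpolys T \<Longrightarrow> mean_trace M n (nc_eval (rmat_alg M n) (scaled_matrix X L n) h) = linear_ext (\<lambda>u. word_trace u n) h"
  unfolding word_trace_def by (rule mean_trace_nc_eval(1)) (auto simp: scaled_matrix_carrier)

end

end

section \<open>The limit state\<close>

lemma mat_word_single: "j \<in> {1..n} \<Longrightarrow> mat_word n a [x] i j = a x i j"
proof -
  assume j: "j \<in> {1..n}"
  have "mat_word n a [x] i j = (\<Sum>k\<in>{1..n}. if k = j then a x i k else 0)"
    by (auto intro!: sum.cong)
  then show ?thesis using j by simp
qed

lemma mat_poly_ncvar: "j \<in> {1..n} \<Longrightarrow> mat_poly n a (ncvar x) i j = a x i j"
  using mat_word_single[of j n a x i] by (simp add: mat_poly_def ncvar_def linear_ext_single)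

lemma mat_poly_diff: "mat_poly n a (g - h) i j = mat_poly n a g i j - mat_poly n a h i j"
  using linear_ext_add[of _ g "- h"] by (simp add: mat_poly_def linear_ext_uminus)

lemma limit_alg_sel [simp]:
  "carrier limit_alg = ncpolys {0..}" "mult limit_alg = (*)" "one limit_alg = 1"
  "zero limit_alg = 0" "add limit_alg = (+)"
  "smult limit_alg c h = Poly_Mapping.single 0 c * h" "star limit_alg = ncstar"
  by (simp_all add: limit_alg_def)

lemma limit_alg_star_algebra: "star_algebra limit_alg"
  unfolding limit_alg_def by (rule star_algebra_free_star_alg)

context input_variables
begin

definition increment_poly :: "(nat \<Rightarrow> real) \<Rightarrow> nat \<Rightarrow> real ncpoly" where
  "increment_poly t r = ncvar (t r) - ncvar (t (r - 1))"

lemma increment_poly_carrier: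
  assumes "increasing_times p t" "r \<in> {1..p}"
  shows "increment_poly t r \<in> ncpolys {0..}"
proof -
  have "0 \<le> t r" "0 \<le> t (r - 1)" using assms(2) increasing_times_nonneg[OF assms(1)] by auto
  then show ?thesis unfolding increment_poly_def by (intro ncpolys_diff ncpolys_ncvar) auto
qed

lemma increment_prod_carrier:
  assumes "increasing_times p t" "set rs \<subseteq> {1..p}"
  shows "prod_list (map (increment_poly t) rs) \<in> ncpolys {0..}"
  using assms(2) by (induction rs) (auto intro!: ncpolys_mult increment_poly_carrier[OF assms(1)])

context
  fixes d L C
  assumes d: "d \<in> {1, 2}" and link: "link_function d L" and C: "fibre_bound L C"
    and lims: "all_word_limits_exist L"
begin

text \<open>\<open>all_word_limits_exist\<close> speaks of nonempty monomials; for the empty one the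
  only indexed word is empty and has density 1.\<close>

lemma density_convergent:
  assumes "set rs \<subseteq> {1..p}" "v \<in> indexed_pair_words rs"
  shows "convergent (walk_density L (drop_indices v))"
proof (cases "rs = []")
  case True
  then have "drop_indices v = []" using assms(2) by (simp add: indexed_pair_words_def drop_indices_def)
  then show ?thesis using density_Nil by (auto simp: convergent_def)
next
  case False
  then have "word_limits_exist L rs" using lims assms(1) unfolding all_word_limits_exist_def by blast
  then show ?thesis using assms(2) False by (rule word_limits_existD)
qed

lemma increment_trace_tendsto:
  assumes "increasing_times p t" "set rs \<subseteq> {1..p}"
  shows "increment_trace L t rs \<longlonglongrightarrow> complex_of_real (weight t rs * limit_density_sum L rs)"
  using assms density_convergent[OF assms(2)] by (rule increment_trace_limit[OF d link C])

lemma word_trace_tendsto: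
  assumes t: "increasing_times p t" and t0: "t 0 = 0" and idx: "\<And>s. s \<in> set u \<Longrightarrow> idx s \<le> p \<and> t (idx s) = s"
  shows "word_trace L u \<longlonglongrightarrow>
     (\<Sum>rs\<in>listset (map (\<lambda>s. {1..idx s}) u). complex_of_real (weight t rs * limit_density_sum L rs))"
proof -
  have "set rs \<subseteq> {1..p}" if "rs \<in> listset (map (\<lambda>s. {1..idx s}) u)" for rs
    using listset_set[OF that] idx by fastforce
  then have "(\<lambda>n. \<Sum>rs\<in>listset (map (\<lambda>s. {1..idx s}) u). increment_trace L t rs n) \<longlonglongrightarrow>
     (\<Sum>rs\<in>listset (map (\<lambda>s. {1..idx s}) u). complex_of_real (weight t rs * limit_density_sum L rs))"
    using increment_trace_tendsto[OF t] by (intro tendsto_sum) blast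
  moreover have "word_trace L u = (\<lambda>n. \<Sum>rs\<in>listset (map (\<lambda>s. {1..idx s}) u). increment_trace L t rs n)"
    using idx by (intro ext word_trace_eq[OF d link C, where t = t] t0) simp
  ultimately show ?thesis by simp
qed

lemma word_trace_convergent:
  assumes "set u \<subseteq> {0..}"
  shows "word_trace L u \<longlonglongrightarrow> lim (word_trace L u)"
proof -
  obtain p t idx where g: "increasing_times p t" "t 0 = 0" "\<And>s. s \<in> set u \<Longrightarrow> idx s \<le> p \<and> t (idx s) = s"
    using time_grid[of "set u"] assms by auto
  then have "convergent (word_trace L u)" using word_trace_tendsto[OF g] by (auto simp: convergent_def)
  then show ?thesis by (simp add: convergent_LIMSEQ_iff)
qed

text \<open>The \<open>lim\<close> in the definition is a genuine limit on the whole algebra;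
  linearity of the state and all later evaluations rest on this.\<close>

lemma limit_state_linear_ext:
  assumes "h \<in> ncpolys {0..}"
  shows "(\<lambda>n. mean_trace M n (nc_eval (rmat_alg M n) (scaled_matrix X L n) h)) \<longlonglongrightarrow> limit_state M X L h"
    and "limit_state M X L h = linear_ext (\<lambda>u. lim (word_trace L u)) h"
proof -
  have "(\<lambda>n. mean_trace M n (nc_eval (rmat_alg M n) (scaled_matrix X L n) h)) \<longlonglongrightarrow> linear_ext (\<lambda>u. lim (word_trace L u)) h"
    unfolding mean_trace_eq_linear_ext[OF d link C assms]
    using assms word_trace_convergent by (rule linear_ext_tendsto)
  moreover from this show e: "limit_state M X L h = linear_ext (\<lambda>u. lim (word_trace L u)) h"
    unfolding limit_state_def by (rule limI)
  ultimately show "(\<lambda>n. mean_trace M n (nc_eval (rmat_alg M n) (scaled_matrix X L n) h)) \<longlonglongrightarrow> limit_state M X L h"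
    by simp
qed

text \<open>At time 0 the walks are empty sums, so every word with a factor at time 0 has trace 0
  already at finite size.\<close>

lemma limit_state_zero_time:
  assumes "x \<in> ncpolys {0..}" "y \<in> ncpolys {0..}"
  shows "limit_state M X L (x * ncvar 0 * y) = 0"
proof -
  have z: "word_trace L u n = 0" if "0 \<in> set u" for u n
  proof -
    have "entry (scaled_matrix X L n 0) \<omega> i j = 0" if "i \<in> {1..n}" "j \<in> {1..n}" for \<omega> i j
      using entry_scaled_matrix[OF d link C that] by (simp add: walk_def)
    then have "mat_word n (\<lambda>s. entry (scaled_matrix X L n s) \<omega>) u i j = 0" if "i \<in> {1..n}" "j \<in> {1..n}" for \<omega> i j
      using \<open>0 \<in> set u\<close> that by (induction u arbitrary: i) (auto intro!: sum.neutral)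
    then show ?thesis unfolding word_trace_def[OF d link C]
      by (subst mean_trace_alg_prod) (auto simp: scaled_matrix_carrier[OF d link C])
  qed
  have *: "word_trace L u = (\<lambda>n. 0)" if "0 \<in> set u" for u
    using z[OF that] by (simp add: fun_eq_iff)
  have lim0: "lim (word_trace L (u @ 0 # v)) = 0" for u v
    by (subst *) auto
  have e: "x * ncvar 0 = (\<Sum>u\<in>Poly_Mapping.keys x. Poly_Mapping.single (u + NCMono [0]) (Poly_Mapping.lookup x u))"
    by (subst poly_mapping_expand[of x]) (simp add: ncvar_def sum_distrib_right mult_single)
  have "x * ncvar 0 * y = (\<Sum>u\<in>Poly_Mapping.keys x. \<Sum>v\<in>Poly_Mapping.keys y.
      Poly_Mapping.single (u + NCMono [0] + v) (Poly_Mapping.lookup x u * Poly_Mapping.lookup y v))"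
    unfolding e by (subst poly_mapping_expand[of y]) (simp add: sum_product mult_single)
  then have "linear_ext (\<lambda>u. lim (word_trace L u)) (x * ncvar 0 * y) = 0"
    by (simp add: linear_ext_sum linear_ext_single lim0)
  moreover have "x * ncvar 0 * y \<in> ncpolys {0..}"
    using assms by (intro ncpolys_mult ncpolys_ncvar) auto
  ultimately show ?thesis by (simp add: limit_state_linear_ext(2))
qed

lemma limit_state_increments:
  assumes t: "increasing_times p t" and rs: "set rs \<subseteq> {1..p}"
  shows "limit_state M X L (prod_list (map (increment_poly t) rs)) =
     complex_of_real (weight t rs * limit_density_sum L rs)"
proof -
  let ?h = "prod_list (map (increment_poly t) rs)"
  have h: "?h \<in> ncpolys {0..}" using t rs by (rule increment_prod_carrier)
  have "mean_trace M n (nc_eval (rmat_alg M n) (scaled_matrix X L n) ?h) = increment_trace L t rs n" for n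
  proof -
    have "mat_poly n (\<lambda>x. entry (scaled_matrix X L n x) \<omega>) ?h i i =
        mat_word n (\<lambda>r. entry (increment_matrix X L t n r) \<omega>) rs i i" if "i \<in> {1..n}" for \<omega> i
      unfolding mat_poly_prod_list[OF that]
      using that by (intro mat_word_cong)
        (auto simp: increment_poly_def mat_poly_diff mat_poly_ncvar entry_increment_matrix[OF d link C])
    then show ?thesis unfolding increment_trace_def[OF d link C]
      by (subst mean_trace_nc_eval(2)[OF h], simp add: scaled_matrix_carrier[OF d link C],
          subst mean_trace_alg_prod) (auto simp: increment_matrix_carrier[OF d link C])
  qed
  then have "(\<lambda>n. mean_trace M n (nc_eval (rmat_alg M n) (scaled_matrix X L n) ?h)) \<longlonglongrightarrow>
      complex_of_real (weight t rs * limit_density_sum L rs)"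
    using increment_trace_tendsto[OF t rs] by simp
  then show ?thesis using limit_state_linear_ext(1)[OF h] LIMSEQ_unique by blast
qed

lemma limit_state_words:
  assumes t: "increasing_times p t" and t0: "t 0 = 0" and idx: "\<And>s. s \<in> set u \<Longrightarrow> idx s \<le> p \<and> t (idx s) = s"
    and u: "set u \<subseteq> {0..}"
  shows "limit_state M X L (prod_list (map ncvar u)) =
     (\<Sum>rs\<in>listset (map (\<lambda>s. {1..idx s}) u). complex_of_real (weight t rs * limit_density_sum L rs))"
proof -
  have "prod_list (map ncvar u) \<in> ncpolys {0..}"
    unfolding prod_list_ncvar using u by (intro ncpolys_single) auto
  then have "limit_state M X L (prod_list (map ncvar u)) = lim (word_trace L u)"
    by (simp add: limit_state_linear_ext(2)) (simp add: prod_list_ncvar linear_ext_single)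
  also have "\<dots> = (\<Sum>rs\<in>listset (map (\<lambda>s. {1..idx s}) u). complex_of_real (weight t rs * limit_density_sum L rs))"
    using word_trace_tendsto[OF t t0 idx] by (rule limI)
  finally show ?thesis .
qed

text \<open>The matrices are real and symmetric, so evaluating \<open>ncstar x * x\<close> gives on
  the diagonal sums of squared moduli of the entries of \<open>x\<close>. Positivity passes to the
  limit.\<close>

lemma star_prob_space_limit: 
  assumes sym: "symmetric_link L"
  shows "star_prob_space limit_alg (limit_state M X L)"
proof -
  interpret star_algebra limit_alg by (rule limit_alg_star_algebra)
  show ?thesis
  proof
    fix x y c assume x: "x \<in> carrier limit_alg"
    show "limit_state M X L (c \<odot>\<^bsub>limit_alg\<^esub> x) = c * limit_state M X L x"
      using x ncpolys_smult[of x "{0..}" c] by (simp add: limit_state_linear_ext(2) linear_ext_smult)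
    assume y: "y \<in> carrier limit_alg"
    show "limit_state M X L (x \<oplus>\<^bsub>limit_alg\<^esub> y) = limit_state M X L x + limit_state M X L y"
      using x y ncpolys_add[of x "{0..}" y] by (simp add: limit_state_linear_ext(2) linear_ext_add)
  next
    have "(\<lambda>n. mean_trace M n (nc_eval (rmat_alg M n) (scaled_matrix X L n) 1)) \<longlonglongrightarrow> 1"
    proof (rule tendsto_eventually)
      \<comment> \<open>For \<open>n = 0\<close> the division by 0 makes the mean trace 0, so the
        value 1 holds only eventually.\<close>
      show "\<forall>\<^sub>F n in sequentially. mean_trace M n (nc_eval (rmat_alg M n) (scaled_matrix X L n) 1) = 1"
        using eventually_gt_at_top[of 0]
      proof eventually_elim
        case (elim n)
        then show ?case unfolding mean_trace_eq_linear_ext[OF d link C ncpolys_one] linear_ext_one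
            word_trace_def[OF d link C]
          by (subst mean_trace_alg_prod) (auto simp: prob_space)
      qed
    qed
    then show "limit_state M X L \<one>\<^bsub>limit_alg\<^esub> = 1"
      using limit_state_linear_ext(1)[OF ncpolys_one] LIMSEQ_unique by auto
  next
    fix x assume x: "x \<in> carrier limit_alg"
    then have h: "ncstar x * x \<in> ncpolys {0..}" by (simp add: ncpolys_mult ncpolys_ncstar)
    define q where "q n = (\<integral>\<omega>. (\<Sum>i\<in>{1..n}. \<Sum>k\<in>{1..n}.
        (cmod (mat_poly n (\<lambda>x. entry (scaled_matrix X L n x) \<omega>) x k i))\<^sup>2) \<partial>M) / real n" for n
    have "mean_trace M n (nc_eval (rmat_alg M n) (scaled_matrix X L n) (ncstar x * x)) = complex_of_real (q n)" for n
    proof -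
      have "mat_poly n (\<lambda>x. entry (scaled_matrix X L n x) \<omega>) (ncstar x) i k =
          cnj (mat_poly n (\<lambda>x. entry (scaled_matrix X L n x) \<omega>) x k i)" if ik: "i \<in> {1..n}" "k \<in> {1..n}" for \<omega> i k
      proof -
        let ?a = "\<lambda>s i j. walk X n (L n i j) s \<omega> / real n"
        have c: "mat_poly n (\<lambda>x. entry (scaled_matrix X L n x) \<omega>) h i j = mat_poly n (\<lambda>s i j. complex_of_real (?a s i j)) h i j"
          if "i \<in> {1..n}" "j \<in> {1..n}" for h i j
          unfolding mat_poly_def using that entry_scaled_matrix[OF d link C]
          by (intro arg_cong2[where f = linear_ext] ext mat_word_cong) auto
        show ?thesis unfolding c[OF ik] c[OF ik(2,1)]
          using sym x ik by (intro mat_poly_ncstar[where T = "{0..}"]) (auto simp: symmetric_link_def)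
      qed
      then have "mat_poly n (\<lambda>x. entry (scaled_matrix X L n x) \<omega>) (ncstar x * x) i i =
          complex_of_real (\<Sum>k\<in>{1..n}. (cmod (mat_poly n (\<lambda>x. entry (scaled_matrix X L n x) \<omega>) x k i))\<^sup>2)"
        if "i \<in> {1..n}" for \<omega> i
        unfolding mat_poly_mult[OF that] of_real_sum complex_norm_square using that
        by (intro sum.cong refl) (auto simp: mult.commute)
      then have "(\<Sum>i\<in>{1..n}. mat_poly n (\<lambda>x. entry (scaled_matrix X L n x) \<omega>) (ncstar x * x) i i) =
          complex_of_real (\<Sum>i\<in>{1..n}. \<Sum>k\<in>{1..n}. (cmod (mat_poly n (\<lambda>x. entry (scaled_matrix X L n x) \<omega>) x k i))\<^sup>2)" for \<omega>
        by simp
      then show ?thesis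
        by (subst mean_trace_nc_eval(2)[OF h])
          (simp_all add: scaled_matrix_carrier[OF d link C] q_def integral_complex_of_real del: of_real_sum)
    qed
    then have lim: "(\<lambda>n. complex_of_real (q n)) \<longlonglongrightarrow> limit_state M X L (ncstar x * x)"
      using limit_state_linear_ext(1)[OF h] by simp
    let ?z = "limit_state M X L (ncstar x * x)"
    have re: "q \<longlonglongrightarrow> Re ?z" using tendsto_Re[OF lim] by simp
    have "?z = complex_of_real (Re ?z)" using lim tendsto_of_real[OF re] by (rule LIMSEQ_unique)
    then have "?z \<in> \<real>" by (metis Reals_of_real)
    moreover have "0 \<le> q n" for n unfolding q_def by (intro divide_nonneg_nonneg integral_nonneg_AE AE_I2 sum_nonneg) auto
    then have "0 \<le> Re ?z" using re by (intro LIMSEQ_le_const) auto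
    ultimately show "limit_state M X L (star limit_alg x \<otimes>\<^bsub>limit_alg\<^esub> x) \<in> \<real> \<and>
        0 \<le> Re (limit_state M X L (star limit_alg x \<otimes>\<^bsub>limit_alg\<^esub> x))" by simp
  qed
qed

lemma converges_algebraically_limit:
  "converges_algebraically (rmat_alg M) (mean_trace M) (scaled_matrix X L) limit_alg (limit_state M X L) ncvar"
  unfolding converges_algebraically_def
proof (intro allI impI ballI)
  fix q and s :: "nat \<Rightarrow> real" and h assume s: "\<forall>i<q. 0 \<le> s i" and h: "h \<in> ncpolys {..<q}"
  have sT: "\<And>i. i \<in> {..<q} \<Longrightarrow> s i \<in> {0..}" using s by simp
  note e = nc_eval_ncvar[OF h sT, folded limit_alg_def]
  have "mean_trace M n (nc_eval (rmat_alg M n) (\<lambda>i. scaled_matrix X L n (s i)) h) =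
      linear_ext (\<lambda>u. word_trace L (map s u) n) h" for n
    unfolding word_trace_def[OF d link C] map_map comp_def
    by (rule mean_trace_nc_eval(1)[OF h]) (auto simp: scaled_matrix_carrier[OF d link C])
  moreover have "(\<lambda>n. linear_ext (\<lambda>u. word_trace L (map s u) n) h) \<longlonglongrightarrow> linear_ext (\<lambda>u. lim (word_trace L (map s u))) h"
    using h
  proof (rule linear_ext_tendsto)
    fix u assume "set u \<subseteq> {..<q}"
    then have "set (map s u) \<subseteq> {0..}" using sT by auto
    then show "word_trace L (map s u) \<longlonglongrightarrow> lim (word_trace L (map s u))" by (rule word_trace_convergent)
  qed
  ultimately show "(\<lambda>n. mean_trace M n (nc_eval (rmat_alg M n) (\<lambda>i. scaled_matrix X L n (s i)) h)) \<longlonglongrightarrow>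
      limit_state M X L (nc_eval limit_alg (\<lambda>i. ncvar (s i)) h)"
    using trans[OF limit_state_linear_ext(2)[OF e(2)] e(1)] by simp
qed

end

end

section \<open>The full Fock space\<close>

text \<open>\<open>X r\<close> is the sum of the creation and annihilation operators of colour \<open>r\<close>, acting on functions of words.\<close>

definition field_op :: "(nat \<Rightarrow> real) \<Rightarrow> nat \<Rightarrow> (nat list \<Rightarrow> complex) \<Rightarrow> nat list \<Rightarrow> complex" where
  "field_op c r f s = complex_of_real (c r) * (f (r # s) + (if s \<noteq> [] \<and> hd s = r then f (tl s) else 0))"

definition vacuum :: "nat list \<Rightarrow> complex" where
  "vacuum s = of_bool (s = [])"

lemma field_op_add: "field_op c r (\<lambda>s. f s + g s) = (\<lambda>s. field_op c r f s + field_op c r g s)"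
  by (auto simp: field_op_def fun_eq_iff algebra_simps)

lemma field_op_scale: "field_op c r (\<lambda>s. z * f s) = (\<lambda>s. z * field_op c r f s)"
  by (auto simp: field_op_def fun_eq_iff algebra_simps)

text \<open>Evaluated at \<open>s\<close>, the leftmost operator adds or removes a letter at the
  front of \<open>s\<close>, which is the recursion of \<open>fock\<close>.\<close>

lemma field_ops_vacuum:
  "foldr (field_op c) rs vacuum s = complex_of_real (prod_list (map c rs) * real (fock s rs))"
  by (induction rs arbitrary: s) (auto simp: vacuum_def field_op_def algebra_simps)

lemma foldr_field_op_add:
  "foldr (field_op c) rs (\<lambda>s. f s + g s) = (\<lambda>s. foldr (field_op c) rs f s + foldr (field_op c) rs g s)"
  by (induction rs) (simp_all add: field_op_add)

lemma foldr_field_op_scale: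
  "foldr (field_op c) rs (\<lambda>s. z * f s) = (\<lambda>s. z * foldr (field_op c) rs f s)"
  by (induction rs) (simp_all add: field_op_scale)

definition jacobi_op :: "real \<Rightarrow> (nat \<Rightarrow> complex) \<Rightarrow> nat \<Rightarrow> complex" where
  "jacobi_op a h i = complex_of_real a * (h (Suc i) + (if i \<noteq> 0 then h (i - 1) else 0))"

definition strip :: "nat \<Rightarrow> nat list \<Rightarrow> (nat list \<Rightarrow> complex) \<Rightarrow> nat \<Rightarrow> complex" where
  "strip r s f i = f (replicate i r @ s)"

text \<open>Words of the form \<open>r\<^sup>i s\<close>, with \<open>s\<close> not starting with \<open>r\<close>, span a subspace on which \<open>X r\<close> acts as the Jacobi operator.\<close>

definition not_starting :: "nat \<Rightarrow> nat list \<Rightarrow> bool" where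
  "not_starting r s \<longleftrightarrow> s = [] \<or> hd s \<noteq> r"

lemma strip_field_op:
  assumes "not_starting r s"
  shows "strip r s (field_op c r f) = jacobi_op (c r) (strip r s f)"
proof
  fix i
  show "strip r s (field_op c r f) i = jacobi_op (c r) (strip r s f) i"
  proof (cases i)
    case 0
    then show ?thesis using assms by (auto simp: strip_def field_op_def jacobi_op_def not_starting_def)
  next
    case (Suc j)
    then show ?thesis by (simp add: strip_def field_op_def jacobi_op_def)
  qed
qed

text \<open>\<open>F\<close> stands for a polynomial in the field operator of colour
  \<open>r\<close>, and \<open>K\<close> for the same polynomial in the Jacobi operator. Homogeneity
  of \<open>K\<close> is recorded to evaluate it on multiples of the delta at 0.\<close>

definition commuting_pair ::
  "nat \<Rightarrow> ((nat list \<Rightarrow> complex) \<Rightarrow> nat list \<Rightarrow> complex) \<Rightarrow> ((nat \<Rightarrow> complex) \<Rightarrow> nat \<Rightarrow> complex) \<Rightarrow> bool" where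
  "commuting_pair r F K \<longleftrightarrow> (\<forall>s f. not_starting r s \<longrightarrow> strip r s (F f) = K (strip r s f)) \<and>
     (\<forall>z h. K (\<lambda>i. z * h i) = (\<lambda>i. z * K h i))"

lemma commuting_pair_id: "commuting_pair r (\<lambda>f. f) (\<lambda>h. h)"
  by (simp add: commuting_pair_def)

lemma commuting_pair_field_op: "commuting_pair r (field_op c r) (jacobi_op (c r))"
  by (auto simp: commuting_pair_def strip_field_op jacobi_op_def fun_eq_iff algebra_simps)

lemma commuting_pair_add:
  assumes "commuting_pair r F K" "commuting_pair r F' K'"
  shows "commuting_pair r (\<lambda>f s. F f s + F' f s) (\<lambda>h i. K h i + K' h i)"
proof -
  have "strip r s (\<lambda>t. F f t + F' f t) = (\<lambda>i. K (strip r s f) i + K' (strip r s f) i)" if "not_starting r s" for s f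
  proof -
    have "strip r s (\<lambda>t. F f t + F' f t) = (\<lambda>i. strip r s (F f) i + strip r s (F' f) i)"
      by (simp add: strip_def fun_eq_iff)
    then show ?thesis using assms that by (simp add: commuting_pair_def)
  qed
  then show ?thesis using assms by (simp add: commuting_pair_def distrib_left)
qed

lemma commuting_pair_scale:
  assumes "commuting_pair r F K"
  shows "commuting_pair r (\<lambda>f s. z * F f s) (\<lambda>h i. z * K h i)"
proof -
  have "strip r s (\<lambda>t. z * F f t) = (\<lambda>i. z * K (strip r s f) i)" if "not_starting r s" for s f
  proof -
    have "strip r s (\<lambda>t. z * F f t) = (\<lambda>i. z * strip r s (F f) i)" by (simp add: strip_def fun_eq_iff)
    then show ?thesis using assms that by (simp add: commuting_pair_def)
  qed
  then show ?thesis using assms by (simp add: commuting_pair_def mult.left_commute)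
qed

lemma commuting_pair_comp:
  assumes "commuting_pair r F K" "commuting_pair r F' K'"
  shows "commuting_pair r (\<lambda>f. F (F' f)) (\<lambda>h. K (K' h))"
  using assms by (simp add: commuting_pair_def)

text \<open>
  The reason for freeness: a centred polynomial in \<open>X r\<close> puts a letter \<open>r\<close> in front of every word that
  does not start with \<open>r\<close>, so an alternating product of such polynomials never returns to the vacuum.
\<close>

lemma commuting_pair_centred:
  assumes "commuting_pair r F K" and f: "\<And>s. f (r # s) = 0" and "F vacuum [] = 0"
    and s: "not_starting r s"
  shows "F f s = 0"
proof -
  let ?e = "\<lambda>i::nat. of_bool (i = 0) :: complex"
  have "strip r [] vacuum = ?e" by (auto simp: strip_def vacuum_def fun_eq_iff)
  moreover have "not_starting r []" by (simp add: not_starting_def)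
  ultimately have "strip r [] (F vacuum) = K ?e" using assms(1) by (simp add: commuting_pair_def)
  then have "K ?e 0 = F vacuum []" by (auto simp: strip_def fun_eq_iff dest: spec[of _ 0])
  then have K0: "K ?e 0 = 0" using assms(3) by simp
  \<comment> \<open>As \<open>f\<close> vanishes on words that start with \<open>r\<close>, its
    strip lives at height 0 only; \<open>K\<close> sends the delta there to a sequence whose value
    at 0 is the vacuum coefficient of \<open>F vacuum\<close>, namely 0.\<close>
  have "strip r s f = (\<lambda>i. f s * ?e i)"
  proof
    fix i show "strip r s f i = f s * ?e i" by (cases i) (auto simp: strip_def f)
  qed
  then have "strip r s (F f) = (\<lambda>i. f s * K ?e i)" using assms(1) s by (simp add: commuting_pair_def)
  then have "strip r s (F f) 0 = 0" using K0 by simp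
  then show ?thesis by (simp add: strip_def)
qed

section \<open>The semicircle distribution\<close>

text \<open>Orthogonality of \<open>sin x\<close> to the higher sines, with a primitive from the
  product-to-sum formula.\<close>

lemma integral_cos_sin:
  assumes "h \<ge> (1::nat)"
  shows "((\<lambda>x. 2 / pi * (sin (real (h + 1) * x) * sin x)) has_integral 0) {0..pi}"
proof -
  let ?F = "\<lambda>x. 1 / pi * (sin (real h * x) / real h - sin (real (h + 2) * x) / real (h + 2))"
  have "((\<lambda>x. 2 / pi * (sin (real (h + 1) * x) * sin x)) has_integral (?F pi - ?F 0)) {0..pi}"
  proof (rule fundamental_theorem_of_calculus)
    fix x :: real assume "x \<in> {0..pi}"
    have c: "cos (real h * x) - cos (real (h + 2) * x) = 2 * (sin (real (h + 1) * x) * sin x)"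
    proof -
      have "real h * x = real (h + 1) * x - x" "real (h + 2) * x = real (h + 1) * x + x"
        by (simp_all add: algebra_simps)
      then show ?thesis by (simp only: cos_diff cos_add)
    qed
    have "((\<lambda>x. sin (a * x) / a) has_real_derivative cos (a * x)) (at x within {0..pi})" if "a \<noteq> 0" for a
      using that by (auto intro!: derivative_eq_intros)
    from this[of "real h"] this[of "real (h + 2)"]
    have "(?F has_real_derivative (1 / pi * (cos (real h * x) - cos (real (h + 2) * x)))) (at x within {0..pi})"
      using assms by (intro DERIV_cmult DERIV_diff) auto
    then show "(?F has_vector_derivative (2 / pi * (sin (real (h + 1) * x) * sin x))) (at x within {0..pi})"
      unfolding c has_real_derivative_iff_has_vector_derivative by (simp add: mult.assoc)
  qed simp
  moreover have "?F pi - ?F 0 = 0"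
    using sin_npi[of h] sin_npi[of "h + 2"] by (simp add: mult.commute)
  ultimately show ?thesis by simp
qed

text \<open>With \<open>y = 2 * cos x\<close> this is the integral, against the semicircle law of
  variance 1, of \<open>y ^ k\<close> times the Chebyshev polynomial of the second kind of degree
  \<open>h\<close> at \<open>y / 2\<close>.\<close>

definition chebyshev_moment :: "nat \<Rightarrow> nat \<Rightarrow> real" where
  "chebyshev_moment h k = integral {0..pi} (\<lambda>x. 2 / pi * (sin (real (h + 1) * x) * sin x * (2 * cos x) ^ k))"

lemma chebyshev_integrable: "(\<lambda>x. 2 / pi * (sin (real h * x) * sin x * (2 * cos x) ^ k)) integrable_on {0..pi}"
  by (intro integrable_continuous_real continuous_intros)

text \<open>The Chebyshev polynomials \<open>sin ((h + 1) x) / sin x\<close> turn multiplication by \<open>2 cos x\<close> into the Jacobi operator.\<close>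

lemma chebyshev_moment_Suc:
  "chebyshev_moment h (Suc k) = chebyshev_moment (Suc h) k + (if h = 0 then 0 else chebyshev_moment (h - 1) k)"
proof -
  have e: "2 / pi * (sin (real (h + 1) * x) * sin x * (2 * cos x) ^ Suc k) =
      2 / pi * (sin (real (h + 2) * x) * sin x * (2 * cos x) ^ k) + 2 / pi * (sin (real h * x) * sin x * (2 * cos x) ^ k)" for x
  proof -
    have "real h * x = real (h + 1) * x - x" "real (h + 2) * x = real (h + 1) * x + x"
      by (simp_all add: algebra_simps)
    then have "sin (real (h + 2) * x) + sin (real h * x) = sin (real (h + 1) * x) * (2 * cos x)"
      by (simp only: sin_diff sin_add)
    then have "sin (real (h + 1) * x) * sin x * (2 * cos x) ^ Suc k =
       (sin (real (h + 2) * x) + sin (real h * x)) * sin x * (2 * cos x) ^ k" by simp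
    then show ?thesis by (simp add: algebra_simps)
  qed
  have "chebyshev_moment h (Suc k) = chebyshev_moment (Suc h) k + integral {0..pi} (\<lambda>x. 2 / pi * (sin (real h * x) * sin x * (2 * cos x) ^ k))"
    unfolding chebyshev_moment_def e using chebyshev_integrable[of "h + 2" k] chebyshev_integrable[of h k]
    by (simp add: integral_add)
  then show ?thesis by (cases h) (simp_all add: chebyshev_moment_def)
qed

lemma chebyshev_moment_0: "chebyshev_moment h 0 = of_bool (h = 0)"
proof (cases "h = 0")
  case True
  have "((\<lambda>x. 2 / pi * (sin x * sin x)) has_integral ((pi - sin pi * cos pi) / pi - (0 - sin 0 * cos 0) / pi)) {0..pi}"
  proof (rule fundamental_theorem_of_calculus)
    fix x :: real assume "x \<in> {0..pi}"
    have "1 - (cos x * cos x - sin x * sin x) = 2 * (sin x * sin x)"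
      using sin_cos_squared_add[of x] by (simp add: power2_eq_square)
    moreover have "((\<lambda>x. (x - sin x * cos x) / pi) has_real_derivative ((1 - (cos x * cos x - sin x * sin x)) / pi)) (at x within {0..pi})"
      by (auto intro!: derivative_eq_intros)
    ultimately show "((\<lambda>x. (x - sin x * cos x) / pi) has_vector_derivative (2 / pi * (sin x * sin x))) (at x within {0..pi})"
      unfolding has_real_derivative_iff_has_vector_derivative by (simp only: times_divide_eq_left)
  qed simp
  then have "((\<lambda>x. 2 / pi * (sin (real (0 + 1) * x) * sin x * (2 * cos x) ^ 0)) has_integral 1) {0..pi}" by simp
  then have "chebyshev_moment 0 0 = 1" unfolding chebyshev_moment_def by (rule integral_unique)
  then show ?thesis using True by simp
next
  case False
  then show ?thesis using integral_unique[OF integral_cos_sin[of h]] by (simp add: chebyshev_moment_def)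
qed

text \<open>Both sides obey the same recursion in \<open>k\<close>, that of the powers of the free
  Jacobi matrix, and agree at \<open>k = 0\<close>; with one colour a word is its length.\<close>

lemma chebyshev_moment_fock: "chebyshev_moment h k = real (fock (replicate h r) (replicate k r))"
proof (induction k arbitrary: h)
  case 0
  then show ?case by (simp add: chebyshev_moment_0)
next
  case (Suc k)
  then show ?case by (cases h) (simp_all add: chebyshev_moment_Suc)
qed

lemma semicircle_moment:
  assumes t: "t > 0"
  shows "((\<lambda>x. sqrt (4 * t - x\<^sup>2) / (2 * pi * t) * x ^ k) has_integral
     sqrt t ^ k * real (fock [] (replicate k r))) {- 2 * sqrt t..2 * sqrt t}"
proof -
  \<comment> \<open>The minus sign makes the substitution increasing, so the derivative factor
    \<open>2 * sqrt t * sin x\<close> is nonnegative and is itself the square root in the density.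
    The resulting \<open>(-1) ^ k\<close> is harmless, as odd moments vanish.\<close>
  define g where "g = (\<lambda>x. - 2 * sqrt t * cos x)"
  define f where "f = (\<lambda>x. sqrt (4 * t - x\<^sup>2) / (2 * pi * t) * x ^ k)"
  have "((\<lambda>x. (2 * sqrt t * sin x) *\<^sub>R f (g x)) has_integral (integral {g 0..g pi} f - integral {g pi..g 0} f)) {0..pi}"
  proof (rule has_integral_substitution_general[of "{}" _ _ _ "- 2 * sqrt t" "2 * sqrt t"])
    show "g ` {0..pi} \<subseteq> {- 2 * sqrt t..2 * sqrt t}"
    proof
      fix y assume "y \<in> g ` {0..pi}"
      then obtain x where x: "y = - 2 * sqrt t * cos x" by (auto simp: g_def)
      have "\<bar>y\<bar> \<le> 2 * sqrt t * 1" unfolding x abs_mult using t by (intro mult_mono) auto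
      then show "y \<in> {- 2 * sqrt t..2 * sqrt t}" by auto
    qed
    show "continuous_on {- 2 * sqrt t..2 * sqrt t} f"
      unfolding f_def using t by (intro continuous_intros) auto
    show "continuous_on {0..pi} g" unfolding g_def by (intro continuous_intros)
    show "(g has_real_derivative 2 * sqrt t * sin x) (at x within {0..pi})" if "x \<in> {0..pi} - {}" for x
      unfolding g_def by (auto intro!: derivative_eq_intros)
  qed auto
  moreover have "g 0 = - 2 * sqrt t" "g pi = 2 * sqrt t" by (simp_all add: g_def)
  moreover have "integral {2 * sqrt t..- 2 * sqrt t} f = 0" using t by simp
  ultimately have sub: "((\<lambda>x. (2 * sqrt t * sin x) *\<^sub>R f (g x)) has_integral (integral {- 2 * sqrt t..2 * sqrt t} f)) {0..pi}"
    by simp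
  have e: "(2 * sqrt t * sin x) *\<^sub>R f (g x) = (- sqrt t) ^ k * (2 / pi * (sin (real (0 + 1) * x) * sin x * (2 * cos x) ^ k))"
    if x: "x \<in> {0..pi}" for x
  proof -
    have "4 * t - (g x)\<^sup>2 = (2 * sqrt t * sin x)\<^sup>2"
      using t by (simp add: g_def power_mult_distrib sin_squared_eq algebra_simps)
    moreover have "0 \<le> 2 * sqrt t * sin x" using x t sin_ge_zero by simp
    ultimately have "sqrt (4 * t - (g x)\<^sup>2) = 2 * sqrt t * sin x" by (simp add: real_sqrt_abs abs_of_nonneg)
    then have "(2 * sqrt t * sin x) *\<^sub>R f (g x) = (2 * sqrt t * sin x)\<^sup>2 / (2 * pi * t) * g x ^ k"
      by (simp add: f_def power2_eq_square)
    also have "(2 * sqrt t * sin x)\<^sup>2 / (2 * pi * t) = 2 / pi * (sin x * sin x)"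
      using t by (simp add: power_mult_distrib power2_eq_square[of "sin x"])
    also have "g x ^ k = (- sqrt t) ^ k * (2 * cos x) ^ k"
      unfolding power_mult_distrib[symmetric] by (simp add: g_def mult_ac)
    finally show ?thesis by (simp add: mult_ac)
  qed
  have "((\<lambda>x. (- sqrt t) ^ k * (2 / pi * (sin (real (0 + 1) * x) * sin x * (2 * cos x) ^ k))) has_integral
      ((- sqrt t) ^ k * chebyshev_moment 0 k)) {0..pi}"
    unfolding chebyshev_moment_def
    by (intro has_integral_mult_right integrable_integral chebyshev_integrable)
  then have "((\<lambda>x. (2 * sqrt t * sin x) *\<^sub>R f (g x)) has_integral ((- sqrt t) ^ k * chebyshev_moment 0 k)) {0..pi}"
    by (rule has_integral_eq[rotated]) (simp only: e)
  with sub have i: "integral {- 2 * sqrt t..2 * sqrt t} f = (- sqrt t) ^ k * chebyshev_moment 0 k"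
    by (rule has_integral_unique)
  have odd: "fock [] (replicate k r) = 0" if "odd k"
  proof -
    \<comment> \<open>Every letter changes the height of the stack by one, so height plus remaining
      length keeps its parity.\<close>
    have "fock (replicate h r) (replicate k r) = 0" if "odd (h + k)" for h k
      using that
    proof (induction k arbitrary: h)
      case (Suc k)
      show ?case
      proof (cases h)
        case 0
        then show ?thesis using Suc.IH[of 1] Suc.prems by simp
      next
        case (Suc j)
        then show ?thesis using Suc.IH[of "Suc h"] Suc.IH[of j] Suc.prems by simp
      qed
    qed (auto intro: odd_pos)
    from this[of 0 k] that show ?thesis by simp
  qed
  have "f integrable_on {- 2 * sqrt t..2 * sqrt t}"
    unfolding f_def using t by (intro integrable_continuous_real continuous_intros) auto
  then have "(f has_integral ((- sqrt t) ^ k * chebyshev_moment 0 k)) {- 2 * sqrt t..2 * sqrt t}"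
    unfolding i[symmetric] by (rule integrable_integral)
  moreover have "(- sqrt t) ^ k * chebyshev_moment 0 k = sqrt t ^ k * real (fock [] (replicate k r))"
    using odd chebyshev_moment_fock[of 0 k r] by (cases "even k") auto
  ultimately show ?thesis by (simp add: f_def)
qed

section \<open>The two examples\<close>

lemma gen_alg_subset:
  assumes "S \<subseteq> ncpolys {0..}"
  shows "gen_alg limit_alg S \<subseteq> ncpolys {0..}"
proof
  fix x assume "x \<in> gen_alg limit_alg S"
  then show "x \<in> ncpolys {0..}"
    using assms by induction (auto intro: ncpolys_add ncpolys_mult ncpolys_smult)
qed

lemma wigner_limit_density_sum:
  "limit_density_sum wigner_link rs = real (fock [] rs)"
proof -
  have "limit_density_sum wigner_link rs = (\<Sum>v\<in>indexed_pair_words rs. of_bool (reduces [] (drop_indices v)))"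
    unfolding limit_density_sum_def
  proof (intro sum.cong refl)
    fix v assume "v \<in> indexed_pair_words rs"
    then have "walk_density wigner_link (drop_indices v) \<longlonglongrightarrow> of_bool (reduces [] (drop_indices v))"
      using wigner_density[of "[]" "drop_indices v"] indexed_pair_words_drop(1) by simp
    then show "lim (walk_density wigner_link (drop_indices v)) = of_bool (reduces [] (drop_indices v))" by (rule limI)
  qed
  also have "\<dots> = real (card {v \<in> indexed_pair_words rs. reduces [] (drop_indices v)})"
    using finite_indexed_pair_words by (simp add: sum.If_cases of_bool_def Int_def)
  finally show ?thesis by (simp add: card_indexed_pair_words_reducing)
qed

lemma all_word_limits_existI:
  assumes "\<And>w :: nat list. paired w \<Longrightarrow> convergent (walk_density L w)"
  shows "all_word_limits_exist L"
  unfolding all_word_limits_exist_def word_limits_exist_def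
proof (intro allI impI ballI)
  fix rs :: "nat list" and m v assume "length rs = 2 * m" and v: "v \<in> indexed_pair_words rs"
  then show "convergent (word_density L m (drop_indices v))"
    using indexed_pair_words_drop[OF v] assms by (simp add: word_density_eq_density)
qed

lemma all_word_limits_exist_wigner: "all_word_limits_exist wigner_link"
  using wigner_density[of "[]"] by (intro all_word_limits_existI) (auto simp: convergent_def)

lemma all_word_limits_exist_circulant: "all_word_limits_exist circulant_link"
  using circulant_density by (intro all_word_limits_existI) (auto simp: convergent_def)

section \<open>Freeness and semicircular increments for the max-min link\<close>

context input_variables
begin

abbreviation wigner_state :: "real ncpoly \<Rightarrow> complex" where
  "wigner_state \<equiv> limit_state M X wigner_link"

lemma wigner_facts:
  obtains C where "(2::nat) \<in> {1, 2}" "link_function 2 wigner_link" "fibre_bound wigner_link C"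
    "all_word_limits_exist wigner_link"
  using wigner_fibre_bound link_function_wigner all_word_limits_exist_wigner by blast

lemma star_prob_space_wigner: "star_prob_space limit_alg wigner_state"
  by (rule wigner_facts) (rule star_prob_space_limit[OF _ _ _ _ symmetric_wigner])

lemma wigner_state_add: "x \<in> ncpolys {0..} \<Longrightarrow> y \<in> ncpolys {0..} \<Longrightarrow> wigner_state (x + y) = wigner_state x + wigner_state y"
  using star_prob_space.state_add[OF star_prob_space_wigner, of x y] by simp

lemma wigner_state_smult: "x \<in> ncpolys {0..} \<Longrightarrow> wigner_state (Poly_Mapping.single 0 c * x) = c * wigner_state x"
  using star_prob_space.state_smult[OF star_prob_space_wigner, of x c] by simp

context
  fixes p t
  assumes t: "increasing_times p t"
begin

definition amplitude :: "nat \<Rightarrow> real" where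
  "amplitude r = sqrt (t r - t (r - 1))"

lemma wigner_state_increments:
  assumes "set rs \<subseteq> {1..p}"
  shows "wigner_state (prod_list (map (increment_poly t) rs)) = foldr (field_op amplitude) rs vacuum []"
proof -
  obtain C where C: "(2::nat) \<in> {1, 2}" "link_function 2 wigner_link" "fibre_bound wigner_link C"
    "all_word_limits_exist wigner_link" by (rule wigner_facts)
  show ?thesis
    unfolding limit_state_increments[OF C t assms] wigner_limit_density_sum field_ops_vacuum
    by (simp add: weight_def amplitude_def[abs_def])
qed

text \<open>\<open>represents y f\<close>: the vector \<open>f\<close> is the image of the vacuum under the operator that corresponds to \<open>y\<close>.\<close>

inductive represents :: "real ncpoly \<Rightarrow> (nat list \<Rightarrow> complex) \<Rightarrow> bool" where
  one: "represents 1 vacuum"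
| mult: "represents y f \<Longrightarrow> r \<in> {1..p} \<Longrightarrow> represents (increment_poly t r * y) (field_op amplitude r f)"
| add: "represents y f \<Longrightarrow> represents z g \<Longrightarrow> represents (y + z) (\<lambda>s. f s + g s)"
| smult: "represents y f \<Longrightarrow> represents (Poly_Mapping.single 0 c * y) (\<lambda>s. c * f s)"

lemma represents_carrier: "represents y f \<Longrightarrow> y \<in> ncpolys {0..}"
  by (induction rule: represents.induct)
    (simp_all add: ncpolys_mult ncpolys_add ncpolys_smult increment_poly_carrier[OF t])

lemma single_zero_commute: "x * Poly_Mapping.single 0 c = Poly_Mapping.single 0 c * (x :: 'v ncpoly)"
  using star_algebra.smult_mult_right[OF star_algebra_free_star_alg[of UNIV], of x 1 c]
  by (simp add: ncpolys_def)

text \<open>The prefix \<open>rs\<close> is what makes the induction work: in the multiplication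
  case the new increment is moved to the end of the prefix.\<close>

lemma represents_state_prefix:
  "represents y f \<Longrightarrow> set rs \<subseteq> {1..p} \<Longrightarrow>
     wigner_state (prod_list (map (increment_poly t) rs) * y) = foldr (field_op amplitude) rs f []"
proof (induction arbitrary: rs rule: represents.induct)
  case one
  then show ?case using wigner_state_increments by simp
next
  case (mult y f r)
  then show ?case using mult.IH[of "rs @ [r]"] by (simp add: mult.assoc)
next
  case (add y f z g)
  have "prod_list (map (increment_poly t) rs) * y \<in> ncpolys {0..}" "prod_list (map (increment_poly t) rs) * z \<in> ncpolys {0..}"
    using add represents_carrier increment_prod_carrier[OF t] by (auto intro!: ncpolys_mult)
  then show ?case using add by (simp add: distrib_left wigner_state_add foldr_field_op_add)
next
  case (smult y f c)
  have "prod_list (map (increment_poly t) rs) * y \<in> ncpolys {0..}"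
    using smult represents_carrier increment_prod_carrier[OF t] by (auto intro!: ncpolys_mult)
  moreover have "prod_list (map (increment_poly t) rs) * (Poly_Mapping.single 0 c * y) =
      Poly_Mapping.single 0 c * (prod_list (map (increment_poly t) rs) * y)"
    by (simp only: mult.assoc[symmetric] single_zero_commute)
  ultimately show ?case using smult by (simp add: wigner_state_smult foldr_field_op_scale)
qed

lemma represents_state: "represents y f \<Longrightarrow> wigner_state y = f []"
  using represents_state_prefix[of y f "[]"] by simp

text \<open>Left multiplication by an element of the algebra of one increment acts on representing
  vectors as a polynomial in a single field operator; the induction builds \<open>F\<close> and
  \<open>K\<close> side by side.\<close>

lemma gen_alg_operator:
  assumes r: "r \<in> {1..p}" and "x \<in> gen_alg limit_alg {increment_poly t r}"
  shows "\<exists>F K. commuting_pair r F K \<and> (\<forall>y f. represents y f \<longrightarrow> represents (x * y) (F f))"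
  using assms(2)
proof induction
  case one
  then show ?case using commuting_pair_id by (intro exI[of _ "\<lambda>f. f"] exI[of _ "\<lambda>h. h"]) simp
next
  case (incl x)
  then show ?case using commuting_pair_field_op[of r amplitude] represents.mult r by blast
next
  case (add x y)
  then obtain F K F' K' where "commuting_pair r F K" "\<forall>z f. represents z f \<longrightarrow> represents (x * z) (F f)"
    "commuting_pair r F' K'" "\<forall>z f. represents z f \<longrightarrow> represents (y * z) (F' f)" by blast
  then show ?case using commuting_pair_add[of r F K F' K'] represents.add
    by (intro exI[of _ "\<lambda>f s. F f s + F' f s"] exI[of _ "\<lambda>h i. K h i + K' h i"]) (simp add: distrib_right)
next
  case (mult x y)
  then obtain F K F' K' where "commuting_pair r F K" "\<forall>z f. represents z f \<longrightarrow> represents (x * z) (F f)"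
    "commuting_pair r F' K'" "\<forall>z f. represents z f \<longrightarrow> represents (y * z) (F' f)" by blast
  then show ?case using commuting_pair_comp[of r F K F' K']
    by (intro exI[of _ "\<lambda>f. F (F' f)"] exI[of _ "\<lambda>h. K (K' h)"]) (simp add: mult.assoc)
next
  case (smult x c)
  then obtain F K where "commuting_pair r F K" "\<forall>z f. represents z f \<longrightarrow> represents (x * z) (F f)" by blast
  then show ?case using commuting_pair_scale[of r F K c] represents.smult
    by (intro exI[of _ "\<lambda>f s. c * F f s"] exI[of _ "\<lambda>h i. c * K h i"]) (simp add: mult.assoc)
qed

text \<open>The product is built from the right. The vector of a partial product vanishes on words
  that do not start with the colour of its leftmost factor; as the next colour differs, it vanishes
  on the words that start with that colour. At the end the empty word gives 0.\<close>

lemma increments_free: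
  "freely_independent limit_alg wigner_state {1..p} (\<lambda>r. gen_alg limit_alg {increment_poly t r})"
  unfolding freely_independent_def
proof (intro allI impI)
  fix k :: nat and \<iota> :: "nat \<Rightarrow> nat" and x
  assume k: "1 \<le> k" and h: "(\<forall>i<k. \<iota> i \<in> {1..p} \<and> x i \<in> gen_alg limit_alg {increment_poly t (\<iota> i)} \<and> wigner_state (x i) = 0) \<and>
    (\<forall>i. Suc i < k \<longrightarrow> \<iota> i \<noteq> \<iota> (Suc i))"
  have "\<exists>f. represents (prod_list (map x [i..<k])) f \<and> (\<forall>s. not_starting (\<iota> i) s \<longrightarrow> f s = 0)" if "i < k" for i
    using that
  proof (induction "k - i" arbitrary: i)
    case (Suc j)
    have i: "\<iota> i \<in> {1..p}" "x i \<in> gen_alg limit_alg {increment_poly t (\<iota> i)}" "wigner_state (x i) = 0"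
      using h Suc.prems by auto
    obtain F K where F: "commuting_pair (\<iota> i) F K" "\<And>y f. represents y f \<Longrightarrow> represents (x i * y) (F f)"
      using gen_alg_operator[OF i(1,2)] by blast
    \<comment> \<open>Applied to the unit, the representation turns the centring of
      \<open>x i\<close> into a vanishing vacuum coefficient.\<close>
    have "represents (x i * 1) (F vacuum)" by (intro F(2) represents.one)
    then have F0: "F vacuum [] = 0" using represents_state i(3) by fastforce
    have "\<exists>f. represents (prod_list (map x [Suc i..<k])) f \<and> (\<forall>s. f (\<iota> i # s) = 0)"
    proof (cases "Suc i < k")
      case True
      have "j = k - Suc i" using Suc.hyps(2) by simp
      from Suc.hyps(1)[OF this True] obtain f where "represents (prod_list (map x [Suc i..<k])) f"
        "\<And>s. not_starting (\<iota> (Suc i)) s \<Longrightarrow> f s = 0" by blast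
      moreover have "\<iota> i \<noteq> \<iota> (Suc i)" using h True by blast
      ultimately show ?thesis by (intro exI[of _ f]) (auto simp: not_starting_def)
    next
      case False
      then show ?thesis using represents.one by (intro exI[of _ vacuum]) (simp add: vacuum_def)
    qed
    then obtain f where f: "represents (prod_list (map x [Suc i..<k])) f" "\<And>s. f (\<iota> i # s) = 0" by blast
    have "[i..<k] = i # [Suc i..<k]" using Suc.prems by (rule upt_conv_Cons)
    then have "represents (prod_list (map x [i..<k])) (F f)" using F(2)[OF f(1)] by simp
    moreover have "F f s = 0" if "not_starting (\<iota> i) s" for s
      using F(1) f(2) F0 that by (rule commuting_pair_centred)
    ultimately show ?case by blast
  qed simp
  from this[of 0] k obtain f where "represents (prod_list (map x [0..<k])) f" "f [] = 0"
    by (auto simp: not_starting_def)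
  then show "wigner_state (alg_prod limit_alg (map x [0..<k])) = 0"
    unfolding limit_alg_def alg_prod_free_star_alg by (simp add: represents_state)
qed

end

end

lemma freely_independent_cong:
  assumes "\<And>i. i \<in> I \<Longrightarrow> \<B> i = \<B>' i"
  shows "freely_independent A \<tau> I \<B> \<longleftrightarrow> freely_independent A \<tau> I \<B>'"
proof -
  have "r \<in> I \<and> y \<in> \<B> r \<and> \<tau> y = 0 \<longleftrightarrow> r \<in> I \<and> y \<in> \<B>' r \<and> \<tau> y = 0" for r y
    using assms by blast
  then show ?thesis unfolding freely_independent_def by (simp only:)
qed

lemma semicircle_moments:
  assumes "t > 0"
  shows "integrable (semicircle t) (\<lambda>u. u ^ k)"
    and "(\<integral>u. u ^ k \<partial>semicircle t) = sqrt t ^ k * real (fock [] (replicate k 1))"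
proof -
  let ?S = "{- 2 * sqrt t..2 * sqrt t}"
  define g where "g x = indicator ?S x * sqrt (4 * t - x\<^sup>2) / (2 * pi * t)" for x
  have sc: "semicircle t = density lborel (\<lambda>x. ennreal (g x))"
    using assms by (simp add: semicircle_def g_def)
  have nonneg: "0 \<le> g x" for x
  proof (cases "x \<in> ?S")
    case True
    then have "\<bar>x\<bar> \<le> 2 * sqrt t" by auto
    then have "\<bar>x\<bar>\<^sup>2 \<le> (2 * sqrt t)\<^sup>2" by (intro power_mono) auto
    then have "x\<^sup>2 \<le> 4 * t" using assms by (simp add: power_mult_distrib)
    then show ?thesis using assms by (simp add: g_def)
  qed (simp add: g_def)
  have [measurable]: "g \<in> borel_measurable lborel" unfolding g_def by measurable
  let ?h = "\<lambda>x. sqrt (4 * t - x\<^sup>2) / (2 * pi * t) * x ^ k"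
  have "continuous_on ?S ?h" using assms by (intro continuous_intros) auto
  then have si: "set_integrable lborel ?S ?h" by (rule borel_integrable_atLeastAtMost')
  have gh: "indicator ?S x *\<^sub>R ?h x = g x * x ^ k" for x by (simp add: g_def)
  have int: "integrable lborel (\<lambda>x. g x * x ^ k)"
    using si unfolding set_integrable_def gh .
  have "(LINT x:?S|lborel. ?h x) = integral ?S ?h"
    using si by (rule set_borel_integral_eq_integral(2))
  then have val: "(\<integral>x. g x * x ^ k \<partial>lborel) = sqrt t ^ k * real (fock [] (replicate k 1))"
    unfolding set_lebesgue_integral_def gh using integral_unique[OF semicircle_moment[OF assms, of k 1]] by simp
  show "integrable (semicircle t) (\<lambda>u. u ^ k)"
    unfolding sc using int nonneg by (subst integrable_real_density) auto
  show "(\<integral>u. u ^ k \<partial>semicircle t) = sqrt t ^ k * real (fock [] (replicate k 1))"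
    unfolding sc using val nonneg by (subst integral_real_density) auto
qed

context input_variables
begin

lemma free_brownian_motion_wigner: "free_brownian_motion limit_alg wigner_state ncvar"
  unfolding free_brownian_motion_def
proof (intro conjI allI impI ballI)
  show "star_prob_space limit_alg wigner_state" by (rule star_prob_space_wigner)
  show "ncvar t \<in> carrier limit_alg" "star limit_alg (ncvar t) = ncvar t" if "0 \<le> t" for t
    using that by (auto simp: ncpolys_ncvar ncstar_ncvar)
next
  fix x y assume "x \<in> gen_alg limit_alg (ncvar ` {0..})" "y \<in> gen_alg limit_alg (ncvar ` {0..})"
  moreover have "gen_alg limit_alg (ncvar ` {0..}) \<subseteq> ncpolys {0..}"
    by (rule gen_alg_subset) (auto intro: ncpolys_ncvar)
  ultimately have xy: "x \<in> ncpolys {0..}" "y \<in> ncpolys {0..}" by blast+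
  obtain C where C: "(2::nat) \<in> {1, 2}" "link_function 2 wigner_link" "fibre_bound wigner_link C"
    "all_word_limits_exist wigner_link" by (rule wigner_facts)
  show "wigner_state (x \<otimes>\<^bsub>limit_alg\<^esub> ncvar 0 \<otimes>\<^bsub>limit_alg\<^esub> y) = 0"
    using limit_state_zero_time[OF C xy] by simp
next
  fix p and t :: "nat \<Rightarrow> real" assume "0 \<le> t 0 \<and> (\<forall>r\<in>{1..p}. t (r - 1) < t r)"
  then have t: "increasing_times p t" by (simp add: increasing_times_def)
  have "gen_alg limit_alg {ncvar (t r) \<ominus>\<^bsub>limit_alg\<^esub> ncvar (t (r - 1))} = gen_alg limit_alg {increment_poly t r}"
    if r: "r \<in> {1..p}" for r
  proof -
    have "0 \<le> t r" "0 \<le> t (r - 1)" using r increasing_times_nonneg[OF t] by auto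
    then show ?thesis unfolding limit_alg_def increment_poly_def
      by (subst free_star_alg_minus) (auto intro: ncpolys_ncvar)
  qed
  then show "freely_independent limit_alg wigner_state {1..p}
      (\<lambda>r. gen_alg limit_alg {ncvar (t r) \<ominus>\<^bsub>limit_alg\<^esub> ncvar (t (r - 1))})"
    using increments_free[OF t] by (subst freely_independent_cong) auto
next
  fix s t :: real assume st: "0 \<le> s" "0 \<le> t"
  interpret N: star_prob_space limit_alg wigner_state by (rule star_prob_space_wigner)
  let ?x = "ncvar (s + t) - ncvar s :: real ncpoly"
  have x: "ncvar (s + t) \<ominus>\<^bsub>limit_alg\<^esub> ncvar s = ?x"
    unfolding limit_alg_def using st by (intro free_star_alg_minus ncpolys_ncvar) auto
  have "integrable (semicircle t) (\<lambda>u. u ^ k) \<and>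
      wigner_state (?x ^ k) = complex_of_real (\<integral>u. u ^ k \<partial>semicircle t)" for k
  \<comment> \<open>For \<open>t = 0\<close> the increment is the zero polynomial and the law is the
    point mass at 0, so both moments are \<open>0 ^ k\<close>, with value 1 at
    \<open>k = 0\<close>.\<close>
  proof (cases "t = 0")
    case True
    have "integrable (return borel 0) (\<lambda>u::real. u ^ k)"
    proof (rule integrable_cong_AE_imp)
      show "integrable (return borel 0) (\<lambda>_::real. (0::real) ^ k)"
        using prob_space.finite_measure[OF prob_space_return[of "0::real" borel]]
        by (intro finite_measure.integrable_const) auto
      show "AE u in return borel (0::real). (0::real) ^ k = u ^ k" by (subst AE_return) auto
    qed auto
    moreover have "(\<integral>u. u ^ k \<partial>return borel (0::real)) = 0 ^ k" by (rule integral_return) auto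
    moreover have "wigner_state 0 = 0" using wigner_state_smult[of 0 0] by simp
    moreover have "wigner_state 1 = 1" using N.state_one by simp
    ultimately show ?thesis using True by (cases k) (simp_all add: semicircle_def)
  next
    case False
    then have t: "t > 0" using st by simp
    \<comment> \<open>A grid with the single interval from \<open>s\<close> to \<open>s + t\<close>,
      numbered 1, turns the power of the increment into the constant word
      \<open>replicate k 1\<close>.\<close>
    define tt where "tt i = (if i = 0 then s else s + t)" for i :: nat
    have tt: "increasing_times 1 tt" using st t by (simp add: increasing_times_def tt_def)
    have "?x ^ k = prod_list (map (increment_poly tt) (replicate k 1))"
      by (simp add: increment_poly_def tt_def prod_list_replicate)
    then have "wigner_state (?x ^ k) = foldr (field_op (amplitude tt)) (replicate k 1) vacuum []"
      using wigner_state_increments[OF tt, of "replicate k 1"] by (simp add: set_replicate_conv_if)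
    also have "\<dots> = complex_of_real (sqrt t ^ k * real (fock [] (replicate k 1)))"
      unfolding field_ops_vacuum using amplitude_def[OF tt] by (simp add: prod_list_replicate tt_def)
    finally show ?thesis using semicircle_moments[OF t, of k] by simp
  qed
  moreover have "?x [^]\<^bsub>limit_alg\<^esub> k = ?x ^ k" for k :: nat
    unfolding limit_alg_def by (rule free_star_alg_pow)
  ultimately show "has_distribution limit_alg wigner_state (ncvar (s + t) \<ominus>\<^bsub>limit_alg\<^esub> ncvar s) (semicircle t)"
    unfolding has_distribution_def x by (simp only: simp_thms)
qed

end

section \<open>Gaussian moments and Brownian motion\<close>

lemma matchings_even: "real (matchings 0 (2 * k)) = fact (2 * k) / (2 ^ k * fact k)"
proof (induction k)
  case (Suc k)
  have e: "2 * Suc k = Suc (Suc (2 * k))" by simp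
  have "real (matchings 0 (2 * Suc k)) = real (Suc (2 * k)) * (fact (2 * k) / (2 ^ k * fact k))"
    by (simp only: e matchings_0(1) of_nat_mult Suc.IH)
  also have "\<dots> = fact (2 * Suc k) / (2 ^ Suc k * fact (Suc k))"
  proof -
    have n: "(fact (Suc (Suc (2 * k))) :: real) = (2 * (1 + real k)) * (real (Suc (2 * k)) * fact (2 * k))"
      by (simp add: algebra_simps)
    have d: "(2 :: real) ^ Suc k * fact (Suc k) = (2 * (1 + real k)) * (2 ^ k * fact k)"
      by (simp add: algebra_simps)
    have "0 < 2 * (1 + real k)" by (intro mult_pos_pos add_pos_nonneg) auto
    then have nz: "2 * (1 + real k) \<noteq> 0" by simp
    show ?thesis unfolding e n d mult_divide_mult_cancel_left[OF nz] by simp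
  qed
  finally show ?case .
qed simp

lemma matchings_odd: "matchings 0 (2 * k + 1) = 0"
  by (induction k) (simp_all add: matchings_0 numeral_2_eq_2 del: matchings.simps(2))

text \<open>The pairings of \<open>k\<close> points number \<open>(k - 1)!!\<close> for even
  \<open>k\<close> and zero for odd \<open>k\<close>, exactly the standard normal moments.\<close>

lemma normal_moment_matchings:
  assumes "\<sigma> > 0"
  shows "has_bochner_integral lborel (\<lambda>x. normal_density 0 \<sigma> x * x ^ k) (\<sigma> ^ k * real (matchings 0 k))"
proof (cases "even k")
  case True
  then obtain m where k: "k = 2 * m" by (elim evenE)
  have "has_bochner_integral lborel (\<lambda>x. normal_density 0 \<sigma> x * (x - 0) ^ (2 * m)) (fact (2 * m) / ((2 / \<sigma>\<^sup>2) ^ m * fact m))"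
    using assms by (rule normal_moment_even)
  moreover have "fact (2 * m) / ((2 / \<sigma>\<^sup>2) ^ m * fact m) = \<sigma> ^ k * real (matchings 0 k)"
    unfolding k matchings_even using assms by (simp add: power_divide power_mult[symmetric] field_simps)
  ultimately show ?thesis using k by simp
next
  case False
  then obtain m where k: "k = 2 * m + 1" by (elim oddE)
  have "has_bochner_integral lborel (\<lambda>x. normal_density 0 \<sigma> x * (x - 0) ^ (2 * m + 1)) 0"
    using assms by (rule normal_moment_odd)
  then show ?thesis unfolding k matchings_odd by simp
qed

lemma prod_list_sum_expand:
  fixes b :: "'r \<Rightarrow> real"
  shows "prod_list (map (\<lambda>s. \<Sum>r\<in>R s. b r) u) = (\<Sum>rs\<in>listset (map R u). prod_list (map b rs))"
  by (induction u) (simp_all add: sum_set_Cons sum_product)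

lemma brownian_increment_product:
  assumes W: "standard_brownian_motion N W" and t: "increasing_times p t" and rs: "set rs \<subseteq> {1..p}"
  shows "has_bochner_integral N (\<lambda>\<omega>. prod_list (map (\<lambda>r. W (t r) \<omega> - W (t (r - 1)) \<omega>) rs))
     (weight t rs * (\<Prod>r\<in>{1..p}. real (matchings 0 (count_list rs r))))"
proof -
  interpret prob_space N using W by (simp add: standard_brownian_motion_def)
  define D where "D r \<omega> = W (t r) \<omega> - W (t (r - 1)) \<omega>" for r \<omega>
  have ind: "indep_vars (\<lambda>_. borel) D {1..p}"
    using W t unfolding standard_brownian_motion_def increasing_times_def D_def[abs_def] by blast
  then have ind_pow: "indep_vars (\<lambda>_. borel) (\<lambda>r \<omega>. D r \<omega> ^ count_list rs r) {1..p}"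
    by (rule indep_vars_compose2) auto
  have moment: "integrable N (\<lambda>\<omega>. D r \<omega> ^ k) \<and>
      expectation (\<lambda>\<omega>. D r \<omega> ^ k) = sqrt (t r - t (r - 1)) ^ k * real (matchings 0 k)" if r: "r \<in> {1..p}" for r k
  proof -
    have pos: "t r - t (r - 1) > 0" "0 \<le> t (r - 1)"
      using t r increasing_times_nonneg[OF t, of "r - 1"] unfolding increasing_times_def by auto
    have "distributed N lborel (\<lambda>\<omega>. W (t (r - 1) + (t r - t (r - 1))) \<omega> - W (t (r - 1)) \<omega>)
        (normal_density 0 (sqrt (t r - t (r - 1))))"
      using W pos unfolding standard_brownian_motion_def by blast
    then have dist: "distributed N lborel (D r) (normal_density 0 (sqrt (t r - t (r - 1))))"
      by (simp add: D_def[abs_def])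
    have b: "has_bochner_integral lborel (\<lambda>x. normal_density 0 (sqrt (t r - t (r - 1))) x * x ^ k)
        (sqrt (t r - t (r - 1)) ^ k * real (matchings 0 k))"
      using pos by (intro normal_moment_matchings) simp
    have "integrable N (\<lambda>\<omega>. D r \<omega> ^ k)"
      using distributed_integrable[OF dist, of "\<lambda>x. x ^ k"] b by (simp add: has_bochner_integral_iff)
    moreover have "expectation (\<lambda>\<omega>. D r \<omega> ^ k) = sqrt (t r - t (r - 1)) ^ k * real (matchings 0 k)"
      using distributed_integral[OF dist, of "\<lambda>x. x ^ k"] b by (simp add: has_bochner_integral_iff)
    ultimately show ?thesis by blast
  qed
  have eq: "prod_list (map (\<lambda>r. D r \<omega>) rs) = (\<Prod>r\<in>{1..p}. D r \<omega> ^ count_list rs r)" for \<omega>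
    using rs by (intro prod_list_map_eq_prod_count) auto
  have w: "weight t rs = (\<Prod>r\<in>{1..p}. sqrt (t r - t (r - 1)) ^ count_list rs r)"
    unfolding weight_def using rs by (intro prod_list_map_eq_prod_count) auto
  have "integrable N (\<lambda>\<omega>. \<Prod>r\<in>{1..p}. D r \<omega> ^ count_list rs r)"
    using ind_pow moment by (intro indep_vars_integrable) auto
  moreover have "expectation (\<lambda>\<omega>. \<Prod>r\<in>{1..p}. D r \<omega> ^ count_list rs r) =
      (\<Prod>r\<in>{1..p}. expectation (\<lambda>\<omega>. D r \<omega> ^ count_list rs r))"
    using ind_pow moment by (intro indep_vars_lebesgue_integral) auto
  moreover have "\<dots> = weight t rs * (\<Prod>r\<in>{1..p}. real (matchings 0 (count_list rs r)))"
    unfolding w prod.distrib[symmetric] using moment by (intro prod.cong) auto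
  ultimately show ?thesis unfolding D_def[symmetric] eq by (simp add: has_bochner_integral_iff)
qed

text \<open>The same grid and the same expansion as for words in the matrices, so that only the
  coefficients of corresponding terms remain to be compared.\<close>

lemma brownian_word_moment:
  assumes W: "standard_brownian_motion N W" and t: "increasing_times p t" "t 0 = 0"
    and idx: "\<And>s. s \<in> set u \<Longrightarrow> idx s \<le> p \<and> t (idx s) = s"
  shows "(\<integral>\<omega>. prod_list (map (\<lambda>s. W s \<omega>) u) \<partial>N) =
     (\<Sum>rs\<in>listset (map (\<lambda>s. {1..idx s}) u). weight t rs * (\<Prod>r\<in>{1..p}. real (matchings 0 (count_list rs r))))"
proof -
  let ?D = "\<lambda>\<omega> r. W (t r) \<omega> - W (t (r - 1)) \<omega>" and ?S = "listset (map (\<lambda>s. {1..idx s}) u)"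
  have sub: "set rs \<subseteq> {1..p}" if "rs \<in> ?S" for rs
    using listset_set[OF that] idx by fastforce
  have "0 \<le> s" if "s \<in> set u" for s
    using idx[OF that] increasing_times_nonneg[OF t(1), of "idx s"] by auto
  then have [measurable]: "W s \<in> borel_measurable N" if "s \<in> set u" for s
    using W that unfolding standard_brownian_motion_def by blast
  have meas: "(\<lambda>\<omega>. prod_list (map (\<lambda>s. W s \<omega>) v)) \<in> borel_measurable N" if "set v \<subseteq> set u" for v
    using that by (induction v) auto
  have bi: "has_bochner_integral N (\<lambda>\<omega>. \<Sum>rs\<in>?S. prod_list (map (?D \<omega>) rs))
      (\<Sum>rs\<in>?S. weight t rs * (\<Prod>r\<in>{1..p}. real (matchings 0 (count_list rs r))))"
    using sub by (intro has_bochner_integral_sum brownian_increment_product[OF W t(1)]) auto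
  have "AE \<omega> in N. W 0 \<omega> = 0" using W by (simp add: standard_brownian_motion_def)
  \<comment> \<open>Telescoping starts from \<open>W 0 = 0\<close>, which holds almost surely, hence
    so does the expansion.\<close>
  then have "AE \<omega> in N. prod_list (map (\<lambda>s. W s \<omega>) u) = (\<Sum>rs\<in>?S. prod_list (map (?D \<omega>) rs))"
  proof eventually_elim
    case (elim \<omega>)
    have tel: "W (t k) \<omega> = (\<Sum>r\<in>{1..k}. ?D \<omega> r)" for k
      by (induction k) (simp_all add: t(2) elim)
    have "map (\<lambda>s. W s \<omega>) u = map (\<lambda>s. \<Sum>r\<in>{1..idx s}. ?D \<omega> r) u"
      unfolding tel[symmetric] using idx by simp
    then show ?case by (simp only: prod_list_sum_expand)
  qed
  then have "(\<integral>\<omega>. prod_list (map (\<lambda>s. W s \<omega>) u) \<partial>N) = (\<integral>\<omega>. (\<Sum>rs\<in>?S. prod_list (map (?D \<omega>) rs)) \<partial>N)"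
    using meas[of u] has_bochner_integral_iff[THEN iffD1, OF bi] by (intro integral_cong_AE) auto
  also have "\<dots> = (\<Sum>rs\<in>?S. weight t rs * (\<Prod>r\<in>{1..p}. real (matchings 0 (count_list rs r))))"
    using bi by (rule has_bochner_integral_integral_eq)
  finally show ?thesis .
qed

text \<open>All densities are 1, so the sum counts indexed words, and this count is a product over
  the time intervals.\<close>

lemma circulant_limit_density_sum:
  assumes "set rs \<subseteq> {1..p}"
  shows "limit_density_sum circulant_link rs = (\<Prod>r\<in>{1..p}. real (matchings 0 (count_list rs r)))"
proof -
  have "limit_density_sum circulant_link rs = (\<Sum>v\<in>indexed_pair_words rs. 1)"
    unfolding limit_density_sum_def
    using circulant_density indexed_pair_words_drop(1) by (intro sum.cong refl limI) auto
  then show ?thesis using card_indexed_pair_words[of "{1..p}" rs] assms by simp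
qed

text \<open>The exponent is \<open>k_r\<close>, a half integer when the count is odd; real powers
  are harmless here because the time differences are positive.\<close>

lemma weight_eq_powr:
  assumes "increasing_times p t" "set rs \<subseteq> {1..p}"
  shows "weight t rs = (\<Prod>r = 1..p. (t r - t (r - 1)) powr (real (count_list rs r) / 2))"
proof -
  have "weight t rs = (\<Prod>r\<in>{1..p}. sqrt (t r - t (r - 1)) ^ count_list rs r)"
    unfolding weight_def using assms(2) by (intro prod_list_map_eq_prod_count) auto
  also have "\<dots> = (\<Prod>r = 1..p. (t r - t (r - 1)) powr (real (count_list rs r) / 2))"
  proof (intro prod.cong refl)
    fix r assume "r \<in> {1..p}"
    then have "t r - t (r - 1) > 0" using assms(1) by (auto simp: increasing_times_def)
    then show "sqrt (t r - t (r - 1)) ^ count_list rs r = (t r - t (r - 1)) powr (real (count_list rs r) / 2)"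
      by (simp add: powr_half_sqrt[symmetric] powr_power)
  qed
  finally show ?thesis .
qed

theorem theorem3p3:
  fixes M :: "'w measure" and X :: "'w input"
  assumes "prob_space M" and "assumption_I M X"
  shows
    "(\<forall>d\<in>{1, 2}. \<forall>L. link_function d L \<and> symmetric_link L \<and> property_B d L \<longrightarrow>
       (\<forall>p. \<forall>t::nat \<Rightarrow> real. \<forall>rs.
          0 \<le> t 0 \<and> (\<forall>r\<in>{1..p}. t (r - 1) < t r) \<and>
          rs \<noteq> [] \<and> set rs \<subseteq> {1..p} \<and> word_limits_exist L rs \<longrightarrow>
          (\<forall>m\<ge>1.
             (length rs = 2 * m - 1 \<longrightarrow>
                (\<lambda>n. mean_trace M n (alg_prod (rmat_alg M n) (map (increment_matrix X L t n) rs)))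
                  \<longlonglongrightarrow> 0) \<and>
             (length rs = 2 * m \<longrightarrow>
                (\<lambda>n. mean_trace M n (alg_prod (rmat_alg M n) (map (increment_matrix X L t n) rs)))
                  \<longlonglongrightarrow> complex_of_real
                    ((\<Prod>r = 1..p. (t r - t (r - 1)) powr (real (count_list rs r) / 2)) *
                     (\<Sum>v\<in>indexed_pair_words rs. lim (word_density L m (drop_indices v))))))) \<and>
       (all_word_limits_exist L \<longrightarrow>
          (\<forall>t\<ge>0. ncvar t \<in> carrier limit_alg \<and> star limit_alg (ncvar t) = ncvar t) \<and>
          (\<forall>h\<in>carrier limit_alg.
             (\<lambda>n. mean_trace M n (nc_eval (rmat_alg M n) (scaled_matrix X L n) h))
               \<longlonglongrightarrow> limit_state M X L h) \<and>
          star_prob_space limit_alg (limit_state M X L) \<and>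
          converges_algebraically (rmat_alg M) (mean_trace M) (scaled_matrix X L)
            limit_alg (limit_state M X L) ncvar)) \<and>
     all_word_limits_exist wigner_link \<and>
     free_brownian_motion limit_alg (limit_state M X wigner_link) ncvar \<and>
     all_word_limits_exist circulant_link \<and>
     (\<forall>(N :: 'b measure) W. standard_brownian_motion N W \<longrightarrow>
        (\<forall>ts. set ts \<subseteq> {0..} \<longrightarrow>
           limit_state M X circulant_link (alg_prod limit_alg (map ncvar ts)) =
             complex_of_real (\<integral>\<omega>. (\<Prod>t\<leftarrow>ts. W t \<omega>) \<partial>N)))"
proof -
  interpret input_variables M X
    using assms by (intro input_variables.intro input_variables_axioms.intro)
  show ?thesis
  proof (intro conjI ballI allI impI)
    fix d :: nat and L assume d: "d \<in> {1, 2}"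
      and L: "link_function d L \<and> symmetric_link L \<and> property_B d L"
    then have link: "link_function d L" and sym: "symmetric_link L" by auto
    obtain C where C: "fibre_bound L C" using L property_B_fibre_bound by blast
    {
      fix p and t :: "nat \<Rightarrow> real" and rs and m :: nat
      assume h: "0 \<le> t 0 \<and> (\<forall>r\<in>{1..p}. t (r - 1) < t r) \<and>
          rs \<noteq> [] \<and> set rs \<subseteq> {1..p} \<and> word_limits_exist L rs" and m: "1 \<le> m"
      then have t: "increasing_times p t" and rs: "set rs \<subseteq> {1..p}" by (auto simp: increasing_times_def)
      have "increment_trace L t rs \<longlonglongrightarrow> complex_of_real (weight t rs * limit_density_sum L rs)"
        using h word_limits_existD by (intro increment_trace_limit[OF d link C t rs]) blast
      then have lim: "(\<lambda>n. mean_trace M n (alg_prod (rmat_alg M n) (map (increment_matrix X L t n) rs)))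
          \<longlonglongrightarrow> complex_of_real (weight t rs * limit_density_sum L rs)"
        unfolding increment_trace_def[OF d link C, abs_def] .
      show "(\<lambda>n. mean_trace M n (alg_prod (rmat_alg M n) (map (increment_matrix X L t n) rs))) \<longlonglongrightarrow> 0"
        if "length rs = 2 * m - 1"
      proof -
        have "odd (length rs)" using that m by simp
        \<comment> \<open>Pair-matched words have even length, so the limit formula reduces to an
          empty sum.\<close>
        then have "indexed_pair_words rs = {}" using indexed_pair_words_drop(3) by blast
        then show ?thesis using lim by (simp add: limit_density_sum_def)
      qed
      show "(\<lambda>n. mean_trace M n (alg_prod (rmat_alg M n) (map (increment_matrix X L t n) rs)))
          \<longlonglongrightarrow> complex_of_real
            ((\<Prod>r = 1..p. (t r - t (r - 1)) powr (real (count_list rs r) / 2)) *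
             (\<Sum>v\<in>indexed_pair_words rs. lim (word_density L m (drop_indices v))))"
        if "length rs = 2 * m"
      proof -
        have "limit_density_sum L rs = (\<Sum>v\<in>indexed_pair_words rs. lim (word_density L m (drop_indices v)))"
          unfolding limit_density_sum_def using that indexed_pair_words_drop(2)
          by (intro sum.cong refl) (simp add: word_density_eq_density)
        then show ?thesis using lim unfolding weight_eq_powr[OF t rs] by simp
      qed
    }
    show "ncvar t \<in> carrier limit_alg" "star limit_alg (ncvar t) = ncvar t" if "0 \<le> t" for t :: real
      using that by (auto simp: ncpolys_ncvar ncstar_ncvar)
    assume lims: "all_word_limits_exist L"
    show "(\<lambda>n. mean_trace M n (nc_eval (rmat_alg M n) (scaled_matrix X L n) h)) \<longlonglongrightarrow> limit_state M X L h"
      if "h \<in> carrier limit_alg" for h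
      using that limit_state_linear_ext(1)[OF d link C lims] by simp
    show "star_prob_space limit_alg (limit_state M X L)"
      by (rule star_prob_space_limit[OF d link C lims sym])
    show "converges_algebraically (rmat_alg M) (mean_trace M) (scaled_matrix X L)
        limit_alg (limit_state M X L) ncvar"
      by (rule converges_algebraically_limit[OF d link C lims])
  next
    show "all_word_limits_exist wigner_link" "all_word_limits_exist circulant_link"
      by (rule all_word_limits_exist_wigner all_word_limits_exist_circulant)+
    show "free_brownian_motion limit_alg (limit_state M X wigner_link) ncvar"
      by (rule free_brownian_motion_wigner)
  next
    fix N :: "'b measure" and W :: "real \<Rightarrow> 'b \<Rightarrow> real" and ts :: "real list"
    assume W: "standard_brownian_motion N W" and ts: "set ts \<subseteq> {0..}"
    obtain p t idx where t: "increasing_times p t" "t 0 = 0"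
      and idx: "\<And>s. s \<in> set ts \<Longrightarrow> idx s \<le> p \<and> t (idx s) = s"
      using time_grid[of "set ts"] ts by auto
    obtain C where C: "fibre_bound circulant_link C"
      using property_B_fibre_bound link_function_circulant property_B_circulant by blast
    have d: "(1::nat) \<in> {1, 2}" by simp
    let ?S = "listset (map (\<lambda>s. {1..idx s}) ts)"
    have "alg_prod limit_alg (map ncvar ts) = prod_list (map ncvar ts)"
      unfolding limit_alg_def by (rule alg_prod_free_star_alg)
    then have "limit_state M X circulant_link (alg_prod limit_alg (map ncvar ts)) =
        (\<Sum>rs\<in>?S. complex_of_real (weight t rs * limit_density_sum circulant_link rs))"
      using limit_state_words[OF d link_function_circulant C all_word_limits_exist_circulant t(1), of ts idx] t(2) idx ts
      by simp
    also have "\<dots> = (\<Sum>rs\<in>?S. complex_of_real (weight t rs * (\<Prod>r\<in>{1..p}. real (matchings 0 (count_list rs r)))))"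
    proof (intro sum.cong refl)
      fix rs assume "rs \<in> ?S"
      then have "set rs \<subseteq> {1..p}" using listset_set idx by fastforce
      then show "complex_of_real (weight t rs * limit_density_sum circulant_link rs) =
          complex_of_real (weight t rs * (\<Prod>r\<in>{1..p}. real (matchings 0 (count_list rs r))))"
        by (simp only: circulant_limit_density_sum)
    qed
    also have "\<dots> = complex_of_real (\<integral>\<omega>. (\<Prod>t\<leftarrow>ts. W t \<omega>) \<partial>N)"
      using brownian_word_moment[OF W t idx] by simp
    finally show "limit_state M X circulant_link (alg_prod limit_alg (map ncvar ts)) =
        complex_of_real (\<integral>\<omega>. (\<Prod>t\<leftarrow>ts. W t \<omega>) \<partial>N)" .
  qed
qed

end
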